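(* Let $k$ be a field, $Q$ a finite quiver without sinks, $A=kQ/J^2$, $B=L_k(Q)^{\rm op}$, and $\mathcal{I}^{\bullet}$ the injective Leavitt complex of $Q$ with its right $B$-action. For each $i\in Q_0$, $l\in\mathbb{Z}$ and $(p,q)\in\mathbf{B}^l_i$, let $x\zeta_{(p,q)}\in I_i\zeta_{(p,q)}$. Then for each vertex $j\in Q_0$ and each arrow $\beta\in Q_1$: (1) $\partial^{l}(x\zeta_{(p,q)}\cdot e_j)=\partial^{l}(x\zeta_{(p,q)})\cdot e_j$; (2) $\partial^{l+1}(x\zeta_{(p,q)}\cdot\beta)=\partial^{l}(x\zeta_{(p,q)})\cdot\beta$; (3) $\partial^{l-1}(x\zeta_{(p,q)}\cdot\beta^{*})=\partial^{l}(x\zeta_{(p,q)})\cdot\beta^{*}$. In other words, the right $B$-action makes $\mathcal{I}^{\bullet}$ a right dg $B$-module and thus a dg $A$-$B$-bimodule.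
   Context: Quivers and $A$. $k$ is a field and $Q=(Q_0,Q_1;s,t)$ is a finite quiver without sinks: $Q_0$ is a finite set of vertices, $Q_1$ a finite set of arrows, $s,t:Q_1\to Q_0$ give starting and terminating vertices, and every vertex is the start of at least one arrow. A path of length $n\geq 1$ is a sequence $p=\alpha_n\cdots\alpha_1$ of arrows with $t(\alpha_j)=s(\alpha_{j+1})$ for $1\le j\le n-1$; $l(p)=n$, $s(p)=s(\alpha_1)$, $t(p)=t(\alpha_n)$. Each vertex $i$ has a trivial path $e_i$ of length $0$ with $s(e_i)=t(e_i)=i$. In the path algebra $kQ$ the product $pq$ of paths is the concatenation (first $q$, then $p$) if $s(p)=t(q)$, and $0$ otherwise. $J$ is the two-sided ideal of $kQ$ generated by arrows; $A=kQ/J^2$ has $k$-basis $\{e_i\}_{i\in Q_0}\cup Q_1$ and is viewed as a dg algebra concentrated in degree zero. Special arrows and admissible pairs. For each vertex $i$ fix one arrow starting at $i$, called the special arrow starting at $i$. For a special arrow $\alpha$ put $S(\alpha)=\{\beta\in Q_1\mid s(\beta)=s(\alpha),\ \beta\ne\alpha\}$. A pair $(p,q)$ of paths $p=\alpha_m\cdots\alpha_1$, $q=\beta_n\cdots\beta_1$ with $m,n\ge 1$ is admissible if $t(p)=t(q)$ and either $\alpha_m\ne\beta_n$, or $\alpha_m=\beta_n$ is not special; moreover for every path $r$ the pairs $(r,e_{t(r)})$ and $(e_{t(r)},r)$ are admissible. For $i\in Q_0$, $l\in\mathbb{Z}$ let $\mathbf{B}^l_i$ be the set of admissible pairs $(p,q)$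 with $l(q)-l(p)=l$ and $s(q)=i$. Injective modules. $I_i=\mathrm{Hom}_k(e_iA,k)$ (a left $A$-module), with basis $\{e_i^{\sharp}\}\cup\{\alpha^{\sharp}\mid \alpha\in Q_1,\ t(\alpha)=i\}$ dual to the basis $\{e_i\}\cup\{\alpha\mid t(\alpha)=i\}$ of $e_iA$. For a set $X$ and module $M$, $M^{(X)}=\bigoplus_{x\in X}M\zeta_x$ is the coproduct of copies of $M$, $m\zeta_x$ being the element $m$ in the copy indexed by $x$. Truncations. For $p=\alpha_n\cdots\alpha_1$ with $n\ge2$: $\widehat{p}=\alpha_{n-1}\cdots\alpha_1$ and $\widetilde{p}=\alpha_n\cdots\alpha_2$; for an arrow $\alpha$: $\widehat{\alpha}=e_{s(\alpha)}$, $\widetilde{\alpha}=e_{t(\alpha)}$. Injective Leavitt complex. $\mathcal{I}^{\bullet}=(\mathcal{I}^l,\partial^l)_{l\in\mathbb{Z}}$ has $\mathcal{I}^l=\bigoplus_{i\in Q_0}I_i^{(\mathbf{B}^l_i)}$ and, for $i\in Q_0$, $(p,q)\in\mathbf{B}^l_i$ and $\alpha\in Q_1$ with $t(\alpha)=i$: $\partial^l(e_i^{\sharp}\zeta_{(p,q)})=0$; $\partial^l(\alpha^{\sharp}\zeta_{(p,q)})=e_{s(\alpha)}^{\sharp}\zeta_{(\widehat{p},e_{s(\alpha)})}-\sum_{\beta\in S(\alpha)}e_{s(\alpha)}^{\sharp}\zeta_{(\beta\widehat{p},\beta)}$ if $q=e_i$, $p=\alpha\widehat{p}$ and $\alpha$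 is special; and $\partial^l(\alpha^{\sharp}\zeta_{(p,q)})=e_{s(\alpha)}^{\sharp}\zeta_{(p,q\alpha)}$ otherwise. Leavitt path algebra. $L_k(Q)$ is the $k$-algebra generated by $\{e_i\mid i\in Q_0\}\cup\{\alpha\mid\alpha\in Q_1\}\cup\{\alpha^*\mid\alpha\in Q_1\}$ subject to: $e_ie_j=\delta_{i,j}e_i$; $e_{t(\alpha)}\alpha=\alpha e_{s(\alpha)}=\alpha$; $e_{s(\alpha)}\alpha^*=\alpha^*e_{t(\alpha)}=\alpha^*$; $\alpha\beta^*=\delta_{\alpha,\beta}e_{t(\alpha)}$; $\sum_{\{\alpha\in Q_1\mid s(\alpha)=i\}}\alpha^*\alpha=e_i$ for each $i\in Q_0$. Grading: $|e_i|=0$, $|\alpha|=1$, $|\alpha^*|=-1$. $B=L_k(Q)^{\rm op}$ is the usual opposite algebra, with product $a\circ b=ba$, graded by $B^n=L_k(Q)^n$, a dg algebra with trivial differential. Right $B$-action on $\mathcal{I}^{\bullet}$. $\mathcal{I}^{\bullet}$ is a right (graded) $B$-module via: for $x\zeta_{(p,q)}\in I_i\zeta_{(p,q)}$, $(p,q)\in\mathbf{B}^l_i$, $j\in Q_0$, $\alpha\in Q_1$: $x\zeta_{(p,q)}\cdot e_j=\delta_{j,s(p)}x\zeta_{(p,q)}$; $x\zeta_{(p,q)}\cdot\alpha=\delta_{\alpha,\alpha_1}x\zeta_{(\widetilde{p},q)}$ if $p=\widetilde{p}\alpha_1$ (with $\alpha_1\in Q_1$), and $=\delta_{s(\alpha),t(q)}x\zeta_{(e_{t(\alpha)},\alpha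 q)}$ if $l(p)=0$; $x\zeta_{(p,q)}\cdot\alpha^*=x\zeta_{(e_{s(\alpha)},\widehat{q})}-\sum_{\beta\in S(\alpha)}x\zeta_{(\beta,\beta\widehat{q})}$ if $l(p)=0$, $q=\alpha\widehat{q}$ and $\alpha$ is special, and $=\delta_{s(p),t(\alpha)}x\zeta_{(p\alpha,q)}$ otherwise. Dg conventions. A right dg $B$-module $N$ is a right graded $B$-module with a differential $d_N$ of degree one such that $d_N(m\cdot b)=d_N(m)\cdot b+(-1)^{|m|}m\cdot d(b)$ for homogeneous elements. A dg $A$-$B$-bimodule is a left dg $A$-module that is also a right dg $B$-module with $(a\cdot m)\cdot b=a\cdot(m\cdot b)$. *)

theory Defs
  imports
    "Graph_Theory.Arc_Walk"
    "HOL-Algebra.QuotRing"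
    "HOL-Algebra.Ideal_Product"
    "HOL-Algebra.Module"
    "HOL-Algebra.Algebraic_Closure_Type"
    "HOL-Library.Poly_Mapping"
    "HOL-Library.Function_Algebras"
begin

section \<open>Differential graded algebras, modules and bimodules\<close>

text \<open>
  A graded \<open>K\<close>-module with an endomorphism, together with the \<open>mult\<close> and \<open>one\<close> fields that the
  record type \<^typ>\<open>('k, 'a) module\<close> already carries. For a dg algebra these two fields are its
  multiplication and its unit; for a dg module they are irrelevant.
\<close>

record ('k, 'a) dg = "('k, 'a) module" +
  part :: "int \<Rightarrow> 'a set"
  diff :: "'a \<Rightarrow> 'a"

definition make_dg ::
    "('k, 'a) module \<Rightarrow> (int \<Rightarrow> 'a set) \<Rightarrow> ('a \<Rightarrow> 'a) \<Rightarrow> ('k, 'a) dg" where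
  "make_dg M P d = module.extend M (dg.fields P d)"

definition sign_twist :: "('a, 'm) ring_scheme \<Rightarrow> int \<Rightarrow> 'a \<Rightarrow> 'a" where
  "sign_twist M n x = (if even n then x else \<ominus>\<^bsub>M\<^esub> x)"

text \<open>
  A cochain complex of \<open>K\<close>-modules, given by its total module \<open>M = \<Oplus>\<^sub>n part M n\<close>.
\<close>

locale dg_kmodule = module K M
  for K :: "'k ring" and M :: "('k, 'a) dg" +
  assumes part_submodule: "submodule (part M n) K M"
    and part_decomposition:
      "m \<in> carrier M \<Longrightarrow>
        \<exists>!c. (\<forall>n. c n \<in> part M n) \<and> finite {n. c n \<noteq> \<zero>\<^bsub>M\<^esub>} \<and>
             m = (\<Oplus>\<^bsub>M\<^esub>n\<in>{n. c n \<noteq> \<zero>\<^bsub>M\<^esub>}. c n)"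
    and diff_add: "\<lbrakk>x \<in> carrier M; y \<in> carrier M\<rbrakk> \<Longrightarrow>
      diff M (x \<oplus>\<^bsub>M\<^esub> y) = diff M x \<oplus>\<^bsub>M\<^esub> diff M y"
    and diff_smult: "\<lbrakk>c \<in> carrier K; x \<in> carrier M\<rbrakk> \<Longrightarrow>
      diff M (c \<odot>\<^bsub>M\<^esub> x) = c \<odot>\<^bsub>M\<^esub> diff M x"
    and diff_degree: "x \<in> part M n \<Longrightarrow> diff M x \<in> part M (n + 1)"
    and diff_diff: "x \<in> carrier M \<Longrightarrow> diff M (diff M x) = \<zero>\<^bsub>M\<^esub>"

locale dg_algebra = dg_kmodule K A + ring A
  for K :: "'k ring" and A :: "('k, 'a) dg" +
  assumes smult_mult_left: "\<lbrakk>c \<in> carrier K; x \<in> carrier A; y \<in> carrier A\<rbrakk> \<Longrightarrow>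
      (c \<odot>\<^bsub>A\<^esub> x) \<otimes>\<^bsub>A\<^esub> y = c \<odot>\<^bsub>A\<^esub> (x \<otimes>\<^bsub>A\<^esub> y)"
    and smult_mult_right: "\<lbrakk>c \<in> carrier K; x \<in> carrier A; y \<in> carrier A\<rbrakk> \<Longrightarrow>
      x \<otimes>\<^bsub>A\<^esub> (c \<odot>\<^bsub>A\<^esub> y) = c \<odot>\<^bsub>A\<^esub> (x \<otimes>\<^bsub>A\<^esub> y)"
    and one_degree: "\<one>\<^bsub>A\<^esub> \<in> part A 0"
    and mult_degree: "\<lbrakk>x \<in> part A m; y \<in> part A n\<rbrakk> \<Longrightarrow> x \<otimes>\<^bsub>A\<^esub> y \<in> part A (m + n)"
    and leibniz: "\<lbrakk>x \<in> part A m; y \<in> part A n\<rbrakk> \<Longrightarrow>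
      diff A (x \<otimes>\<^bsub>A\<^esub> y) = diff A x \<otimes>\<^bsub>A\<^esub> y \<oplus>\<^bsub>A\<^esub> sign_twist A m (x \<otimes>\<^bsub>A\<^esub> diff A y)"

locale left_dg_module = A: dg_algebra K A + N: dg_kmodule K N
  for K :: "'k ring" and A :: "('k, 'a) dg" and N :: "('k, 'n) dg"
    and lact :: "'a \<Rightarrow> 'n \<Rightarrow> 'n" +
  assumes lact_closed: "\<lbrakk>a \<in> carrier A; m \<in> carrier N\<rbrakk> \<Longrightarrow> lact a m \<in> carrier N"
    and lact_add_left: "\<lbrakk>a \<in> carrier A; a' \<in> carrier A; m \<in> carrier N\<rbrakk> \<Longrightarrow>
      lact (a \<oplus>\<^bsub>A\<^esub> a') m = lact a m \<oplus>\<^bsub>N\<^esub> lact a' m"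
    and lact_add_right: "\<lbrakk>a \<in> carrier A; m \<in> carrier N; m' \<in> carrier N\<rbrakk> \<Longrightarrow>
      lact a (m \<oplus>\<^bsub>N\<^esub> m') = lact a m \<oplus>\<^bsub>N\<^esub> lact a m'"
    and lact_smult_left: "\<lbrakk>c \<in> carrier K; a \<in> carrier A; m \<in> carrier N\<rbrakk> \<Longrightarrow>
      lact (c \<odot>\<^bsub>A\<^esub> a) m = c \<odot>\<^bsub>N\<^esub> lact a m"
    and lact_smult_right: "\<lbrakk>c \<in> carrier K; a \<in> carrier A; m \<in> carrier N\<rbrakk> \<Longrightarrow>
      lact a (c \<odot>\<^bsub>N\<^esub> m) = c \<odot>\<^bsub>N\<^esub> lact a m"
    and lact_one: "m \<in> carrier N \<Longrightarrow> lact \<one>\<^bsub>A\<^esub> m = m"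
    and lact_mult: "\<lbrakk>a \<in> carrier A; a' \<in> carrier A; m \<in> carrier N\<rbrakk> \<Longrightarrow>
      lact (a \<otimes>\<^bsub>A\<^esub> a') m = lact a (lact a' m)"
    and lact_degree: "\<lbrakk>a \<in> part A i; m \<in> part N n\<rbrakk> \<Longrightarrow> lact a m \<in> part N (i + n)"
    and lact_leibniz: "\<lbrakk>a \<in> part A i; m \<in> part N n\<rbrakk> \<Longrightarrow>
      diff N (lact a m) = lact (diff A a) m \<oplus>\<^bsub>N\<^esub> sign_twist N i (lact a (diff N m))"

locale right_dg_module = B: dg_algebra K B + N: dg_kmodule K N
  for K :: "'k ring" and B :: "('k, 'b) dg" and N :: "('k, 'n) dg"
    and ract :: "'n \<Rightarrow> 'b \<Rightarrow> 'n" +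
  assumes ract_closed: "\<lbrakk>m \<in> carrier N; b \<in> carrier B\<rbrakk> \<Longrightarrow> ract m b \<in> carrier N"
    and ract_add_right: "\<lbrakk>m \<in> carrier N; b \<in> carrier B; b' \<in> carrier B\<rbrakk> \<Longrightarrow>
      ract m (b \<oplus>\<^bsub>B\<^esub> b') = ract m b \<oplus>\<^bsub>N\<^esub> ract m b'"
    and ract_add_left: "\<lbrakk>m \<in> carrier N; m' \<in> carrier N; b \<in> carrier B\<rbrakk> \<Longrightarrow>
      ract (m \<oplus>\<^bsub>N\<^esub> m') b = ract m b \<oplus>\<^bsub>N\<^esub> ract m' b"
    and ract_smult_right: "\<lbrakk>c \<in> carrier K; m \<in> carrier N; b \<in> carrier B\<rbrakk> \<Longrightarrow>
      ract m (c \<odot>\<^bsub>B\<^esub> b) = c \<odot>\<^bsub>N\<^esub> ract m b"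
    and ract_smult_left: "\<lbrakk>c \<in> carrier K; m \<in> carrier N; b \<in> carrier B\<rbrakk> \<Longrightarrow>
      ract (c \<odot>\<^bsub>N\<^esub> m) b = c \<odot>\<^bsub>N\<^esub> ract m b"
    and ract_one: "m \<in> carrier N \<Longrightarrow> ract m \<one>\<^bsub>B\<^esub> = m"
    and ract_mult: "\<lbrakk>m \<in> carrier N; b \<in> carrier B; b' \<in> carrier B\<rbrakk> \<Longrightarrow>
      ract m (b \<otimes>\<^bsub>B\<^esub> b') = ract (ract m b) b'"
    and ract_degree: "\<lbrakk>m \<in> part N n; b \<in> part B i\<rbrakk> \<Longrightarrow> ract m b \<in> part N (n + i)"
    and ract_leibniz: "\<lbrakk>m \<in> part N n; b \<in> part B i\<rbrakk> \<Longrightarrow>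
      diff N (ract m b) = ract (diff N m) b \<oplus>\<^bsub>N\<^esub> sign_twist N n (ract m (diff B b))"

locale dg_bimodule = left_dg_module K A N lact + right_dg_module K B N ract
  for K :: "'k ring" and A :: "('k, 'a) dg" and B :: "('k, 'b) dg" and N :: "('k, 'n) dg"
    and lact :: "'a \<Rightarrow> 'n \<Rightarrow> 'n" and ract :: "'n \<Rightarrow> 'b \<Rightarrow> 'n" +
  assumes bimodule_assoc: "\<lbrakk>a \<in> carrier A; m \<in> carrier N; b \<in> carrier B\<rbrakk> \<Longrightarrow>
      ract (lact a m) b = lact a (ract m b)"


section \<open>Algebras with a multiplicative basis, quotients and opposites\<close>

text \<open>
  The algebra of a small category with set of morphisms \<open>Mor\<close>, partial composition \<open>mul\<close> and finite
  set of identities \<open>Ids\<close>: \<open>Mor\<close> is a basis, and the product of two non-composable basis elements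
  is 0. This covers path algebras (\<open>Mor\<close> the paths) and free algebras (\<open>Mor\<close> the words).
\<close>

definition scale :: "'k::field \<Rightarrow> ('b \<Rightarrow>\<^sub>0 'k) \<Rightarrow> ('b \<Rightarrow>\<^sub>0 'k)" where
  "scale c f = Poly_Mapping.map (\<lambda>x. c * x) f"

definition category_algebra ::
    "'b set \<Rightarrow> ('b \<Rightarrow> 'b \<Rightarrow> 'b option) \<Rightarrow> 'b set \<Rightarrow> ('k::field, 'b \<Rightarrow>\<^sub>0 'k) module" where
  "category_algebra Mor mul Ids =
    \<lparr>carrier = {f. Poly_Mapping.keys f \<subseteq> Mor},
     monoid.mult = (\<lambda>f g. \<Sum>p\<in>Poly_Mapping.keys f. \<Sum>q\<in>Poly_Mapping.keys g.
       (case mul p q of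
          None \<Rightarrow> 0
        | Some r \<Rightarrow> Poly_Mapping.single r (Poly_Mapping.lookup f p * Poly_Mapping.lookup g q))),
     monoid.one = (\<Sum>u\<in>Ids. Poly_Mapping.single u 1),
     ring.zero = 0,
     ring.add = (+),
     module.smult = scale\<rparr>"

definition quotient_algebra :: "('k, 'a) module \<Rightarrow> 'a set \<Rightarrow> ('k, 'a set) module" where
  "quotient_algebra R I =
    ring.extend (R Quot I) (module.fields (\<lambda>c C. \<Union>x\<in>C. I +>\<^bsub>R\<^esub> (c \<odot>\<^bsub>R\<^esub> x)))"

definition opposite_algebra :: "('k, 'a) module \<Rightarrow> ('k, 'a) module" where
  "opposite_algebra R = R\<lparr>monoid.mult := \<lambda>a b. b \<otimes>\<^bsub>R\<^esub> a\<rparr>"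


section \<open>Quivers, paths and admissible pairs\<close>

text \<open>
  A path is a pair of its starting vertex and its list of arrows in the order in which they are
  traversed: \<open>\<alpha>\<^sub>n \<cdots> \<alpha>\<^sub>1\<close> is \<open>(s(\<alpha>\<^sub>1), [\<alpha>\<^sub>1, \<dots>, \<alpha>\<^sub>n])\<close>, and \<open>e\<^sub>i\<close> is \<open>(i, [])\<close>.
\<close>

type_synonym ('v, 'a) path = "'v \<times> 'a list"

definition paths :: "('v, 'a) pre_digraph \<Rightarrow> ('v, 'a) path set" where
  "paths Q = {(i, as). \<exists>j. pre_digraph.awalk Q i as j}"

definition path_source :: "('v, 'a) path \<Rightarrow> 'v" where
  "path_source p = fst p"

definition path_target :: "('v, 'a) pre_digraph \<Rightarrow> ('v, 'a) path \<Rightarrow> 'v" where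
  "path_target Q p = pre_digraph.awlast Q (fst p) (snd p)"

definition path_length :: "('v, 'a) path \<Rightarrow> nat" where
  "path_length p = length (snd p)"

definition trivial_path :: "'v \<Rightarrow> ('v, 'a) path" where
  "trivial_path i = (i, [])"

definition arrow_path :: "('v, 'a) pre_digraph \<Rightarrow> 'a \<Rightarrow> ('v, 'a) path" where
  "arrow_path Q \<alpha> = (tail Q \<alpha>, [\<alpha>])"

text \<open>\<open>path_comp Q p q\<close> is \<open>pq\<close>: first \<open>q\<close>, then \<open>p\<close>.\<close>

definition path_comp ::
    "('v, 'a) pre_digraph \<Rightarrow> ('v, 'a) path \<Rightarrow> ('v, 'a) path \<Rightarrow> ('v, 'a) path option" where
  "path_comp Q p q =
    (if path_source p = path_target Q q then Some (fst q, snd q @ snd p) else None)"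

text \<open>For \<open>p = \<alpha>\<^sub>n \<cdots> \<alpha>\<^sub>1\<close>, \<open>hat_path p\<close> omits \<open>\<alpha>\<^sub>n\<close> and \<open>tilde_path Q p\<close> omits \<open>\<alpha>\<^sub>1\<close>.\<close>

definition hat_path :: "('v, 'a) path \<Rightarrow> ('v, 'a) path" where
  "hat_path p = (fst p, butlast (snd p))"

definition tilde_path :: "('v, 'a) pre_digraph \<Rightarrow> ('v, 'a) path \<Rightarrow> ('v, 'a) path" where
  "tilde_path Q p = (head Q (hd (snd p)), tl (snd p))"

text \<open>\<open>post_arrow \<beta> p\<close> is \<open>\<beta>p\<close> and \<open>pre_arrow Q p \<beta>\<close> is \<open>p\<beta>\<close>, for composable \<open>\<beta>\<close> and \<open>p\<close>.\<close>

definition post_arrow :: "'a \<Rightarrow> ('v, 'a) path \<Rightarrow> ('v, 'a) path" where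
  "post_arrow \<beta> p = (fst p, snd p @ [\<beta>])"

definition pre_arrow :: "('v, 'a) pre_digraph \<Rightarrow> ('v, 'a) path \<Rightarrow> 'a \<Rightarrow> ('v, 'a) path" where
  "pre_arrow Q p \<beta> = (tail Q \<beta>, \<beta> # snd p)"

text \<open>\<open>sp i\<close> is the chosen special arrow starting at the vertex \<open>i\<close>.\<close>

definition special :: "('v, 'a) pre_digraph \<Rightarrow> ('v \<Rightarrow> 'a) \<Rightarrow> 'a \<Rightarrow> bool" where
  "special Q sp \<alpha> \<longleftrightarrow> \<alpha> \<in> arcs Q \<and> sp (tail Q \<alpha>) = \<alpha>"

definition siblings :: "('v, 'a) pre_digraph \<Rightarrow> 'a \<Rightarrow> 'a set" where
  "siblings Q \<alpha> = {\<beta> \<in> arcs Q. tail Q \<beta> = tail Q \<alpha> \<and> \<beta> \<noteq> \<alpha>}"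

definition admissible ::
    "('v, 'a) pre_digraph \<Rightarrow> ('v \<Rightarrow> 'a) \<Rightarrow> ('v, 'a) path \<times> ('v, 'a) path \<Rightarrow> bool" where
  "admissible Q sp = (\<lambda>(p, q).
    p \<in> paths Q \<and> q \<in> paths Q \<and> path_target Q p = path_target Q q \<and>
    (path_length p = 0 \<or> path_length q = 0 \<or>
     last (snd p) \<noteq> last (snd q) \<or> \<not> special Q sp (last (snd p))))"

definition admissible_pairs ::
    "('v, 'a) pre_digraph \<Rightarrow> ('v \<Rightarrow> 'a) \<Rightarrow> int \<Rightarrow> 'v \<Rightarrow> (('v, 'a) path \<times> ('v, 'a) path) set" where
  "admissible_pairs Q sp l i =
    {(p, q). admissible Q sp (p, q) \<and> int (path_length q) - int (path_length p) = l \<and>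
             path_source q = i}"


section \<open>The algebra \<open>A = kQ/J\<^sup>2\<close> and its injective modules\<close>

definition path_algebra ::
    "('v, 'a) pre_digraph \<Rightarrow> ('k::field, ('v, 'a) path \<Rightarrow>\<^sub>0 'k) module" where
  "path_algebra Q = category_algebra (paths Q) (path_comp Q) (trivial_path ` verts Q)"

definition arrow_ideal :: "('v, 'a) pre_digraph \<Rightarrow> (('v, 'a) path \<Rightarrow>\<^sub>0 'k::field) set" where
  "arrow_ideal Q =
    Idl\<^bsub>path_algebra Q\<^esub> ((\<lambda>\<alpha>. Poly_Mapping.single (arrow_path Q \<alpha>) 1) ` arcs Q)"

definition arrow_ideal_sq :: "('v, 'a) pre_digraph \<Rightarrow> (('v, 'a) path \<Rightarrow>\<^sub>0 'k::field) set" where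
  "arrow_ideal_sq Q = arrow_ideal Q \<cdot>\<^bsub>path_algebra Q\<^esub> arrow_ideal Q"

definition algA ::
    "('v, 'a) pre_digraph \<Rightarrow> ('k::field, (('v, 'a) path \<Rightarrow>\<^sub>0 'k) set) module" where
  "algA Q = quotient_algebra (path_algebra Q) (arrow_ideal_sq Q)"

definition classA ::
    "('v, 'a) pre_digraph \<Rightarrow> ('v, 'a) path \<Rightarrow> (('v, 'a) path \<Rightarrow>\<^sub>0 'k::field) set" where
  "classA Q p = arrow_ideal_sq Q +>\<^bsub>path_algebra Q\<^esub> Poly_Mapping.single p 1"

definition dgA ::
    "('v, 'a) pre_digraph \<Rightarrow> ('k::field, (('v, 'a) path \<Rightarrow>\<^sub>0 'k) set) dg" where
  "dgA Q = make_dg (algA Q) (\<lambda>n. if n = 0 then carrier (algA Q) else {\<zero>\<^bsub>algA Q\<^esub>})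
    (\<lambda>_. \<zero>\<^bsub>algA Q\<^esub>)"

text \<open>The right ideal \<open>e\<^sub>iA\<close> and the paths whose classes form its basis.\<close>

definition eA :: "('v, 'a) pre_digraph \<Rightarrow> 'v \<Rightarrow> (('v, 'a) path \<Rightarrow>\<^sub>0 'k::field) set set" where
  "eA Q i = {classA Q (trivial_path i) \<otimes>\<^bsub>algA Q\<^esub> a | a. a \<in> carrier (algA Q)}"

definition eA_basis :: "('v, 'a) pre_digraph \<Rightarrow> 'v \<Rightarrow> ('v, 'a) path set" where
  "eA_basis Q i = insert (trivial_path i) (arrow_path Q ` in_arcs Q i)"

type_synonym ('v, 'a, 'k) functional = "(('v, 'a) path \<Rightarrow>\<^sub>0 'k) set \<Rightarrow> 'k"

text \<open>
  \<open>I\<^sub>i = Hom\<^sub>k(e\<^sub>iA, k)\<close>. Functionals are extended by 0 outside \<open>e\<^sub>iA\<close>, so that equality, addition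
  and zero are those of the function type.
\<close>

definition inj_module ::
    "('v, 'a) pre_digraph \<Rightarrow> 'v \<Rightarrow> ('v, 'a, 'k::field) functional set" where
  "inj_module Q i = {\<phi>.
    (\<forall>u. u \<notin> eA Q i \<longrightarrow> \<phi> u = 0) \<and>
    (\<forall>u\<in>eA Q i. \<forall>v\<in>eA Q i. \<phi> (u \<oplus>\<^bsub>algA Q\<^esub> v) = \<phi> u + \<phi> v) \<and>
    (\<forall>c. \<forall>u\<in>eA Q i. \<phi> (c \<odot>\<^bsub>algA Q\<^esub> u) = c * \<phi> u)}"

definition inj_lact ::
    "('v, 'a) pre_digraph \<Rightarrow> 'v \<Rightarrow> (('v, 'a) path \<Rightarrow>\<^sub>0 'k::field) set \<Rightarrow>
     ('v, 'a, 'k) functional \<Rightarrow> ('v, 'a, 'k) functional" where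
  "inj_lact Q i a \<phi> = (\<lambda>u. if u \<in> eA Q i then \<phi> (u \<otimes>\<^bsub>algA Q\<^esub> a) else 0)"

text \<open>For \<open>b \<in> eA_basis Q i\<close>, the element \<open>b\<^sup>\<sharp>\<close> of the basis of \<open>I\<^sub>i\<close> dual to the basis of \<open>e\<^sub>iA\<close>.\<close>

definition dual_elt ::
    "('v, 'a) pre_digraph \<Rightarrow> 'v \<Rightarrow> ('v, 'a) path \<Rightarrow> ('v, 'a, 'k::field) functional" where
  "dual_elt Q i b = (THE \<phi>. \<phi> \<in> inj_module Q i \<and>
    (\<forall>b'\<in>eA_basis Q i. \<phi> (classA Q b') = (if b' = b then 1 else 0)))"

abbreviation e_sharp :: "('v, 'a) pre_digraph \<Rightarrow> 'v \<Rightarrow> ('v, 'a, 'k::field) functional" where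
  "e_sharp Q i \<equiv> dual_elt Q i (trivial_path i)"


section \<open>The injective Leavitt complex\<close>

text \<open>
  The sets \<open>admissible_pairs Q sp l i\<close> are pairwise disjoint for different \<open>(l, i)\<close>, so the direct sum
  over all \<open>l\<close>, \<open>i\<close> and \<open>(p, q)\<close> can be indexed by the pairs \<open>(p, q)\<close> alone. The element
  \<open>x \<zeta>\<^sub>(\<^sub>p\<^sub>,\<^sub>q\<^sub>)\<close> is \<open>Poly_Mapping.single (p, q) x\<close>.
\<close>

type_synonym ('v, 'a, 'k) leavitt_cochain =
  "(('v, 'a) path \<times> ('v, 'a) path) \<Rightarrow>\<^sub>0 ('v, 'a, 'k) functional"

definition zeta ::
    "('v, 'a, 'k::field) functional \<Rightarrow> ('v, 'a) path \<times> ('v, 'a) path \<Rightarrow>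
     ('v, 'a, 'k) leavitt_cochain" where
  "zeta x pq = Poly_Mapping.single pq x"

definition cochain_scale ::
    "'k::field \<Rightarrow> ('v, 'a, 'k) leavitt_cochain \<Rightarrow> ('v, 'a, 'k) leavitt_cochain" where
  "cochain_scale c z = Poly_Mapping.map (\<lambda>\<phi> u. c * \<phi> u) z"

definition leavitt_part ::
    "('v, 'a) pre_digraph \<Rightarrow> ('v \<Rightarrow> 'a) \<Rightarrow> int \<Rightarrow> ('v, 'a, 'k::field) leavitt_cochain set" where
  "leavitt_part Q sp l = {z. \<forall>pq\<in>Poly_Mapping.keys z. \<exists>i\<in>verts Q.
    pq \<in> admissible_pairs Q sp l i \<and> Poly_Mapping.lookup z pq \<in> inj_module Q i}"

definition leavitt_carrier ::
    "('v, 'a) pre_digraph \<Rightarrow> ('v \<Rightarrow> 'a) \<Rightarrow> ('v, 'a, 'k::field) leavitt_cochain set" where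
  "leavitt_carrier Q sp = {z. \<forall>pq\<in>Poly_Mapping.keys z. \<exists>l. \<exists>i\<in>verts Q.
    pq \<in> admissible_pairs Q sp l i \<and> Poly_Mapping.lookup z pq \<in> inj_module Q i}"

text \<open>
  \<open>leavitt_diff_basis Q sp b (p, q)\<close> is the value of the differential at \<open>b\<^sup>\<sharp> \<zeta>\<^sub>(\<^sub>p\<^sub>,\<^sub>q\<^sub>)\<close>, for \<open>b\<close> in
  \<open>eA_basis Q (path_source q)\<close>. The differential is its linear extension: \<open>\<phi> (classA Q b)\<close> is
  the coordinate of \<open>\<phi>\<close> at \<open>b\<^sup>\<sharp>\<close>.
\<close>

definition leavitt_diff_basis ::
    "('v, 'a) pre_digraph \<Rightarrow> ('v \<Rightarrow> 'a) \<Rightarrow> ('v, 'a) path \<Rightarrow>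
     ('v, 'a) path \<times> ('v, 'a) path \<Rightarrow> ('v, 'a, 'k::field) leavitt_cochain" where
  "leavitt_diff_basis Q sp b = (\<lambda>(p, q).
    case snd b of
      [] \<Rightarrow> 0
    | \<alpha> # _ \<Rightarrow>
        if path_length q = 0 \<and> path_length p \<noteq> 0 \<and> last (snd p) = \<alpha> \<and> special Q sp \<alpha>
        then zeta (e_sharp Q (tail Q \<alpha>)) (hat_path p, trivial_path (tail Q \<alpha>))
             - (\<Sum>\<beta>\<in>siblings Q \<alpha>.
                  zeta (e_sharp Q (tail Q \<alpha>)) (post_arrow \<beta> (hat_path p), arrow_path Q \<beta>))
        else zeta (e_sharp Q (tail Q \<alpha>)) (p, pre_arrow Q q \<alpha>))"

definition leavitt_diff ::
    "('v, 'a) pre_digraph \<Rightarrow> ('v \<Rightarrow> 'a) \<Rightarrow> ('v, 'a, 'k::field) leavitt_cochain \<Rightarrow>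
     ('v, 'a, 'k) leavitt_cochain" where
  "leavitt_diff Q sp z =
    (\<Sum>(p, q)\<in>Poly_Mapping.keys z. \<Sum>b\<in>eA_basis Q (path_source q).
       cochain_scale (Poly_Mapping.lookup z (p, q) (classA Q b)) (leavitt_diff_basis Q sp b (p, q)))"

definition leavitt_complex ::
    "('v, 'a) pre_digraph \<Rightarrow> ('v \<Rightarrow> 'a) \<Rightarrow> ('k::field, ('v, 'a, 'k) leavitt_cochain) dg" where
  "leavitt_complex Q sp =
    \<lparr>carrier = leavitt_carrier Q sp, monoid.mult = undefined, monoid.one = undefined,
     ring.zero = 0, ring.add = (+),
     module.smult = cochain_scale, part = leavitt_part Q sp, diff = leavitt_diff Q sp\<rparr>"

definition leavitt_lact ::
    "('v, 'a) pre_digraph \<Rightarrow> (('v, 'a) path \<Rightarrow>\<^sub>0 'k::field) set \<Rightarrow>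
     ('v, 'a, 'k) leavitt_cochain \<Rightarrow> ('v, 'a, 'k) leavitt_cochain" where
  "leavitt_lact Q a z =
    (\<Sum>(p, q)\<in>Poly_Mapping.keys z.
       zeta (inj_lact Q (path_source q) a (Poly_Mapping.lookup z (p, q))) (p, q))"


section \<open>The Leavitt path algebra\<close>

datatype ('v, 'a) leavitt_gen = Vertex 'v | Arrow 'a | Ghost 'a

definition leavitt_gens :: "('v, 'a) pre_digraph \<Rightarrow> ('v, 'a) leavitt_gen set" where
  "leavitt_gens Q = Vertex ` verts Q \<union> Arrow ` arcs Q \<union> Ghost ` arcs Q"

definition leavitt_free ::
    "('v, 'a) pre_digraph \<Rightarrow> ('k::field, ('v, 'a) leavitt_gen list \<Rightarrow>\<^sub>0 'k) module" where
  "leavitt_free Q = category_algebra (lists (leavitt_gens Q)) (\<lambda>u v. Some (u @ v)) {[]}"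

abbreviation word :: "('v, 'a) leavitt_gen list \<Rightarrow> (('v, 'a) leavitt_gen list \<Rightarrow>\<^sub>0 'k::field)" where
  "word w \<equiv> Poly_Mapping.single w 1"

text \<open>
  The relations are imposed on the free unital algebra. The first one is the usual convention that
  the unit of the algebra generated by the \<open>e\<^sub>i\<close>, the \<open>\<alpha>\<close> and the \<open>\<alpha>\<^sup>*\<close> is \<open>\<Sum>\<^sub>i e\<^sub>i\<close>: by the other
  relations \<open>\<Sum>\<^sub>i e\<^sub>i\<close> acts as the identity on all generators, but without the first relation
  a superfluous second unit would be adjoined.
\<close>

definition leavitt_relations ::
    "('v, 'a) pre_digraph \<Rightarrow> (('v, 'a) leavitt_gen list \<Rightarrow>\<^sub>0 'k::field) set" where
  "leavitt_relations Q =
    {(\<Sum>i\<in>verts Q. word [Vertex i]) - word []} \<union>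
    {word [Vertex i, Vertex j] - (if i = j then word [Vertex i] else 0) | i j.
       i \<in> verts Q \<and> j \<in> verts Q} \<union>
    {word [Vertex (head Q \<alpha>), Arrow \<alpha>] - word [Arrow \<alpha>] | \<alpha>. \<alpha> \<in> arcs Q} \<union>
    {word [Arrow \<alpha>, Vertex (tail Q \<alpha>)] - word [Arrow \<alpha>] | \<alpha>. \<alpha> \<in> arcs Q} \<union>
    {word [Vertex (tail Q \<alpha>), Ghost \<alpha>] - word [Ghost \<alpha>] | \<alpha>. \<alpha> \<in> arcs Q} \<union>
    {word [Ghost \<alpha>, Vertex (head Q \<alpha>)] - word [Ghost \<alpha>] | \<alpha>. \<alpha> \<in> arcs Q} \<union>
    {word [Arrow \<alpha>, Ghost \<beta>] - (if \<alpha> = \<beta> then word [Vertex (head Q \<alpha>)] else 0) | \<alpha> \<beta>.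
       \<alpha> \<in> arcs Q \<and> \<beta> \<in> arcs Q} \<union>
    {(\<Sum>\<alpha>\<in>out_arcs Q i. word [Ghost \<alpha>, Arrow \<alpha>]) - word [Vertex i] | i. i \<in> verts Q}"

definition leavitt_ideal ::
    "('v, 'a) pre_digraph \<Rightarrow> (('v, 'a) leavitt_gen list \<Rightarrow>\<^sub>0 'k::field) set" where
  "leavitt_ideal Q = Idl\<^bsub>leavitt_free Q\<^esub> (leavitt_relations Q)"

definition leavitt_algebra ::
    "('v, 'a) pre_digraph \<Rightarrow> ('k::field, (('v, 'a) leavitt_gen list \<Rightarrow>\<^sub>0 'k) set) module" where
  "leavitt_algebra Q = quotient_algebra (leavitt_free Q) (leavitt_ideal Q)"

definition leavitt_elt ::
    "('v, 'a) pre_digraph \<Rightarrow> ('v, 'a) leavitt_gen \<Rightarrow>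
     (('v, 'a) leavitt_gen list \<Rightarrow>\<^sub>0 'k::field) set" where
  "leavitt_elt Q g = leavitt_ideal Q +>\<^bsub>leavitt_free Q\<^esub> word [g]"

fun gen_degree :: "('v, 'a) leavitt_gen \<Rightarrow> int" where
  "gen_degree (Vertex i) = 0"
| "gen_degree (Arrow \<alpha>) = 1"
| "gen_degree (Ghost \<alpha>) = -1"

definition leavitt_alg_part ::
    "('v, 'a) pre_digraph \<Rightarrow> int \<Rightarrow> (('v, 'a) leavitt_gen list \<Rightarrow>\<^sub>0 'k::field) set set" where
  "leavitt_alg_part Q n =
    {leavitt_ideal Q +>\<^bsub>leavitt_free Q\<^esub> f | f.
       f \<in> carrier (leavitt_free Q) \<and>
       (\<forall>w\<in>Poly_Mapping.keys f. sum_list (map gen_degree w) = n)}"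

definition dgB ::
    "('v, 'a) pre_digraph \<Rightarrow> ('k::field, (('v, 'a) leavitt_gen list \<Rightarrow>\<^sub>0 'k) set) dg" where
  "dgB Q = make_dg (opposite_algebra (leavitt_algebra Q)) (leavitt_alg_part Q)
    (\<lambda>_. \<zero>\<^bsub>leavitt_algebra Q\<^esub>)"


section \<open>The right action of \<open>B\<close> on the injective Leavitt complex\<close>

fun zeta_ract ::
    "('v, 'a) pre_digraph \<Rightarrow> ('v \<Rightarrow> 'a) \<Rightarrow> ('v, 'a) leavitt_gen \<Rightarrow> ('v, 'a, 'k::field) functional \<Rightarrow>
     ('v, 'a) path \<times> ('v, 'a) path \<Rightarrow> ('v, 'a, 'k) leavitt_cochain" where
  "zeta_ract Q sp (Vertex j) x (p, q) = (if j = path_source p then zeta x (p, q) else 0)"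
| "zeta_ract Q sp (Arrow \<alpha>) x (p, q) =
    (if path_length p \<noteq> 0
     then (if \<alpha> = hd (snd p) then zeta x (tilde_path Q p, q) else 0)
     else (if tail Q \<alpha> = path_target Q q
           then zeta x (trivial_path (head Q \<alpha>), post_arrow \<alpha> q) else 0))"
| "zeta_ract Q sp (Ghost \<alpha>) x (p, q) =
    (if path_length p = 0 \<and> path_length q \<noteq> 0 \<and> last (snd q) = \<alpha> \<and> special Q sp \<alpha>
     then zeta x (trivial_path (tail Q \<alpha>), hat_path q)
          - (\<Sum>\<beta>\<in>siblings Q \<alpha>. zeta x (arrow_path Q \<beta>, post_arrow \<beta> (hat_path q)))
     else (if path_source p = head Q \<alpha> then zeta x (pre_arrow Q p \<alpha>, q) else 0))"

definition gen_ract ::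
    "('v, 'a) pre_digraph \<Rightarrow> ('v \<Rightarrow> 'a) \<Rightarrow> ('v, 'a, 'k::field) leavitt_cochain \<Rightarrow>
     ('v, 'a) leavitt_gen \<Rightarrow> ('v, 'a, 'k) leavitt_cochain" where
  "gen_ract Q sp z g =
    (\<Sum>pq\<in>Poly_Mapping.keys z. zeta_ract Q sp g (Poly_Mapping.lookup z pq) pq)"

text \<open>
  In the opposite algebra \<open>g\<^sub>1 g\<^sub>2 \<cdots> g\<^sub>n = g\<^sub>n \<circ> \<cdots> \<circ> g\<^sub>2 \<circ> g\<^sub>1\<close>, so as an element of \<open>B\<close> the word
  \<open>g\<^sub>1 g\<^sub>2 \<cdots> g\<^sub>n\<close> acts on the right by first applying \<open>g\<^sub>n\<close> and finally \<open>g\<^sub>1\<close>.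
\<close>

definition free_ract ::
    "('v, 'a) pre_digraph \<Rightarrow> ('v \<Rightarrow> 'a) \<Rightarrow> ('v, 'a, 'k::field) leavitt_cochain \<Rightarrow>
     (('v, 'a) leavitt_gen list \<Rightarrow>\<^sub>0 'k) \<Rightarrow> ('v, 'a, 'k) leavitt_cochain" where
  "free_ract Q sp z f =
    (\<Sum>w\<in>Poly_Mapping.keys f.
       cochain_scale (Poly_Mapping.lookup f w) (foldr (\<lambda>g m. gen_ract Q sp m g) w z))"

text \<open>
  An element of \<open>B\<close> is a coset \<open>b\<close>, and acts as any of its representatives; that the result does not
  depend on the representative is not part of the definition.
\<close>

definition leavitt_ract ::
    "('v, 'a) pre_digraph \<Rightarrow> ('v \<Rightarrow> 'a) \<Rightarrow> ('v, 'a, 'k::field) leavitt_cochain \<Rightarrow>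
     (('v, 'a) leavitt_gen list \<Rightarrow>\<^sub>0 'k) set \<Rightarrow> ('v, 'a, 'k) leavitt_cochain" where
  "leavitt_ract Q sp z b = (THE m. \<forall>f\<in>b. free_ract Q sp z f = m)"

end

theory Submission
  imports Defs
begin

text \<open>
  Each generator \<open>g\<close> of \<open>L\<^sub>k(Q)\<close> acts on \<open>x \<zeta>\<^sub>(\<^sub>p\<^sub>,\<^sub>q\<^sub>)\<close> by changing the index only, at the start of \<open>p\<close> or,
  when \<open>p\<close> is trivial, at the end of \<open>q\<close>. The differential is a combination, with coefficients
  depending on \<open>x\<close>, of operations that change the index at the start of \<open>q\<close> or, when \<open>q\<close> is trivial,
  at the end of \<open>p\<close>. These two kinds of operations commute on admissible pairs; the only interference
  occurs when \<open>q\<close> is trivial and \<open>p\<close> has length at most 1, where the correction terms for special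
  arrows cancel.
  The left action of \<open>A\<close> changes \<open>x\<close> only, and so commutes with the right action. It commutes with
  the differential because taking the coefficient at \<open>e\<^sub>i\<close> is an algebra homomorphism \<open>A \<rightarrow> k\<close>.

  The action descends from the free algebra to \<open>L\<^sub>k(Q)\<close> because the annihilator of the complex is an
  ideal containing the relations, and \<open>L\<^sub>k(Q)\<close> is graded because the relations are homogeneous.
\<close>

section \<open>Additive maps on finitely supported functions\<close>

text \<open>The correction sums over \<open>siblings\<close> come from the relation that the
  products \<alpha>* \<alpha> over the arrows \<alpha> starting at i add up to e_i. Admissibility
  forbids a common special last arrow, so a pair that would end in one is rewritten through this
  relation as the shortened pair minus the pairs ending in a sibling. The differential and the
  action of a ghost use the same rewriting, which is why they agree where they meet. The square of
  the differential vanishes because its values only involve the functionals \<open>e_sharp\<close>,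
  and these are 0 on arrows. Two objects are definite descriptions. For \<open>dual_elt\<close> this
  requires that the trivial path and the incoming arrows span e_i A; for
  \<open>leavitt_ract\<close>, that all representatives of a coset act alike. Products, actions and
  the differential are sums over supports, and supports may shrink under addition. Identities are
  therefore reduced by additivity to basis elements. No sign survives in the Leibniz rules: A sits
  in degree 0 and B has zero differential.\<close>

definition lext :: "('b \<Rightarrow> 'c \<Rightarrow> 'd) \<Rightarrow> ('b \<Rightarrow>\<^sub>0 'c::ab_group_add) \<Rightarrow> 'd::ab_group_add" where
  "lext F f = (\<Sum>k\<in>Poly_Mapping.keys f. F k (Poly_Mapping.lookup f k))"

lemma lext_single [simp]: "F k 0 = 0 \<Longrightarrow> lext F (Poly_Mapping.single k x) = F k x"
  by (simp add: lext_def)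

text \<open>\<open>lext\<close> is the common shape of products, actions and the differential. Keys
  of \<open>f + g\<close> may disappear by cancellation; since \<open>F k 0 = 0\<close>, all three
  sums can be extended to a common set of keys.\<close>

lemma additive_lext:
  assumes "\<And>k. Modules.additive (F k)"
  shows "Modules.additive (lext F)"
proof
  fix f g
  interpret Modules.additive "F k" for k by fact
  show "lext F (f + g) = lext F f + lext F g"
    unfolding lext_def by (rule Poly_Mapping.setsum_keys_plus_distrib) (simp_all add: zero add)
qed

lemma additive_lext_param:
  assumes "\<And>k x. Modules.additive (\<lambda>y. F y k x)"
  shows "Modules.additive (\<lambda>y. lext (F y) f)"
proof -
  interpret Modules.additive "\<lambda>y. F y k x" for k x by fact
  show ?thesis by (rule Modules.additive.intro) (simp add: lext_def add sum.distrib)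
qed

lemma additive_compose:
  assumes "Modules.additive S" "Modules.additive T"
  shows "Modules.additive (\<lambda>x. S (T x))"
  using assms by (simp add: Modules.additive_def)

text \<open>The single case only concerns keys of the given \<open>f\<close> with their actual
  coefficients, so a support condition on \<open>f\<close> is available there without being part of
  \<open>P\<close>.\<close>

lemma poly_mapping_induct_single [case_names zero single add]:
  fixes f :: "'b \<Rightarrow>\<^sub>0 'c::comm_monoid_add"
  assumes "P 0"
    and "\<And>k. k \<in> Poly_Mapping.keys f \<Longrightarrow> P (Poly_Mapping.single k (Poly_Mapping.lookup f k))"
    and "\<And>g h. P g \<Longrightarrow> P h \<Longrightarrow> P (g + h)"
  shows "P f"
proof -
  have "P (\<Sum>k\<in>S. Poly_Mapping.single k (Poly_Mapping.lookup f k))"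
    if "finite S" "S \<subseteq> Poly_Mapping.keys f" for S
    using that by (induction S) (auto intro: assms)
  moreover have "f = (\<Sum>k\<in>Poly_Mapping.keys f. Poly_Mapping.single k (Poly_Mapping.lookup f k))"
    by (rule poly_mapping_eqI)
      (auto simp: lookup_sum lookup_single when_def in_keys_iff)
  ultimately show ?thesis
    by (metis finite_keys subset_refl)
qed

text \<open>Applied once per argument, this reduces bilinear and trilinear identities to basis
  elements.\<close>

lemma additive_eqI:
  assumes "Modules.additive S" "Modules.additive T"
    and "\<And>k. k \<in> Poly_Mapping.keys f \<Longrightarrow> S (Poly_Mapping.single k (Poly_Mapping.lookup f k)) =
      T (Poly_Mapping.single k (Poly_Mapping.lookup f k))"
  shows "S f = T f"
  by (rule poly_mapping_induct_single[where P = "\<lambda>f. S f = T f"])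
    (simp_all add: assms Modules.additive.zero[OF assms(1)] Modules.additive.zero[OF assms(2)]
      Modules.additive.add[OF assms(1)] Modules.additive.add[OF assms(2)])

lemma lookup_scale [simp]: "Poly_Mapping.lookup (scale c f) p = c * Poly_Mapping.lookup f p"
  by (simp add: scale_def Poly_Mapping.map.rep_eq when_def)

lemma scale_single [simp]: "scale c (Poly_Mapping.single p a) = Poly_Mapping.single p (c * a)"
  by (rule poly_mapping_eqI) (simp add: lookup_single when_def)

lemma scale_zero [simp]: "scale c 0 = 0"
  by (rule poly_mapping_eqI) simp

lemma scale_add: "scale c (f + g) = scale c f + scale c g"
  by (rule poly_mapping_eqI) (simp add: lookup_add distrib_left)

lemma additive_scale: "Modules.additive (scale c)"
  by (rule Modules.additive.intro) (rule scale_add)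

lemma keys_scale: "Poly_Mapping.keys (scale c f) \<subseteq> Poly_Mapping.keys f"
  by (auto simp: in_keys_iff)

section \<open>Category algebras\<close>

text \<open>The locale \<^locale>\<open>algebra\<close> of the library requires a commutative multiplication.\<close>

locale ring_algebra = module K A + ring A
  for K :: "('k, 'r) ring_scheme" and A :: "('k, 'a, 'm) module_scheme" +
  assumes smult_mult_left: "\<lbrakk>c \<in> carrier K; x \<in> carrier A; y \<in> carrier A\<rbrakk> \<Longrightarrow>
      (c \<odot>\<^bsub>A\<^esub> x) \<otimes>\<^bsub>A\<^esub> y = c \<odot>\<^bsub>A\<^esub> (x \<otimes>\<^bsub>A\<^esub> y)"
    and smult_mult_right: "\<lbrakk>c \<in> carrier K; x \<in> carrier A; y \<in> carrier A\<rbrakk> \<Longrightarrow>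
      x \<otimes>\<^bsub>A\<^esub> (c \<odot>\<^bsub>A\<^esub> y) = c \<odot>\<^bsub>A\<^esub> (x \<otimes>\<^bsub>A\<^esub> y)"

lemma ring_of_type_algebra_simps [simp]:
  "carrier ring_of_type_algebra = UNIV"
  "\<zero>\<^bsub>ring_of_type_algebra\<^esub> = 0"
  "\<one>\<^bsub>ring_of_type_algebra\<^esub> = 1"
  "a \<oplus>\<^bsub>ring_of_type_algebra\<^esub> b = a + b"
  "a \<otimes>\<^bsub>ring_of_type_algebra\<^esub> b = a * b"
  by (simp_all add: ring_of_type_algebra_def)

text \<open>This is the product of \<open>category_algebra\<close>, written with nested
  \<open>lext\<close> so that additivity in each factor follows from \<open>additive_lext\<close>
  and \<open>additive_lext_param\<close>.\<close>

definition convolution ::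
    "('b \<Rightarrow> 'b \<Rightarrow> 'b option) \<Rightarrow> ('b \<Rightarrow>\<^sub>0 'k::field) \<Rightarrow> ('b \<Rightarrow>\<^sub>0 'k) \<Rightarrow> ('b \<Rightarrow>\<^sub>0 'k)" where
  "convolution mul f g = lext (\<lambda>p a. lext (\<lambda>q b. case mul p q of
     None \<Rightarrow> 0 | Some r \<Rightarrow> Poly_Mapping.single r (a * b)) g) f"

lemma additive_convolution_left: "Modules.additive (\<lambda>f. convolution mul f g)"
  unfolding convolution_def
  by (intro additive_lext additive_lext_param Modules.additive.intro)
    (simp add: single_add distrib_right split: option.split)

lemma additive_convolution_right: "Modules.additive (\<lambda>g. convolution mul f g)"
  unfolding convolution_def
  by (intro additive_lext additive_lext_param Modules.additive.intro)
    (simp add: single_add distrib_left split: option.split)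

lemmas convolution_add_left = Modules.additive.add[OF additive_convolution_left]
  and convolution_add_right = Modules.additive.add[OF additive_convolution_right]
  and convolution_zero_left [simp] = Modules.additive.zero[OF additive_convolution_left]
  and convolution_zero_right [simp] = Modules.additive.zero[OF additive_convolution_right]

lemma convolution_single [simp]:
  "convolution mul (Poly_Mapping.single p a) (Poly_Mapping.single q b) =
    (case mul p q of None \<Rightarrow> 0 | Some r \<Rightarrow> Poly_Mapping.single r (a * b))"
proof -
  \<comment> \<open>Coefficient 0 in the left factor must give 0: this is the side condition of
    \<open>lext_single\<close> for the outer sum.\<close>
  have "lext (\<lambda>q b. case mul p q of None \<Rightarrow> 0 | Some r \<Rightarrow> Poly_Mapping.single r (0 * b)) g = 0"
    for g :: "'a \<Rightarrow>\<^sub>0 'b"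
    unfolding lext_def by (rule sum.neutral) (simp split: option.split)
  then show ?thesis
    unfolding convolution_def by (simp split: option.split)
qed

lemma convolution_scale_left: "convolution mul (scale c f) g = scale c (convolution mul f g)"
proof (rule additive_eqI[where f = f])
  fix p
  let ?f = "Poly_Mapping.single p (Poly_Mapping.lookup f p)"
  show "convolution mul (scale c ?f) g = scale c (convolution mul ?f g)"
    by (rule additive_eqI[where f = g])
      (auto intro: additive_compose additive_scale additive_convolution_right
        simp: mult.assoc split: option.split)
qed (auto intro: additive_compose additive_scale additive_convolution_left
    additive_compose[OF additive_convolution_left])

lemma convolution_scale_right: "convolution mul f (scale c g) = scale c (convolution mul f g)"
proof (rule additive_eqI[where f = f])
  fix p
  let ?f = "Poly_Mapping.single p (Poly_Mapping.lookup f p)"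
  show "convolution mul ?f (scale c g) = scale c (convolution mul ?f g)"
    by (rule additive_eqI[where f = g])
      (auto intro: additive_compose[OF additive_convolution_right] additive_compose
        additive_scale additive_convolution_right
        simp: mult.left_commute split: option.split)
qed (auto intro: additive_compose additive_scale additive_convolution_left)

lemma category_algebra_simps:
  "carrier (category_algebra Mor mul Ids) = {f. Poly_Mapping.keys f \<subseteq> Mor}"
  "f \<otimes>\<^bsub>category_algebra Mor mul Ids\<^esub> g = convolution mul f g"
  "\<one>\<^bsub>category_algebra Mor mul Ids\<^esub> = (\<Sum>u\<in>Ids. Poly_Mapping.single u 1)"
  "\<zero>\<^bsub>category_algebra Mor mul Ids\<^esub> = 0"
  "f \<oplus>\<^bsub>category_algebra Mor mul Ids\<^esub> g = f + g"
  "c \<odot>\<^bsub>category_algebra Mor mul Ids\<^esub> f = scale c f"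
  by (simp_all add: category_algebra_def convolution_def lext_def)

text \<open>\<open>Option.bind\<close> makes undefinedness absorbing, so the two bracketings of a
  triple are undefined together, and both products in the algebra are then 0. Exactly one identity
  composes with a morphism on each side, which makes the sum of the identities a unit.\<close>

locale finite_category =
  fixes Mor :: "'b set" and mul :: "'b \<Rightarrow> 'b \<Rightarrow> 'b option" and Ids :: "'b set"
  assumes mul_closed: "\<lbrakk>p \<in> Mor; q \<in> Mor; mul p q = Some r\<rbrakk> \<Longrightarrow> r \<in> Mor"
    and mul_assoc: "\<lbrakk>p \<in> Mor; q \<in> Mor; r \<in> Mor\<rbrakk> \<Longrightarrow>
      Option.bind (mul p q) (\<lambda>s. mul s r) = Option.bind (mul q r) (mul p)"
    and finite_Ids: "finite Ids"
    and Ids_subset: "Ids \<subseteq> Mor"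
    and left_id: "p \<in> Mor \<Longrightarrow> \<exists>u\<in>Ids. \<forall>v\<in>Ids. mul v p = (if v = u then Some p else None)"
    and right_id: "p \<in> Mor \<Longrightarrow> \<exists>u\<in>Ids. \<forall>v\<in>Ids. mul p v = (if v = u then Some p else None)"
begin

abbreviation alg :: "('k::field, 'b \<Rightarrow>\<^sub>0 'k) module" where
  "alg \<equiv> category_algebra Mor mul Ids"

lemma convolution_closed:
  assumes "Poly_Mapping.keys f \<subseteq> Mor" "Poly_Mapping.keys g \<subseteq> Mor"
  shows "Poly_Mapping.keys (convolution mul f g) \<subseteq> Mor"
  using assms unfolding convolution_def lext_def
  by (intro order_trans[OF keys_sum] UN_least) (auto dest: mul_closed split: option.splits if_splits)

lemma convolution_assoc:
  assumes "Poly_Mapping.keys f \<subseteq> Mor" "Poly_Mapping.keys g \<subseteq> Mor" "Poly_Mapping.keys h \<subseteq> Mor"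
  shows "convolution mul (convolution mul f g) h = convolution mul f (convolution mul g h)"
proof (rule additive_eqI[where f = f])
  fix p assume p: "p \<in> Poly_Mapping.keys f"
  let ?f = "Poly_Mapping.single p (Poly_Mapping.lookup f p)"
  show "convolution mul (convolution mul ?f g) h = convolution mul ?f (convolution mul g h)"
  proof (rule additive_eqI[where f = g])
    fix q assume q: "q \<in> Poly_Mapping.keys g"
    let ?g = "Poly_Mapping.single q (Poly_Mapping.lookup g q)"
    show "convolution mul (convolution mul ?f ?g) h = convolution mul ?f (convolution mul ?g h)"
    proof (rule additive_eqI[where f = h])
      fix r assume r: "r \<in> Poly_Mapping.keys h"
      have "Option.bind (mul p q) (\<lambda>s. mul s r) = Option.bind (mul q r) (mul p)"
        using p q r assms by (intro mul_assoc) auto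
      then show "convolution mul (convolution mul ?f ?g) (Poly_Mapping.single r (Poly_Mapping.lookup h r)) =
          convolution mul ?f (convolution mul ?g (Poly_Mapping.single r (Poly_Mapping.lookup h r)))"
        by (cases "mul p q"; cases "mul q r"; auto simp: mult.assoc split: option.split)
    qed (auto intro: additive_compose additive_convolution_right
        additive_compose[OF additive_convolution_right])
  qed (auto intro: additive_convolution_right additive_convolution_left
      additive_compose[OF additive_convolution_right] additive_compose[OF additive_convolution_left])
qed (auto intro: additive_convolution_left additive_compose[OF additive_convolution_left])

lemma convolution_one_left:
  assumes "Poly_Mapping.keys f \<subseteq> Mor"
  shows "convolution mul (\<Sum>u\<in>Ids. Poly_Mapping.single u 1) f = f"
proof (rule additive_eqI[where f = f])
  fix p assume p: "p \<in> Poly_Mapping.keys f"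
  let ?f = "Poly_Mapping.single p (Poly_Mapping.lookup f p)"
  obtain u where u: "u \<in> Ids" "\<And>v. v \<in> Ids \<Longrightarrow> mul v p = (if v = u then Some p else None)"
    using left_id p assms by blast
  have "convolution mul (\<Sum>u\<in>Ids. Poly_Mapping.single u 1) ?f =
      (\<Sum>v\<in>Ids. convolution mul (Poly_Mapping.single v 1) ?f)"
    by (rule Modules.additive.sum[OF additive_convolution_left])
  also have "\<dots> = (\<Sum>v\<in>Ids. if v = u then ?f else 0)"
    by (rule sum.cong) (simp_all add: u)
  finally show "convolution mul (\<Sum>u\<in>Ids. Poly_Mapping.single u 1) ?f = ?f"
    using u finite_Ids by simp
qed (auto intro: additive_convolution_right Modules.additive.intro)

lemma convolution_one_right:
  assumes "Poly_Mapping.keys f \<subseteq> Mor"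
  shows "convolution mul f (\<Sum>u\<in>Ids. Poly_Mapping.single u 1) = f"
proof (rule additive_eqI[where f = f])
  fix p assume p: "p \<in> Poly_Mapping.keys f"
  let ?f = "Poly_Mapping.single p (Poly_Mapping.lookup f p)"
  obtain u where u: "u \<in> Ids" "\<And>v. v \<in> Ids \<Longrightarrow> mul p v = (if v = u then Some p else None)"
    using right_id p assms by blast
  have "convolution mul ?f (\<Sum>u\<in>Ids. Poly_Mapping.single u 1) =
      (\<Sum>v\<in>Ids. convolution mul ?f (Poly_Mapping.single v 1))"
    by (rule Modules.additive.sum[OF additive_convolution_right])
  also have "\<dots> = (\<Sum>v\<in>Ids. if v = u then ?f else 0)"
    by (rule sum.cong) (simp_all add: u)
  finally show "convolution mul ?f (\<Sum>u\<in>Ids. Poly_Mapping.single u 1) = ?f"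
    using u finite_Ids by simp
qed (auto intro: additive_convolution_left Modules.additive.intro)

lemma category_algebra_ring: "ring (alg :: ('k::field, 'b \<Rightarrow>\<^sub>0 'k) module)"
proof (rule ringI)
  show "abelian_group (alg :: ('k, 'b \<Rightarrow>\<^sub>0 'k) module)"
  proof (rule abelian_groupI)
    fix f :: "'b \<Rightarrow>\<^sub>0 'k" assume "f \<in> carrier alg"
    then show "\<exists>g\<in>carrier alg. g \<oplus>\<^bsub>alg\<^esub> f = \<zero>\<^bsub>alg\<^esub>"
      by (intro bexI[of _ "- f"]) (auto simp: category_algebra_simps in_keys_iff)
  qed (auto simp: category_algebra_simps algebra_simps dest: keys_add[THEN subsetD])
  show "monoid (alg :: ('k, 'b \<Rightarrow>\<^sub>0 'k) module)"
    using Ids_subset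
    by (intro monoidI)
      (auto simp: category_algebra_simps convolution_closed convolution_assoc convolution_one_left
        convolution_one_right dest!: keys_sum[THEN subsetD] subsetD[OF convolution_closed, rotated 2])
qed (simp_all add: category_algebra_simps convolution_add_left convolution_add_right)

lemma category_algebra_algebra:
  "ring_algebra ring_of_type_algebra (alg :: ('k::field, 'b \<Rightarrow>\<^sub>0 'k) module)"
proof -
  interpret ring "alg :: ('k, 'b \<Rightarrow>\<^sub>0 'k) module"
    by (rule category_algebra_ring)
  have "module ring_of_type_algebra (alg :: ('k, 'b \<Rightarrow>\<^sub>0 'k) module)"
  proof (rule moduleI)
    show "cring (ring_of_type_algebra :: 'k ring)"
      by (rule cring_from_type_algebra)
    show "abelian_group (alg :: ('k, 'b \<Rightarrow>\<^sub>0 'k) module)"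
      by (rule is_abelian_group)
  qed (auto simp: category_algebra_simps scale_add lookup_add distrib_right mult.assoc
      intro!: poly_mapping_eqI dest: keys_scale[THEN subsetD])
  then show ?thesis
    by (intro ring_algebra.intro ring_algebra_axioms.intro ring_axioms)
      (simp_all add: category_algebra_simps convolution_scale_left convolution_scale_right)
qed

end

section \<open>Quotients, opposites and dg algebras with zero differential\<close>

text \<open>Quotients, opposites and \<open>make_dg\<close> change the record or its type while
  keeping the additive structure, so the group laws are transported along equality of the
  fields.\<close>

lemma abelian_group_cong:
  fixes R :: "('a, 'm) ring_scheme" and S :: "('a, 'n) ring_scheme"
  assumes "carrier S = carrier R" "ring.zero S = ring.zero R" "ring.add S = ring.add R"
    and "abelian_group R"
  shows "abelian_group S"
proof -
  interpret abelian_group R by fact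
  show ?thesis
    by (rule abelian_groupI) (auto simp: assms(1-3) a_ac intro: l_neg)
qed

lemma ring_algebra_cong:
  fixes R :: "('k, 'a, 'm) module_scheme" and S :: "('k, 'a, 'n) module_scheme"
  assumes "carrier S = carrier R" "monoid.mult S = monoid.mult R" "monoid.one S = monoid.one R"
    "ring.zero S = ring.zero R" "ring.add S = ring.add R" "module.smult S = module.smult R"
    and "ring_algebra K R"
  shows "ring_algebra K S"
proof -
  interpret ring_algebra K R by fact
  have "abelian_group S"
    by (rule abelian_group_cong[OF assms(1,4,5) is_abelian_group])
  moreover have "monoid S"
    by (rule monoidI) (simp_all add: assms(1-6) m_assoc)
  ultimately show ?thesis
    by (intro ring_algebra.intro ring_algebra_axioms.intro moduleI ringI R.is_cring)
      (simp_all add: assms(1-6) l_distr r_distr smult_l_distr smult_r_distr smult_assoc1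
        smult_mult_left smult_mult_right)
qed

locale algebra_ideal = ring_algebra K R + ideal I R
  for K :: "'k ring" and R :: "('k, 'a) module" (structure) and I :: "'a set"
begin

abbreviation coset :: "'a \<Rightarrow> 'a set" where
  "coset x \<equiv> I +> x"

abbreviation quotient :: "('k, 'a set) module" where
  "quotient \<equiv> quotient_algebra R I"

text \<open>Absorption under ring multiplication suffices, because
  \<open>c \<odot> x = (c \<odot> \<one>) \<otimes> x\<close>.\<close>

lemma smult_ideal:
  assumes "c \<in> carrier K" "x \<in> I"
  shows "c \<odot> x \<in> I"
  by (metis assms I_l_closed Icarr R.ring_simprules(6) l_one one_closed smult_closed smult_mult_left)

lemma coset_eq_iff:
  "\<lbrakk>x \<in> carrier R; y \<in> carrier R\<rbrakk> \<Longrightarrow> coset x = coset y \<longleftrightarrow> x \<ominus> y \<in> I"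
  using quotient_eq_iff_same_a_r_cos[OF is_ideal] by blast

lemma quotient_simps:
  "carrier quotient = a_rcosets I"
  "u \<otimes>\<^bsub>quotient\<^esub> v = rcoset_mult R I u v"
  "\<one>\<^bsub>quotient\<^esub> = coset \<one>"
  "\<zero>\<^bsub>quotient\<^esub> = I"
  "u \<oplus>\<^bsub>quotient\<^esub> v = u <+> v"
  "c \<odot>\<^bsub>quotient\<^esub> u = (\<Union>x\<in>u. coset (c \<odot> x))"
  by (simp_all add: quotient_algebra_def ring.defs module.defs FactRing_def)

lemma coset_closed [simp]: "x \<in> carrier R \<Longrightarrow> coset x \<in> carrier quotient"
  by (simp add: quotient_simps a_rcosetsI a_subset)

lemma coset_cases:
  assumes "u \<in> carrier quotient"
  obtains x where "x \<in> carrier R" "u = coset x"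
  using assms unfolding quotient_simps A_RCOSETS_def' by blast

lemma quotient_add [simp]:
  "\<lbrakk>x \<in> carrier R; y \<in> carrier R\<rbrakk> \<Longrightarrow> coset x \<oplus>\<^bsub>quotient\<^esub> coset y = coset (x \<oplus> y)"
  by (simp add: quotient_simps a_rcos_sum)

lemma quotient_mult [simp]:
  "\<lbrakk>x \<in> carrier R; y \<in> carrier R\<rbrakk> \<Longrightarrow> coset x \<otimes>\<^bsub>quotient\<^esub> coset y = coset (x \<otimes> y)"
  by (simp add: quotient_simps rcoset_mult_add)

lemma coset_zero: "coset \<zero> = \<zero>\<^bsub>quotient\<^esub>"
  by (simp add: quotient_simps a_rcos_zero is_ideal)

lemma coset_ideal: "x \<in> I \<Longrightarrow> coset x = \<zero>\<^bsub>quotient\<^esub>"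
  by (simp add: quotient_simps a_rcos_const)

lemma coset_one: "coset \<one> = \<one>\<^bsub>quotient\<^esub>"
  by (simp add: quotient_simps)

text \<open>A scalar multiple of a coset is defined as a union over all representatives. Their
  multiples differ by elements of \<open>I\<close>, so this is a nonempty union of one and the same
  coset.\<close>

lemma quotient_smult [simp]:
  assumes "c \<in> carrier K" "x \<in> carrier R"
  shows "c \<odot>\<^bsub>quotient\<^esub> coset x = coset (c \<odot> x)"
proof -
  have "coset (c \<odot> y) = coset (c \<odot> x)" if y: "y \<in> coset x" for y
  proof -
    obtain h where h: "h \<in> I" "y = h \<oplus> x"
      using y by (auto simp: a_r_coset_def')
    then have "c \<odot> y = (c \<odot> h) \<oplus> (c \<odot> x)" "c \<odot> h \<in> I"
      using assms smult_ideal smult_r_distr by (auto simp: Icarr)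
    then have "c \<odot> y \<ominus> c \<odot> x = c \<odot> h"
      using assms h by (simp add: Icarr minus_eq M.add.m_assoc r_neg)
    then show ?thesis
      using assms h \<open>c \<odot> h \<in> I\<close> by (simp add: Icarr coset_eq_iff)
  qed
  then have "(\<Union>y\<in>coset x. coset (c \<odot> y)) = (\<Union>y\<in>coset x. coset (c \<odot> x))"
    by (intro SUP_cong) simp_all
  then show ?thesis
    using a_rcos_self[OF assms(2)] unfolding quotient_simps by blast
qed

lemma quotient_ring: "ring quotient"
proof -
  interpret Q: ring "R Quot I" by (rule quotient_is_ring)
  have Q: "carrier quotient = carrier (R Quot I)" "\<zero>\<^bsub>quotient\<^esub> = \<zero>\<^bsub>R Quot I\<^esub>"
    "ring.add quotient = ring.add (R Quot I)" "monoid.mult quotient = monoid.mult (R Quot I)"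
    "\<one>\<^bsub>quotient\<^esub> = \<one>\<^bsub>R Quot I\<^esub>"
    by (simp_all add: quotient_algebra_def ring.defs module.defs)
  have "abelian_group quotient"
    by (rule abelian_group_cong[OF Q(1-3) Q.is_abelian_group])
  moreover have "monoid quotient"
    by (rule monoidI) (simp_all add: Q Q.m_assoc)
  ultimately show ?thesis
    by (rule ringI) (simp_all add: Q Q.l_distr Q.r_distr)
qed

lemma quotient_ring_algebra: "ring_algebra K quotient"
proof -
  interpret Q: ring quotient by (rule quotient_ring)
  have "module K quotient"
  proof (rule moduleI)
    show "cring K" by (rule R.is_cring)
    show "abelian_group quotient" by (rule Q.is_abelian_group)
  qed (auto elim!: coset_cases simp: smult_l_distr smult_r_distr smult_assoc1)
  then show ?thesis
    by (intro ring_algebra.intro ring_algebra_axioms.intro quotient_ring)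
      (auto elim!: coset_cases simp: smult_mult_left smult_mult_right)
qed

lemma coset_finsum:
  assumes "f \<in> S \<rightarrow> carrier R"
  shows "coset (finsum R f S) = finsum quotient (\<lambda>n. coset (f n)) S"
proof -
  interpret Q: ring quotient by (rule quotient_ring)
  have "ring_hom_ring R quotient coset"
    by (rule ring_hom_ringI) (simp_all add: ring_axioms quotient_ring coset_one)
  then show ?thesis
    using assms by (simp add: ring_hom_ring.hom_finsum comp_def)
qed

end

section \<open>Opposite algebras, gradings, and dg algebras with zero differential\<close>

lemma opposite_simps [simp]:
  "carrier (opposite_algebra R) = carrier R"
  "x \<otimes>\<^bsub>opposite_algebra R\<^esub> y = y \<otimes>\<^bsub>R\<^esub> x"
  "\<one>\<^bsub>opposite_algebra R\<^esub> = \<one>\<^bsub>R\<^esub>"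
  "\<zero>\<^bsub>opposite_algebra R\<^esub> = \<zero>\<^bsub>R\<^esub>"
  "ring.add (opposite_algebra R) = ring.add R"
  "module.smult (opposite_algebra R) = module.smult R"
  "finsum (opposite_algebra R) = finsum R"
  by (simp_all add: opposite_algebra_def finsum_def fun_eq_iff)

lemma opposite_ring_algebra:
  assumes "ring_algebra K R"
  shows "ring_algebra K (opposite_algebra R)"
proof -
  interpret ring_algebra K R by fact
  let ?S = "opposite_algebra R"
  have group: "abelian_group ?S"
    by (rule abelian_group_cong[OF _ _ _ is_abelian_group]) simp_all
  moreover have "monoid ?S"
    by (rule monoidI) (simp_all add: m_assoc)
  ultimately have "ring ?S"
    by (rule ringI) (simp_all add: l_distr r_distr)
  moreover have "module K ?S"
    using group by (intro moduleI R.is_cring) (simp_all add: smult_l_distr smult_r_distr smult_assoc1)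
  ultimately show ?thesis
    by (intro ring_algebra.intro ring_algebra_axioms.intro)
      (simp_all add: smult_mult_left smult_mult_right)
qed

lemma make_dg_simps [simp]:
  "carrier (make_dg R P d) = carrier R"
  "monoid.mult (make_dg R P d) = monoid.mult R"
  "\<one>\<^bsub>make_dg R P d\<^esub> = \<one>\<^bsub>R\<^esub>"
  "\<zero>\<^bsub>make_dg R P d\<^esub> = \<zero>\<^bsub>R\<^esub>"
  "ring.add (make_dg R P d) = ring.add R"
  "module.smult (make_dg R P d) = module.smult R"
  "part (make_dg R P d) = P"
  "diff (make_dg R P d) = d"
  by (simp_all add: make_dg_def module.defs dg.defs)

lemma submodule_cong:
  fixes R :: "('k, 'a, 'm) module_scheme" and S :: "('k, 'a, 'n) module_scheme"
  assumes "carrier S = carrier R" "ring.zero S = ring.zero R" "ring.add S = ring.add R"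
    "module.smult S = module.smult R" and "submodule H K R"
  shows "submodule H K S"
  using assms(5)
  unfolding submodule_def submodule_axioms_def subgroup_def m_inv_def monoid.simps
    partial_object.simps assms(1-4) .

lemma finsum_make_dg [simp]: "finsum (make_dg R P d) = finsum R"
  by (intro ext) (simp add: finsum_def finprod_def)

text \<open>Applying \<open>\<pi> n\<close> to any decomposition isolates its component
  \<open>c n\<close>, which gives uniqueness; the projections themselves give existence. This serves
  the gradings of A, of B and of the complex alike.\<close>

lemma (in abelian_group) decomposition_by_projections:
  fixes P :: "int \<Rightarrow> 'a set" and \<pi> :: "int \<Rightarrow> 'a \<Rightarrow> 'a"
  assumes P: "\<And>n. P n \<subseteq> carrier G"
    and \<pi>_part: "\<And>n x. x \<in> carrier G \<Longrightarrow> \<pi> n x \<in> P n"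
    and \<pi>_add: "\<And>n x y. \<lbrakk>x \<in> carrier G; y \<in> carrier G\<rbrakk> \<Longrightarrow> \<pi> n (x \<oplus> y) = \<pi> n x \<oplus> \<pi> n y"
    and \<pi>_id: "\<And>n k x. x \<in> P k \<Longrightarrow> \<pi> n x = (if n = k then x else \<zero>)"
    and \<pi>_sum: "\<And>x. x \<in> carrier G \<Longrightarrow>
      \<exists>S. finite S \<and> (\<forall>n. n \<notin> S \<longrightarrow> \<pi> n x = \<zero>) \<and> x = (\<Oplus>n\<in>S. \<pi> n x)"
    and m: "m \<in> carrier G"
  shows "\<exists>!c. (\<forall>n. c n \<in> P n) \<and> finite {n. c n \<noteq> \<zero>} \<and> m = (\<Oplus>n\<in>{n. c n \<noteq> \<zero>}. c n)"
proof (rule ex1I[where a = "\<lambda>n. \<pi> n m"])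
  have \<pi>_carrier: "\<pi> n x \<in> carrier G" if "x \<in> carrier G" for n x
    using P \<pi>_part that by blast
  obtain S where S: "finite S" "\<And>n. n \<notin> S \<Longrightarrow> \<pi> n m = \<zero>" "m = (\<Oplus>n\<in>S. \<pi> n m)"
    using \<pi>_sum[OF m] by blast
  have sub: "{n. \<pi> n m \<noteq> \<zero>} \<subseteq> S"
    using S(2) by blast
  have "(\<Oplus>n\<in>{n. \<pi> n m \<noteq> \<zero>}. \<pi> n m) = (\<Oplus>n\<in>S. \<pi> n m)"
    using S(1) sub \<pi>_carrier[OF m] by (intro add.finprod_mono_neutral_cong_left) auto
  then show "(\<forall>n. \<pi> n m \<in> P n) \<and> finite {n. \<pi> n m \<noteq> \<zero>} \<and> m = (\<Oplus>n\<in>{n. \<pi> n m \<noteq> \<zero>}. \<pi> n m)"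
    using S(1,3) sub \<pi>_part[OF m] by (simp add: finite_subset)
  fix c
  assume c: "(\<forall>n. c n \<in> P n) \<and> finite {n. c n \<noteq> \<zero>} \<and> m = (\<Oplus>n\<in>{n. c n \<noteq> \<zero>}. c n)"
  then have c_carrier: "c n \<in> carrier G" for n
    using P by blast
  show "c = (\<lambda>n. \<pi> n m)"
  proof
    fix n
    \<comment> \<open>Additivity is only given on the carrier; \<open>\<pi> n \<zero>\<close> is 0
      by cancellation.\<close>
    have "\<pi> n \<zero> \<oplus> \<pi> n \<zero> = \<pi> n \<zero>"
      using \<pi>_add[of \<zero> \<zero> n] by simp
    then have \<pi>_zero: "\<pi> n \<zero> = \<zero>"
      using \<pi>_carrier[of \<zero> n] by simp
    have \<pi>_finsum: "\<pi> n (\<Oplus>k\<in>T. c k) = (\<Oplus>k\<in>T. \<pi> n (c k))" if "finite T" for T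
      using that
      by (induction T) (simp_all add: \<pi>_zero \<pi>_add \<pi>_carrier c_carrier)
    have "\<pi> n m = (\<Oplus>k\<in>{k. c k \<noteq> \<zero>}. \<pi> n (c k))"
      using c \<pi>_finsum by metis
    also have "\<dots> = (\<Oplus>k\<in>{k. c k \<noteq> \<zero>}. if n = k then c k else \<zero>)"
      using c by (intro finsum_cong') (auto simp: \<pi>_id c_carrier)
    also have "\<dots> = c n"
    proof (cases "c n = \<zero>")
      case True
      then have "(\<Oplus>k\<in>{k. c k \<noteq> \<zero>}. if n = k then c k else \<zero>) = (\<Oplus>k\<in>{k. c k \<noteq> \<zero>}. \<zero>)"
        by (intro finsum_cong') auto
      then show ?thesis
        using True by simp
    next
      case False
      then show ?thesis
        using c c_carrier by (intro finsum_singleton) auto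
    qed
    finally show "c n = \<pi> n m" ..
  qed
qed

lemma dg_algebra_zero_diff:
  fixes K :: "'k ring" and R :: "('k, 'a) module"
  assumes "ring_algebra K R"
    and sub: "\<And>n. submodule (P n) K R"
    and decomposition: "\<And>m. m \<in> carrier R \<Longrightarrow>
      \<exists>!c. (\<forall>n. c n \<in> P n) \<and> finite {n. c n \<noteq> \<zero>\<^bsub>R\<^esub>} \<and> m = (\<Oplus>\<^bsub>R\<^esub>n\<in>{n. c n \<noteq> \<zero>\<^bsub>R\<^esub>}. c n)"
    and "\<one>\<^bsub>R\<^esub> \<in> P 0"
    and "\<And>m n x y. \<lbrakk>x \<in> P m; y \<in> P n\<rbrakk> \<Longrightarrow> x \<otimes>\<^bsub>R\<^esub> y \<in> P (m + n)"
  shows "dg_algebra K (make_dg R P (\<lambda>_. \<zero>\<^bsub>R\<^esub>))" (is "dg_algebra K ?M")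
proof -
  interpret R: ring_algebra K R by fact
  interpret M: ring_algebra K ?M
    by (rule ring_algebra_cong[OF _ _ _ _ _ _ assms(1)]) simp_all
  have P: "\<zero>\<^bsub>R\<^esub> \<in> P n" "P n \<subseteq> carrier R" for n
    using subgroup.one_closed[OF submodule.axioms(1)[OF sub[of n]]]
      subgroup.subset[OF submodule.axioms(1)[OF sub[of n]]] by simp_all
  \<comment> \<open>With all differentials 0, the Leibniz rule comes down to this.\<close>
  have "sign_twist ?M n \<zero>\<^bsub>R\<^esub> = \<zero>\<^bsub>R\<^esub>" for n
    using M.minus_zero by (simp add: sign_twist_def)
  then show ?thesis
    using P by (intro dg_algebra.intro dg_kmodule.intro dg_kmodule_axioms.intro
        dg_algebra_axioms.intro M.module_axioms M.ring_axioms)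
      (auto simp: assms R.smult_mult_left R.smult_mult_right subset_iff
        intro: submodule_cong[OF _ _ _ _ sub])
qed

text \<open>Closure under negation is multiplication by \<open>\<ominus> \<one>\<close>.\<close>

lemma (in ring) idealI_closed:
  assumes "I \<subseteq> carrier R" "\<zero> \<in> I"
    and "\<And>x y. \<lbrakk>x \<in> I; y \<in> I\<rbrakk> \<Longrightarrow> x \<oplus> y \<in> I"
    and "\<And>x r. \<lbrakk>x \<in> I; r \<in> carrier R\<rbrakk> \<Longrightarrow> r \<otimes> x \<in> I"
    and "\<And>x r. \<lbrakk>x \<in> I; r \<in> carrier R\<rbrakk> \<Longrightarrow> x \<otimes> r \<in> I"
  shows "ideal I R"
proof (rule idealI)
  have "\<ominus> x \<in> I" if "x \<in> I" for x
    using assms(4)[OF that, of "\<ominus> \<one>"] that assms(1) by (auto simp: l_minus)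
  then show "subgroup I (add_monoid R)"
    using assms by unfold_locales (auto simp: a_inv_def)
qed (use assms ring_axioms in auto)

section \<open>Paths\<close>

lemma path_target_Nil [simp]: "path_target Q (i, []) = i"
  by (simp add: path_target_def pre_digraph.awalk_verts_conv)

lemma path_target_Cons [simp]: "path_target Q (i, \<alpha> # as) = path_target Q (head Q \<alpha>, as)"
  by (simp add: path_target_def pre_digraph.awalk_verts_conv)

lemma path_target_append [simp]:
  "path_target Q (i, as @ bs) = path_target Q (path_target Q (i, as), bs)"
  by (induction as arbitrary: i) simp_all

locale quiver = fin_digraph Q for Q :: "('v, 'a) pre_digraph"
begin

lemma path_Nil [simp]: "(i, []) \<in> paths Q \<longleftrightarrow> i \<in> verts Q"
  using awalk_Nil_iff by (auto simp: paths_def)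

lemma path_Cons [simp]:
  "(i, \<alpha> # as) \<in> paths Q \<longleftrightarrow> \<alpha> \<in> arcs Q \<and> i = tail Q \<alpha> \<and> (head Q \<alpha>, as) \<in> paths Q"
  by (auto simp: paths_def awalk_simps)

lemma path_append [simp]:
  "(i, as @ bs) \<in> paths Q \<longleftrightarrow> (i, as) \<in> paths Q \<and> (path_target Q (i, as), bs) \<in> paths Q"
proof (induction as arbitrary: i)
  case Nil
  then show ?case
    by (cases bs) auto
qed auto

lemma path_source_in_verts: "p \<in> paths Q \<Longrightarrow> path_source p \<in> verts Q"
  by (cases p; cases "snd p") (auto simp: path_source_def)

lemma path_target_in_verts: "p \<in> paths Q \<Longrightarrow> path_target Q p \<in> verts Q"
proof (cases p)
  fix i as
  assume "p \<in> paths Q" "p = (i, as)"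
  then show ?thesis
    by (induction as arbitrary: i p) auto
qed

lemma paths_category: "finite_category (paths Q) (path_comp Q) (trivial_path ` verts Q)"
proof
  fix p q r assume "p \<in> paths Q" "q \<in> paths Q" "path_comp Q p q = Some r"
  then show "r \<in> paths Q"
    by (cases p; cases q) (auto simp: path_comp_def path_source_def split: if_splits)
next
  fix p q r
  show "Option.bind (path_comp Q p q) (\<lambda>s. path_comp Q s r) =
      Option.bind (path_comp Q q r) (path_comp Q p)"
    by (cases p; cases q; cases r) (auto simp: path_comp_def path_source_def)
next
  fix p assume p: "p \<in> paths Q"
  show "\<exists>u\<in>trivial_path ` verts Q. \<forall>v\<in>trivial_path ` verts Q.
      path_comp Q v p = (if v = u then Some p else None)"
    using path_target_in_verts[OF p]
    by (intro bexI[of _ "trivial_path (path_target Q p)"])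
      (auto simp: path_comp_def path_source_def trivial_path_def)
  show "\<exists>u\<in>trivial_path ` verts Q. \<forall>v\<in>trivial_path ` verts Q.
      path_comp Q p v = (if v = u then Some p else None)"
    using path_source_in_verts[OF p]
    by (intro bexI[of _ "trivial_path (path_source p)"])
      (auto simp: path_comp_def path_source_def trivial_path_def)
qed (auto simp: trivial_path_def)

sublocale P: finite_category "paths Q" "path_comp Q" "trivial_path ` verts Q"
  by (rule paths_category)

abbreviation kQ :: "('k::field, ('v, 'a) path \<Rightarrow>\<^sub>0 'k) module" where
  "kQ \<equiv> path_algebra Q"

abbreviation mult_kQ :: "(('v, 'a) path \<Rightarrow>\<^sub>0 'k::field) \<Rightarrow> (('v, 'a) path \<Rightarrow>\<^sub>0 'k) \<Rightarrow> (('v, 'a) path \<Rightarrow>\<^sub>0 'k)"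
    (infixl \<open>\<bullet>\<close> 70) where
  "mult_kQ \<equiv> convolution (path_comp Q)"

lemmas kQ_simps = category_algebra_simps[of "paths Q" "path_comp Q" "trivial_path ` verts Q",
    folded path_algebra_def]

lemma kQ_algebra: "ring_algebra ring_of_type_algebra (kQ :: ('k::field, ('v, 'a) path \<Rightarrow>\<^sub>0 'k) module)"
  unfolding path_algebra_def by (rule P.category_algebra_algebra)

lemma arrow_path_in_paths: "\<alpha> \<in> arcs Q \<Longrightarrow> arrow_path Q \<alpha> \<in> paths Q"
  by (simp add: arrow_path_def)

lemma single_closed: "p \<in> paths Q \<Longrightarrow> Poly_Mapping.single p c \<in> carrier kQ"
  by (simp add: kQ_simps)

lemma ideal_arrow_ideal: "ideal (arrow_ideal Q) (kQ :: ('k::field, ('v, 'a) path \<Rightarrow>\<^sub>0 'k) module)"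
proof -
  interpret ring_algebra ring_of_type_algebra "kQ :: ('k, ('v, 'a) path \<Rightarrow>\<^sub>0 'k) module"
    by (rule kQ_algebra)
  show ?thesis
    unfolding arrow_ideal_def by (rule genideal_ideal) (auto intro: single_closed arrow_path_in_paths)
qed

lemma ideal_arrow_ideal_sq:
  "ideal (arrow_ideal_sq Q) (kQ :: ('k::field, ('v, 'a) path \<Rightarrow>\<^sub>0 'k) module)"
proof -
  interpret ring_algebra ring_of_type_algebra "kQ :: ('k, ('v, 'a) path \<Rightarrow>\<^sub>0 'k) module"
    by (rule kQ_algebra)
  show ?thesis
    unfolding arrow_ideal_sq_def by (intro ideal_prod_is_ideal ideal_arrow_ideal)
qed

lemma arrow_ideal_sq_subset:
  "arrow_ideal_sq Q \<subseteq> (arrow_ideal Q :: (('v, 'a) path \<Rightarrow>\<^sub>0 'k::field) set)"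
proof -
  interpret ring_algebra ring_of_type_algebra "kQ :: ('k, ('v, 'a) path \<Rightarrow>\<^sub>0 'k) module"
    by (rule kQ_algebra)
  show ?thesis
    unfolding arrow_ideal_sq_def using ideal_prod_inter[OF ideal_arrow_ideal ideal_arrow_ideal] by simp
qed

lemma arrow_ideal_sqI:
  "f \<in> arrow_ideal Q \<Longrightarrow> g \<in> arrow_ideal Q \<Longrightarrow> f \<bullet> g \<in> arrow_ideal_sq Q"
  unfolding arrow_ideal_sq_def using ideal_prod.prod[of f _ g _ kQ] by (simp add: kQ_simps)

text \<open>Splitting off the first arrow of \<open>p\<close> and leaving the coefficient on the
  remaining path displays the element as a left multiple of a generator of the ideal.\<close>

lemma single_in_arrow_ideal:
  fixes c :: "'k::field"
  assumes "p \<in> paths Q" "snd p \<noteq> []"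
  shows "Poly_Mapping.single p c \<in> arrow_ideal Q"
proof -
  interpret J: ideal "arrow_ideal Q" "kQ :: ('k, ('v, 'a) path \<Rightarrow>\<^sub>0 'k) module"
    by (rule ideal_arrow_ideal)
  obtain i \<alpha> as where p: "p = (i, \<alpha> # as)"
    using assms by (cases p; cases "snd p") auto
  have "Poly_Mapping.single (arrow_path Q \<alpha>) (1::'k) \<in> arrow_ideal Q"
    using assms p unfolding arrow_ideal_def by (intro J.genideal_self[THEN subsetD])
      (auto intro: single_closed arrow_path_in_paths)
  moreover have "Poly_Mapping.single (head Q \<alpha>, as) c \<in> carrier kQ"
    using assms p by (intro single_closed) simp
  moreover have "Poly_Mapping.single p c =
      Poly_Mapping.single (head Q \<alpha>, as) c \<bullet> Poly_Mapping.single (arrow_path Q \<alpha>) 1"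
    using assms p by (simp add: path_comp_def path_source_def arrow_path_def)
  ultimately show ?thesis
    using J.I_l_closed by (metis kQ_simps(2))
qed

text \<open>Lengths add under composition, so a trivial path arises only as the product of itself
  with itself.\<close>

lemma lookup_vertex_mult:
  "Poly_Mapping.lookup (f \<bullet> g) (i, []) = Poly_Mapping.lookup f (i, []) * Poly_Mapping.lookup g (i, [])"
proof (rule additive_eqI[where f = f])
  fix p
  let ?f = "Poly_Mapping.single p (Poly_Mapping.lookup f p)"
  show "Poly_Mapping.lookup (?f \<bullet> g) (i, []) =
      Poly_Mapping.lookup ?f (i, []) * Poly_Mapping.lookup g (i, [])"
    by (rule additive_eqI[where f = g])
      (auto intro: Modules.additive.intro simp: lookup_add convolution_add_right distrib_left
        path_comp_def path_source_def lookup_single when_def prod_eq_iff)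
qed (auto intro: Modules.additive.intro simp: lookup_add convolution_add_left distrib_right)

text \<open>By multiplicativity of the coefficient at \<open>(i, [])\<close>, its zeros form an
  ideal, and this ideal contains the arrows.\<close>

lemma lookup_vertex_arrow_ideal:
  fixes f :: "('v, 'a) path \<Rightarrow>\<^sub>0 'k::field"
  assumes "f \<in> arrow_ideal Q"
  shows "Poly_Mapping.lookup f (i, []) = 0"
proof -
  interpret ring_algebra ring_of_type_algebra "kQ :: ('k, ('v, 'a) path \<Rightarrow>\<^sub>0 'k) module"
    by (rule kQ_algebra)
  have "ideal {f \<in> carrier kQ. Poly_Mapping.lookup f (i, []) = (0::'k)} kQ"
    by (rule idealI_closed)
      (auto simp: kQ_simps lookup_add lookup_vertex_mult P.convolution_closed[THEN subsetD]
        dest: keys_add[THEN subsetD])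
  then have "arrow_ideal Q \<subseteq> {f \<in> carrier kQ. Poly_Mapping.lookup f (i, []) = (0::'k)}"
    unfolding arrow_ideal_def
    by (rule genideal_minimal) (auto simp: single_closed arrow_path_in_paths lookup_single arrow_path_def)
  then show ?thesis
    using assms by blast
qed

section \<open>The algebra \<open>A\<close>\<close>

lemma algA_ideal: "algebra_ideal ring_of_type_algebra
    (kQ :: ('k::field, ('v, 'a) path \<Rightarrow>\<^sub>0 'k) module) (arrow_ideal_sq Q)"
  by (intro algebra_ideal.intro kQ_algebra ideal_arrow_ideal_sq)

interpretation A: algebra_ideal ring_of_type_algebra
  "kQ :: ('k::field, ('v, 'a) path \<Rightarrow>\<^sub>0 'k) module" "arrow_ideal_sq Q"
  by (rule algA_ideal)

lemma A_quotient: "A.quotient = algA Q"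
  by (simp add: algA_def)

lemmas algA_add = A.quotient_add[unfolded A_quotient kQ_simps]
  and algA_mult = A.quotient_mult[unfolded A_quotient kQ_simps]
  and algA_smult = A.quotient_smult[unfolded A_quotient kQ_simps]
  and algA_zero = A.coset_ideal[unfolded A_quotient]

lemma algA_algebra:
  "ring_algebra ring_of_type_algebra (algA Q :: ('k::field, (('v, 'a) path \<Rightarrow>\<^sub>0 'k) set) module)"
  using A.quotient_ring_algebra by (simp only: A_quotient)

interpretation AQ: ring_algebra ring_of_type_algebra
  "algA Q :: ('k::field, (('v, 'a) path \<Rightarrow>\<^sub>0 'k) set) module"
  by (rule algA_algebra)

lemma dgA_dg_algebra:
  "dg_algebra ring_of_type_algebra (dgA Q :: ('k::field, (('v, 'a) path \<Rightarrow>\<^sub>0 'k) set) dg)"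
  unfolding dgA_def
proof (rule dg_algebra_zero_diff)
  let ?A = "algA Q :: ('k, (('v, 'a) path \<Rightarrow>\<^sub>0 'k) set) module"
  let ?P = "\<lambda>n::int. if n = 0 then carrier ?A else {\<zero>\<^bsub>?A\<^esub>}"
  show "ring_algebra ring_of_type_algebra ?A"
    by (rule algA_algebra)
  show "submodule (?P n) ring_of_type_algebra ?A" for n
    by (rule AQ.submoduleI) (auto split: if_splits)
  show "\<exists>!c. (\<forall>n. c n \<in> ?P n) \<and> finite {n. c n \<noteq> \<zero>\<^bsub>?A\<^esub>} \<and>
      m = (\<Oplus>\<^bsub>?A\<^esub>n\<in>{n. c n \<noteq> \<zero>\<^bsub>?A\<^esub>}. c n)" if "m \<in> carrier ?A" for m
    by (rule AQ.decomposition_by_projections[where \<pi> = "\<lambda>n x. if n = 0 then x else \<zero>\<^bsub>?A\<^esub>"])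
      (use that in \<open>auto split: if_splits intro!: exI[of _ "{0}"]\<close>)
qed (auto split: if_splits)

text \<open>The character of A at the vertex \<open>i\<close>. Any representative may be chosen: J^2
  lies in J, whose elements have coefficient 0 at every trivial path.\<close>

definition vertex_coeff :: "'v \<Rightarrow> (('v, 'a) path \<Rightarrow>\<^sub>0 'k::field) set \<Rightarrow> 'k" where
  "vertex_coeff i u = Poly_Mapping.lookup (SOME f. f \<in> u) (i, [])"

lemma vertex_coeff_coset:
  assumes "f \<in> carrier kQ"
  shows "vertex_coeff i (A.coset f) = Poly_Mapping.lookup f (i, [])"
proof -
  have "(SOME g. g \<in> A.coset f) \<in> A.coset f"
    using A.a_rcos_self[OF assms] by (rule someI)
  then obtain h where "h \<in> arrow_ideal_sq Q" "(SOME g. g \<in> A.coset f) = h + f"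
    by (auto simp: a_r_coset_def' kQ_simps)
  then show ?thesis
    using lookup_vertex_arrow_ideal[of h i] arrow_ideal_sq_subset
    by (auto simp: vertex_coeff_def lookup_add)
qed

lemma vertex_coeff_add:
  "\<lbrakk>u \<in> carrier (algA Q); v \<in> carrier (algA Q)\<rbrakk> \<Longrightarrow>
    vertex_coeff i (u \<oplus>\<^bsub>algA Q\<^esub> v) = vertex_coeff i u + vertex_coeff i v"
  unfolding A_quotient[symmetric]
  by (elim A.coset_cases) (simp add: vertex_coeff_coset kQ_simps lookup_add
      order_trans[OF keys_add])

lemma vertex_coeff_mult:
  "\<lbrakk>u \<in> carrier (algA Q); v \<in> carrier (algA Q)\<rbrakk> \<Longrightarrow>
    vertex_coeff i (u \<otimes>\<^bsub>algA Q\<^esub> v) = vertex_coeff i u * vertex_coeff i v"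
  unfolding A_quotient[symmetric]
  by (elim A.coset_cases) (simp add: vertex_coeff_coset kQ_simps lookup_vertex_mult
      P.convolution_closed)

lemma vertex_coeff_smult:
  "u \<in> carrier (algA Q) \<Longrightarrow> vertex_coeff i (c \<odot>\<^bsub>algA Q\<^esub> u) = c * vertex_coeff i u"
  unfolding A_quotient[symmetric]
  by (elim A.coset_cases) (simp add: vertex_coeff_coset kQ_simps order_trans[OF keys_scale])

section \<open>The right ideals e_i A\<close>

lemma classA_eq: "classA Q p = A.coset (Poly_Mapping.single p 1)"
  by (simp add: classA_def)

lemma classA_closed: "p \<in> paths Q \<Longrightarrow> classA Q p \<in> carrier (algA Q)"
  unfolding classA_eq A_quotient[symmetric] by (intro A.coset_closed single_closed)

lemma eA_subset: "i \<in> verts Q \<Longrightarrow> eA Q i \<subseteq> carrier (algA Q)"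
  by (auto simp: eA_def trivial_path_def intro!: AQ.m_closed classA_closed)

lemma eA_carrier: "\<lbrakk>u \<in> eA Q i; i \<in> verts Q\<rbrakk> \<Longrightarrow> u \<in> carrier (algA Q)"
  using eA_subset by blast

text \<open>With the factor e_i kept explicit, \<open>f\<close> ranges over the whole path algebra,
  so an induction over \<open>f\<close> carries no condition on the targets of its paths.\<close>

lemma eA_coset:
  fixes u :: "(('v, 'a) path \<Rightarrow>\<^sub>0 'k::field) set"
  assumes "i \<in> verts Q" "u \<in> eA Q i"
  obtains f where "Poly_Mapping.keys f \<subseteq> paths Q" "u = A.coset (Poly_Mapping.single (i, []) 1 \<bullet> f)"
proof -
  obtain a where "a \<in> carrier (algA Q)" "u = classA Q (i, []) \<otimes>\<^bsub>algA Q\<^esub> a"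
    using assms by (auto simp: eA_def trivial_path_def)
  then show ?thesis
    using that assms(1) unfolding A_quotient[symmetric]
    by (elim A.coset_cases) (simp add: classA_eq kQ_simps)
qed

lemma eA_cosetI:
  "\<lbrakk>i \<in> verts Q; Poly_Mapping.keys f \<subseteq> paths Q\<rbrakk> \<Longrightarrow>
    A.coset (Poly_Mapping.single (i, []) 1 \<bullet> f) \<in> eA Q i"
  unfolding eA_def A_quotient[symmetric]
  by (auto simp: classA_eq kQ_simps trivial_path_def intro!: exI[of _ "A.coset f"])

lemma eA_mult:
  assumes "i \<in> verts Q" "u \<in> eA Q i" "a \<in> carrier (algA Q)"
  shows "u \<otimes>\<^bsub>algA Q\<^esub> a \<in> eA Q i"
  using assms by (auto simp: eA_def AQ.m_assoc classA_closed trivial_path_def)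

lemma eA_add:
  assumes "i \<in> verts Q" "u \<in> eA Q i" "v \<in> eA Q i"
  shows "u \<oplus>\<^bsub>algA Q\<^esub> v \<in> eA Q i"
  using assms by (force simp: eA_def AQ.r_distr[symmetric] classA_closed trivial_path_def)

lemma eA_smult:
  assumes "i \<in> verts Q" "u \<in> eA Q i"
  shows "c \<odot>\<^bsub>algA Q\<^esub> u \<in> eA Q i"
  using assms by (force simp: eA_def AQ.smult_mult_right[symmetric] classA_closed trivial_path_def)

lemma single_vertex_mult:
  "Poly_Mapping.single (i, []) 1 \<bullet> Poly_Mapping.single p c =
    (if path_target Q p = i then Poly_Mapping.single p c else 0)"
  by (simp add: path_comp_def path_source_def)

lemma classA_in_eA:
  assumes "i \<in> verts Q" "p \<in> paths Q" "path_target Q p = i"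
  shows "classA Q p \<in> eA Q i"
  using eA_cosetI[of i "Poly_Mapping.single p 1"] assms by (simp add: path_comp_def path_source_def classA_eq)

lemma eA_basis_paths:
  assumes "i \<in> verts Q" "b \<in> eA_basis Q i"
  shows "b \<in> paths Q" "path_target Q b = i"
  using assms by (auto simp: eA_basis_def trivial_path_def arrow_path_def)

text \<open>The first arrow and the remaining nontrivial path both lie in J.\<close>

lemma long_path_in_arrow_ideal_sq:
  assumes "p \<in> paths Q" "Suc 0 < length (snd p)"
  shows "Poly_Mapping.single p (c::'k::field) \<in> arrow_ideal_sq Q"
proof -
  obtain i \<alpha> \<beta> as where p: "p = (i, \<alpha> # \<beta> # as)"
    using assms by (cases p; cases "snd p"; cases "tl (snd p)") auto
  have "Poly_Mapping.single (head Q \<alpha>, \<beta> # as) c \<bullet> Poly_Mapping.single (arrow_path Q \<alpha>) 1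
      \<in> arrow_ideal_sq Q"
    using assms p by (intro arrow_ideal_sqI single_in_arrow_ideal) (auto simp: arrow_path_def)
  then show ?thesis
    using assms p by (simp add: path_comp_def path_source_def arrow_path_def)
qed

section \<open>The injective modules I_i and their dual bases\<close>

lemma inj_moduleD:
  assumes "\<phi> \<in> inj_module Q i"
  shows "u \<notin> eA Q i \<Longrightarrow> \<phi> u = 0"
    and "\<lbrakk>u \<in> eA Q i; v \<in> eA Q i\<rbrakk> \<Longrightarrow> \<phi> (u \<oplus>\<^bsub>algA Q\<^esub> v) = \<phi> u + \<phi> v"
    and "u \<in> eA Q i \<Longrightarrow> \<phi> (c \<odot>\<^bsub>algA Q\<^esub> u) = c * \<phi> u"
  using assms by (auto simp: inj_module_def)

lemma inj_module_zero [simp]: "0 \<in> inj_module Q i"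
  by (simp add: inj_module_def)

lemma inj_module_add [intro]: "\<lbrakk>\<phi> \<in> inj_module Q i; \<psi> \<in> inj_module Q i\<rbrakk> \<Longrightarrow> \<phi> + \<psi> \<in> inj_module Q i"
  by (auto simp: inj_module_def algebra_simps)

lemma inj_module_smult [intro]: "\<phi> \<in> inj_module Q i \<Longrightarrow> (\<lambda>u. c * \<phi> u) \<in> inj_module Q i"
  by (auto simp: inj_module_def algebra_simps)

lemma inj_module_zero_coset:
  assumes "\<phi> \<in> inj_module Q i" "i \<in> verts Q"
  shows "\<phi> (A.coset (0 :: ('v, 'a) path \<Rightarrow>\<^sub>0 'k::field)) = 0"
proof -
  have "A.coset (0 :: ('v, 'a) path \<Rightarrow>\<^sub>0 'k) \<in> eA Q i"
    using eA_cosetI[OF assms(2), of 0] by simp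
  then have "\<phi> (0 \<odot>\<^bsub>algA Q\<^esub> A.coset 0) = 0"
    using inj_moduleD(3)[OF assms(1)] by simp
  then show ?thesis
    by (simp add: algA_smult)
qed

text \<open>The classes of \<open>eA_basis\<close> span e_i A: multiplication by e_i kills paths
  with another target, and paths of length at least 2 are 0 in A. This gives the uniqueness in the
  definite description \<open>dual_elt\<close>.\<close>

lemma inj_module_eqI:
  fixes \<phi> \<psi> :: "('v, 'a, 'k::field) functional"
  assumes \<phi>: "\<phi> \<in> inj_module Q i" and \<psi>: "\<psi> \<in> inj_module Q i" and i: "i \<in> verts Q"
    and eq: "\<And>b. b \<in> eA_basis Q i \<Longrightarrow> \<phi> (classA Q b) = \<psi> (classA Q b)"
  shows "\<phi> = \<psi>"
proof
  fix u
  let ?e = "Poly_Mapping.single (i, []) (1::'k)"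
  show "\<phi> u = \<psi> u"
  proof (cases "u \<in> eA Q i")
    case True
    then obtain f where f: "Poly_Mapping.keys f \<subseteq> paths Q" "u = A.coset (?e \<bullet> f)"
      using eA_coset[OF i] by blast
    \<comment> \<open>The support condition is part of the induction because the addition step uses
      it to stay inside the carrier and inside \<open>eA\<close>.\<close>
    have "Poly_Mapping.keys f \<subseteq> paths Q \<and> \<phi> (A.coset (?e \<bullet> f)) = \<psi> (A.coset (?e \<bullet> f))"
    proof (induction f rule: poly_mapping_induct_single)
      case zero
      then show ?case
        by (simp add: inj_module_zero_coset[OF \<phi> i] inj_module_zero_coset[OF \<psi> i])
    next
      case (single p)
      then have p: "p \<in> paths Q"
        using f by blast
      let ?c = "Poly_Mapping.lookup f p"
      have "\<phi> (A.coset (?e \<bullet> Poly_Mapping.single p ?c)) = \<psi> (A.coset (?e \<bullet> Poly_Mapping.single p ?c))"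
      proof (cases "path_target Q p = i")
        case False
        then show ?thesis
          unfolding single_vertex_mult
          by (simp add: inj_module_zero_coset[OF \<phi> i] inj_module_zero_coset[OF \<psi> i])
      next
        case target: True
        show ?thesis
        proof (cases "p \<in> eA_basis Q i")
          case True
          have "A.coset (Poly_Mapping.single p ?c) = ?c \<odot>\<^bsub>algA Q\<^esub> classA Q p"
            using p by (simp add: classA_eq algA_smult)
          then show ?thesis
            using True target p i eq[OF True] unfolding single_vertex_mult
            by (simp add: inj_moduleD(3)[OF \<phi>] inj_moduleD(3)[OF \<psi>] classA_in_eA)
        next
          case False
          \<comment> \<open>A path ending at \<open>i\<close> outside \<open>eA_basis\<close> is
            neither trivial nor a single arrow.\<close>
          then have "Suc 0 < length (snd p)"
            using p target by (cases p; cases "snd p"; cases "tl (snd p)")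
              (auto simp: eA_basis_def trivial_path_def arrow_path_def in_arcs_def)
          then have "Poly_Mapping.single p ?c \<in> arrow_ideal_sq Q"
            using p by (rule long_path_in_arrow_ideal_sq[rotated])
          then have "A.coset (Poly_Mapping.single p ?c) = A.coset 0"
            by (simp only: algA_zero A.coset_zero[unfolded A_quotient kQ_simps])
          then show ?thesis
            using target unfolding single_vertex_mult
            by (simp add: inj_module_zero_coset[OF \<phi> i] inj_module_zero_coset[OF \<psi> i])
        qed
      qed
      then show ?case
        using p by simp
    next
      case (add g h)
      have "A.coset (?e \<bullet> (g + h)) = A.coset (?e \<bullet> g) \<oplus>\<^bsub>algA Q\<^esub> A.coset (?e \<bullet> h)"
        using add i by (simp add: convolution_add_right algA_add P.convolution_closed)
      then show ?case
        using add i by (simp add: inj_moduleD(2)[OF \<phi>] inj_moduleD(2)[OF \<psi>] eA_cosetI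
            order_trans[OF keys_add])
    qed
    then show ?thesis
      using f by blast
  qed (simp add: inj_moduleD(1)[OF \<phi>] inj_moduleD(1)[OF \<psi>])
qed

text \<open>The character at \<open>i\<close>, restricted to e_i A, has the values that
  \<open>dual_elt\<close> prescribes, and \<open>inj_module_eqI\<close> makes it the only such
  functional.\<close>

lemma e_sharp_eq:
  assumes i: "i \<in> verts Q"
  shows "e_sharp Q i = (\<lambda>u. if u \<in> eA Q i then vertex_coeff i u else (0::'k::field))"
    and "(e_sharp Q i :: ('v, 'a, 'k) functional) \<in> inj_module Q i"
proof -
  let ?\<phi> = "\<lambda>u. if u \<in> eA Q i then vertex_coeff i u else (0::'k)"
  have \<phi>: "?\<phi> \<in> inj_module Q i"
    using eA_subset[OF i] by (auto simp: inj_module_def vertex_coeff_add vertex_coeff_smult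
        eA_add[OF i] eA_smult[OF i] subset_iff)
  have basis: "?\<phi> (classA Q b) = (if b = trivial_path i then 1 else 0)" if "b \<in> eA_basis Q i" for b
    using that classA_in_eA[OF i eA_basis_paths[OF i that]] eA_basis_paths[OF i that]
    by (auto simp: classA_eq vertex_coeff_coset single_closed lookup_single when_def trivial_path_def)
  show "e_sharp Q i = ?\<phi>"
    unfolding dual_elt_def
    using \<phi> basis by (intro the_equality) (auto intro!: inj_module_eqI[OF _ _ i])
  with \<phi> show "(e_sharp Q i :: ('v, 'a, 'k) functional) \<in> inj_module Q i"
    by simp
qed

text \<open>The source of the vanishing square of the differential. Arrows not ending at
  \<open>i\<close> are included, so no compatibility between the functional and the index of its
  copy has to be tracked later.\<close>

lemma e_sharp_arrow:
  assumes "i \<in> verts Q" "\<alpha> \<in> arcs Q"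
  shows "e_sharp Q i (classA Q (arrow_path Q \<alpha>)) = (0::'k::field)"
  using assms
  by (simp add: e_sharp_eq(1) classA_eq vertex_coeff_coset single_closed arrow_path_in_paths
      lookup_single arrow_path_def)

text \<open>Multiplying \<alpha> on the right by a nontrivial path lands in J^2, so only the
  coefficient of \<open>a\<close> at the source of \<alpha> is visible.\<close>

lemma arrow_mult:
  fixes x :: "('v, 'a, 'k::field) functional"
  assumes \<alpha>: "\<alpha> \<in> arcs Q" and x: "x \<in> inj_module Q (head Q \<alpha>)" and a: "a \<in> carrier (algA Q)"
  shows "x (classA Q (arrow_path Q \<alpha>) \<otimes>\<^bsub>algA Q\<^esub> a) =
    vertex_coeff (tail Q \<alpha>) a * x (classA Q (arrow_path Q \<alpha>))"
proof -
  let ?i = "head Q \<alpha>" and ?\<alpha> = "arrow_path Q \<alpha>"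
  have i: "?i \<in> verts Q" and p\<alpha>: "?\<alpha> \<in> paths Q" and target: "path_target Q ?\<alpha> = ?i"
    using \<alpha> by (simp_all add: arrow_path_def)
  have clA: "(classA Q ?\<alpha> :: (('v, 'a) path \<Rightarrow>\<^sub>0 'k) set) \<in> eA Q ?i"
    "(classA Q ?\<alpha> :: (('v, 'a) path \<Rightarrow>\<^sub>0 'k) set) \<in> carrier (algA Q)"
    using classA_in_eA[OF i p\<alpha> target] classA_closed[OF p\<alpha>] by simp_all
  obtain f where f: "f \<in> carrier kQ" "a = A.coset f"
    using a unfolding A_quotient[symmetric] by (elim A.coset_cases)
  have "f \<in> carrier kQ \<and> x (classA Q ?\<alpha> \<otimes>\<^bsub>algA Q\<^esub> A.coset f) =
      vertex_coeff (tail Q \<alpha>) (A.coset f) * x (classA Q ?\<alpha>)"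
  proof (induction f rule: poly_mapping_induct_single)
    case zero
    then show ?case
      using p\<alpha> by (simp add: classA_eq algA_mult vertex_coeff_coset kQ_simps
          inj_module_zero_coset[OF x i])
  next
    case (single p)
    then have p: "p \<in> paths Q"
      using f by (auto simp: kQ_simps)
    let ?c = "Poly_Mapping.lookup f p"
    have carrier: "Poly_Mapping.single p ?c \<in> carrier kQ"
      using p by (rule single_closed)
    have "classA Q ?\<alpha> \<otimes>\<^bsub>algA Q\<^esub> A.coset (Poly_Mapping.single p ?c) =
        A.coset (Poly_Mapping.single ?\<alpha> 1 \<bullet> Poly_Mapping.single p ?c)"
      unfolding classA_eq using p p\<alpha> by (intro algA_mult) auto
    also have "x \<dots> = vertex_coeff (tail Q \<alpha>) (A.coset (Poly_Mapping.single p ?c)) * x (classA Q ?\<alpha>)"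
    proof (cases "snd p = []")
      case True
      have "A.coset (Poly_Mapping.single ?\<alpha> ?c) = ?c \<odot>\<^bsub>algA Q\<^esub> classA Q ?\<alpha>"
        using p\<alpha> by (simp add: classA_eq algA_smult)
      then show ?thesis
        using True clA carrier by (cases p) (auto simp: vertex_coeff_coset lookup_single when_def
            path_comp_def path_source_def arrow_path_def inj_module_zero_coset[OF x i]
            inj_moduleD(3)[OF x])
    next
      case False
      then have "Poly_Mapping.single ?\<alpha> 1 \<bullet> Poly_Mapping.single p ?c \<in> arrow_ideal_sq Q"
        using p p\<alpha> by (intro arrow_ideal_sqI single_in_arrow_ideal) (simp_all add: arrow_path_def)
      then have "A.coset (Poly_Mapping.single ?\<alpha> 1 \<bullet> Poly_Mapping.single p ?c) = A.coset 0"
        by (simp only: algA_zero A.coset_zero[unfolded A_quotient kQ_simps])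
      then have "x (A.coset (Poly_Mapping.single ?\<alpha> 1 \<bullet> Poly_Mapping.single p ?c)) = 0"
        by (simp only: inj_module_zero_coset[OF x i])
      moreover have "vertex_coeff (tail Q \<alpha>) (A.coset (Poly_Mapping.single p ?c)) = 0"
        unfolding vertex_coeff_coset[OF carrier] using False
        by (cases p) (simp add: lookup_single when_def)
      ultimately show ?thesis
        by simp
    qed
    finally show ?case
      using carrier by simp
  next
    case (add g h)
    then have gh: "g \<in> carrier kQ" "h \<in> carrier kQ" "g + h \<in> carrier kQ"
      "A.coset (g + h) = A.coset g \<oplus>\<^bsub>algA Q\<^esub> A.coset h"
      "A.coset g \<in> carrier (algA Q)" "A.coset h \<in> carrier (algA Q)"
      using A.coset_closed[of g] A.coset_closed[of h]
      by (simp_all add: algA_add A_quotient kQ_simps order_trans[OF keys_add])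
    then show ?case
      using clA i add x by (simp add: AQ.r_distr inj_moduleD(2) eA_mult vertex_coeff_add distrib_right)
  qed
  then show ?thesis
    using f by blast
qed

section \<open>The left action of A on a single I_i\<close>

lemma inj_lact_closed:
  assumes "i \<in> verts Q" "a \<in> carrier (algA Q)" "\<phi> \<in> inj_module Q i"
  shows "inj_lact Q i a \<phi> \<in> inj_module Q i"
  using assms
  by (auto intro!: ext simp: inj_module_def inj_lact_def eA_mult eA_add eA_smult AQ.l_distr AQ.smult_mult_left
      eA_carrier)

lemma inj_lact_additive: "inj_lact Q i a (\<phi> + \<psi>) = inj_lact Q i a \<phi> + inj_lact Q i a \<psi>"
  by (auto simp: inj_lact_def)

lemma inj_lact_scale: "inj_lact Q i a (\<lambda>u. c * \<phi> u) = (\<lambda>u. c * inj_lact Q i a \<phi> u)"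
  by (auto simp: inj_lact_def)

lemma inj_lact_add:
  assumes "i \<in> verts Q" "a \<in> carrier (algA Q)" "b \<in> carrier (algA Q)" "\<phi> \<in> inj_module Q i"
  shows "inj_lact Q i (a \<oplus>\<^bsub>algA Q\<^esub> b) \<phi> = inj_lact Q i a \<phi> + inj_lact Q i b \<phi>"
  using assms
  by (auto intro!: ext simp: inj_lact_def AQ.r_distr eA_mult inj_moduleD(2) eA_carrier)

lemma inj_lact_smult:
  assumes "i \<in> verts Q" "a \<in> carrier (algA Q)" "\<phi> \<in> inj_module Q i"
  shows "inj_lact Q i (c \<odot>\<^bsub>algA Q\<^esub> a) \<phi> = (\<lambda>u. c * inj_lact Q i a \<phi> u)"
  using assms
  by (auto intro!: ext simp: inj_lact_def AQ.smult_mult_right eA_mult inj_moduleD(3) eA_carrier)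

lemma inj_lact_one:
  assumes "i \<in> verts Q" "\<phi> \<in> inj_module Q i"
  shows "inj_lact Q i \<one>\<^bsub>algA Q\<^esub> \<phi> = \<phi>"
  using assms
  by (auto intro!: ext simp: inj_lact_def inj_moduleD(1) eA_carrier)

lemma inj_lact_mult:
  assumes "i \<in> verts Q" "a \<in> carrier (algA Q)" "b \<in> carrier (algA Q)"
  shows "inj_lact Q i (a \<otimes>\<^bsub>algA Q\<^esub> b) \<phi> = inj_lact Q i a (inj_lact Q i b \<phi>)"
  using assms
  by (auto intro!: ext simp: inj_lact_def AQ.m_assoc eA_mult eA_carrier)

text \<open>By multiplicativity of the character at \<open>i\<close>, the line spanned by
  \<open>e_sharp Q i\<close> is a submodule on which A acts through this character.\<close>

lemma inj_lact_e_sharp: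
  assumes i: "i \<in> verts Q" and a: "a \<in> carrier (algA Q)"
  shows "inj_lact Q i a (e_sharp Q i) = (\<lambda>u. vertex_coeff i a * e_sharp Q i u)"
  using assms
  by (auto intro!: ext simp: inj_lact_def e_sharp_eq(1)[OF i] vertex_coeff_mult eA_mult eA_carrier)

text \<open>The scalar is the one by which \<open>a\<close> acts on
  \<open>e_sharp Q (tail Q \<alpha>)\<close>. This agreement makes the differential commute with the
  left action.\<close>

lemma inj_lact_arrow:
  assumes "\<alpha> \<in> arcs Q" "x \<in> inj_module Q (head Q \<alpha>)" "a \<in> carrier (algA Q)"
  shows "inj_lact Q (head Q \<alpha>) a x (classA Q (arrow_path Q \<alpha>)) =
    vertex_coeff (tail Q \<alpha>) a * x (classA Q (arrow_path Q \<alpha>))"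
proof -
  have "path_target Q (arrow_path Q \<alpha>) = head Q \<alpha>"
    by (simp add: arrow_path_def)
  then show ?thesis
    using assms by (simp add: inj_lact_def arrow_mult arrow_path_in_paths classA_in_eA)
qed

end

section \<open>Linear maps on cochains\<close>

lemma additive_fun_apply: "Modules.additive (\<lambda>h. h i)"
  by (rule Modules.additive.intro) simp

lemma additive_sum_apply: "Modules.additive (\<lambda>h. \<Sum>i\<in>S. h i)"
  by (rule Modules.additive.intro) (simp add: sum.distrib)

lemma lookup_cochain_scale [simp]:
  "Poly_Mapping.lookup (cochain_scale c z) pq = (\<lambda>u. c * Poly_Mapping.lookup z pq u)"
  by (auto simp: cochain_scale_def Poly_Mapping.map.rep_eq when_def fun_eq_iff)

lemma cochain_scale_zeta [simp]: "cochain_scale c (zeta x pq) = zeta (\<lambda>u. c * x u) pq"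
  by (rule poly_mapping_eqI) (auto simp: zeta_def lookup_single when_def fun_eq_iff)

lemma cochain_scale_add_right: "cochain_scale c (z + w) = cochain_scale c z + cochain_scale c w"
  by (rule poly_mapping_eqI) (simp add: lookup_add fun_eq_iff distrib_left)

lemma cochain_scale_add_left: "cochain_scale (c + d) z = cochain_scale c z + cochain_scale d z"
  by (rule poly_mapping_eqI) (simp add: lookup_add fun_eq_iff distrib_right)

lemma cochain_scale_scale: "cochain_scale c (cochain_scale d z) = cochain_scale (c * d) z"
  by (rule poly_mapping_eqI) (simp add: mult.assoc)

lemma cochain_scale_one [simp]: "cochain_scale 1 z = z"
  by (rule poly_mapping_eqI) simp

lemma additive_cochain_scale: "Modules.additive (cochain_scale c)"
  by (rule Modules.additive.intro) (rule cochain_scale_add_right)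

lemma additive_cochain_scale_left: "Modules.additive (\<lambda>c. cochain_scale c z)"
  by (rule Modules.additive.intro) (rule cochain_scale_add_left)

lemmas cochain_scale_zero_left [simp] = Modules.additive.zero[OF additive_cochain_scale_left]
  and cochain_scale_zero_right [simp] = Modules.additive.zero[OF additive_cochain_scale]

lemma additive_zeta: "Modules.additive (\<lambda>x. zeta x pq)"
  by (rule Modules.additive.intro) (simp add: zeta_def single_add)

lemmas zeta_zero [simp] = Modules.additive.zero[OF additive_zeta]

text \<open>No carrier appears: the action and the differential are linear on all finitely supported
  functions, inadmissible indices included, so compositions are linear without closure
  facts.\<close>

definition klinear :: "(('v, 'a, 'k::field) leavitt_cochain \<Rightarrow> ('v, 'a, 'k) leavitt_cochain) \<Rightarrow> bool" where
  "klinear T \<longleftrightarrow> Modules.additive T \<and> (\<forall>c z. T (cochain_scale c z) = cochain_scale c (T z))"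

lemma klinear_additive: "klinear T \<Longrightarrow> Modules.additive T"
  and klinear_scale: "klinear T \<Longrightarrow> T (cochain_scale c z) = cochain_scale c (T z)"
  by (simp_all add: klinear_def)

lemmas klinear_zero = Modules.additive.zero[OF klinear_additive]
  and klinear_add = Modules.additive.add[OF klinear_additive]

lemma klinear_compose: "klinear S \<Longrightarrow> klinear T \<Longrightarrow> klinear (\<lambda>z. S (T z))"
  by (auto simp: klinear_def intro: additive_compose)

lemma klinear_lext:
  assumes "\<And>pq. Modules.additive (F pq)"
    and "\<And>pq c x. F pq (\<lambda>u. c * x u) = cochain_scale c (F pq x)"
  shows "klinear (lext F)"
  unfolding klinear_def
proof (intro conjI allI)
  show add: "Modules.additive (lext F)"
    by (rule additive_lext) fact
  fix c z
  have F0: "F pq 0 = 0" for pq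
    by (rule Modules.additive.zero[OF assms(1)])
  show "lext F (cochain_scale c z) = cochain_scale c (lext F z)"
  proof (rule additive_eqI[where f = z])
    fix pq
    show "lext F (cochain_scale c (Poly_Mapping.single pq (Poly_Mapping.lookup z pq))) =
        cochain_scale c (lext F (Poly_Mapping.single pq (Poly_Mapping.lookup z pq)))"
      using assms(2) cochain_scale_zeta[of c "Poly_Mapping.lookup z pq" pq]
      by (simp add: F0 zeta_def)
  qed (auto intro: additive_compose additive_cochain_scale add)
qed

section \<open>The combinatorics of the action and the differential\<close>

text \<open>
  The action of a generator and the differential move around indices \<open>(p, q)\<close> independently of the
  element of the injective module. Replacing \<open>x \<zeta>\<^sub>(\<^sub>p\<^sub>,\<^sub>q\<^sub>)\<close> by the value of an arbitrary function \<open>e\<close> at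
  \<open>(p, q)\<close> separates this from linearity: both constructions commute with additive maps.
\<close>

fun pair_ract ::
    "('v, 'a) pre_digraph \<Rightarrow> ('v \<Rightarrow> 'a) \<Rightarrow> (('v, 'a) path \<times> ('v, 'a) path \<Rightarrow> 'm::ab_group_add) \<Rightarrow>
     ('v, 'a) leavitt_gen \<Rightarrow> ('v, 'a) path \<times> ('v, 'a) path \<Rightarrow> 'm" where
  "pair_ract Q sp e (Vertex j) (p, q) = (if j = path_source p then e (p, q) else 0)"
| "pair_ract Q sp e (Arrow \<alpha>) (p, q) =
    (if path_length p \<noteq> 0
     then (if \<alpha> = hd (snd p) then e (tilde_path Q p, q) else 0)
     else (if tail Q \<alpha> = path_target Q q
           then e (trivial_path (head Q \<alpha>), post_arrow \<alpha> q) else 0))"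
| "pair_ract Q sp e (Ghost \<alpha>) (p, q) =
    (if path_length p = 0 \<and> path_length q \<noteq> 0 \<and> last (snd q) = \<alpha> \<and> special Q sp \<alpha>
     then e (trivial_path (tail Q \<alpha>), hat_path q)
          - (\<Sum>\<beta>\<in>siblings Q \<alpha>. e (arrow_path Q \<beta>, post_arrow \<beta> (hat_path q)))
     else (if path_source p = head Q \<alpha> then e (pre_arrow Q p \<alpha>, q) else 0))"

fun pair_diff ::
    "('v, 'a) pre_digraph \<Rightarrow> ('v \<Rightarrow> 'a) \<Rightarrow> (('v, 'a) path \<times> ('v, 'a) path \<Rightarrow> 'm::ab_group_add) \<Rightarrow>
     'a \<Rightarrow> ('v, 'a) path \<times> ('v, 'a) path \<Rightarrow> 'm" where
  "pair_diff Q sp e \<alpha> (p, q) =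
    (if path_length q = 0 \<and> path_length p \<noteq> 0 \<and> last (snd p) = \<alpha> \<and> special Q sp \<alpha>
     then e (hat_path p, trivial_path (tail Q \<alpha>))
          - (\<Sum>\<beta>\<in>siblings Q \<alpha>. e (post_arrow \<beta> (hat_path p), arrow_path Q \<beta>))
     else e (p, pre_arrow Q q \<alpha>))"

lemma zeta_ract_eq: "zeta_ract Q sp g x pq = pair_ract Q sp (zeta x) g pq"
  by (cases "(Q, sp, g, x, pq)" rule: zeta_ract.cases) simp_all

lemma leavitt_diff_basis_arrow:
  "leavitt_diff_basis Q sp (arrow_path Q \<alpha>) pq = pair_diff Q sp (zeta (e_sharp Q (tail Q \<alpha>))) \<alpha> pq"
  by (cases pq) (simp add: leavitt_diff_basis_def arrow_path_def)

text \<open>\<open>pair_ract\<close> is an integral combination of values of \<open>e\<close>, so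
  additive maps pass through it. As \<open>T\<close> serve scalar multiplication, the differential,
  the left action and the action of another generator.\<close>

lemma pair_ract_natural:
  assumes "Modules.additive T"
  shows "T (pair_ract Q sp e g pq) = pair_ract Q sp (\<lambda>pq'. T (e pq')) g pq"
  by (cases pq; cases g)
    (simp_all add: Modules.additive.zero[OF assms] Modules.additive.diff[OF assms]
      Modules.additive.sum[OF assms])

lemma pair_diff_natural:
  assumes "Modules.additive T"
  shows "T (pair_diff Q sp e \<alpha> pq) = pair_diff Q sp (\<lambda>pq'. T (e pq')) \<alpha> pq"
  by (cases pq)
    (simp add: Modules.additive.diff[OF assms] Modules.additive.sum[OF assms])

text \<open>Let \<open>e\<close> take values in functions of the summation index. Evaluation at an
  index and summation over \<open>I\<close> are both additive, so the claim is naturality used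
  twice.\<close>

lemma pair_ract_sum:
  "pair_ract Q sp (\<lambda>pq'. \<Sum>i\<in>I. e i pq') g pq = (\<Sum>i\<in>I. pair_ract Q sp (e i) g pq)"
  using pair_ract_natural[OF additive_sum_apply[of I], of Q sp "\<lambda>pq' i. e i pq'" g pq]
    pair_ract_natural[OF additive_fun_apply, of Q sp "\<lambda>pq' i. e i pq'" g pq]
  by simp

lemma pair_ract_minus:
  "pair_ract Q sp (\<lambda>pq'. e pq' - e' pq') g pq = pair_ract Q sp e g pq - pair_ract Q sp e' g pq"
  by (cases pq; cases g) (simp_all add: sum_subtractf)

lemma pair_diff_minus:
  "pair_diff Q sp (\<lambda>pq'. e pq' - e' pq') \<alpha> pq = pair_diff Q sp e \<alpha> pq - pair_diff Q sp e' \<alpha> pq"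
  by (cases pq) (simp add: sum_subtractf)

definition pair_degree :: "('v, 'a) path \<times> ('v, 'a) path \<Rightarrow> int" where
  "pair_degree pq = int (path_length (snd pq)) - int (path_length (fst pq))"

locale leavitt_quiver = quiver Q for Q :: "('v, 'a) pre_digraph" +
  fixes sp :: "'v \<Rightarrow> 'a"
  assumes sp: "i \<in> verts Q \<Longrightarrow> sp i \<in> out_arcs Q i"
begin

lemmas path_defs = path_source_def path_length_def trivial_path_def arrow_path_def hat_path_def
  tilde_path_def post_arrow_def pre_arrow_def

lemma finite_siblings [simp]: "finite (siblings Q \<alpha>)"
  by (simp add: siblings_def)

text \<open>Only one arrow per vertex is special. Hence the correction terms, whose two paths end in
  the same sibling, are admissible.\<close>

lemma siblings_special: "\<lbrakk>\<beta> \<in> siblings Q \<alpha>; special Q sp \<alpha>\<rbrakk> \<Longrightarrow> \<not> special Q sp \<beta>"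
  by (auto simp: siblings_def special_def)

lemma admissible_iff:
  "admissible Q sp ((i, as), (j, bs)) \<longleftrightarrow> (i, as) \<in> paths Q \<and> (j, bs) \<in> paths Q \<and>
    path_target Q (i, as) = path_target Q (j, bs) \<and>
    (as = [] \<or> bs = [] \<or> last as \<noteq> last bs \<or> \<not> special Q sp (last as))"
  by (auto simp: admissible_def path_length_def)

text \<open>The subgroup \<open>H\<close> is arbitrary in order to serve two purposes: with
  \<open>H\<close> the cochains of one degree it gives closure of the action, and with
  \<open>H = {0}\<close>, applied to a difference, it says that only the values of \<open>e\<close>
  at admissible pairs of the right degree and source matter.\<close>

lemma pair_ract_closed:
  fixes H :: "'m::ab_group_add set"
  assumes pq: "admissible Q sp pq" and g: "g \<in> leavitt_gens Q"
    and H: "0 \<in> H" "\<And>x y. x \<in> H \<Longrightarrow> y \<in> H \<Longrightarrow> x - y \<in> H" "\<And>x y. x \<in> H \<Longrightarrow> y \<in> H \<Longrightarrow> x + y \<in> H"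
    and e: "\<And>pq'. \<lbrakk>admissible Q sp pq'; pair_degree pq' = pair_degree pq + gen_degree g;
      path_source (snd pq') = path_source (snd pq)\<rbrakk> \<Longrightarrow> e pq' \<in> H"
  shows "pair_ract Q sp e g pq \<in> H"
proof -
  have sum: "sum f S \<in> H" if "\<And>x. x \<in> S \<Longrightarrow> f x \<in> H" for f :: "'a \<Rightarrow> 'm" and S
    using that by (induction S rule: infinite_finite_induct) (auto intro: H)
  obtain i as j bs where pq': "pq = ((i, as), (j, bs))"
    by (cases pq; cases "fst pq"; cases "snd pq") auto
  show ?thesis
  proof (cases g)
    case (Vertex v)
    then show ?thesis
      using pq e[of pq] H(1) by (auto simp: pq')
  next
    case (Arrow \<alpha>)
    then have "\<alpha> \<in> arcs Q"
      using g by (auto simp: leavitt_gens_def)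
    then show ?thesis
      using pq Arrow H(1) unfolding pq'
      by (cases as) (auto intro!: e simp: pq' admissible_iff path_defs pair_degree_def)
  next
    case (Ghost \<alpha>)
    then have \<alpha>: "\<alpha> \<in> arcs Q"
      using g by (auto simp: leavitt_gens_def)
    show ?thesis
    proof (cases "as = [] \<and> bs \<noteq> [] \<and> last bs = \<alpha> \<and> special Q sp \<alpha>")
      case True
      then obtain bs' where bs: "bs = bs' @ [\<alpha>]"
        by (metis append_butlast_last_id)
      have "e (trivial_path (tail Q \<alpha>), (j, bs')) \<in> H"
        using pq True \<alpha> Ghost by (intro e) (auto simp: pq' bs admissible_iff path_defs pair_degree_def)
      \<comment> \<open>Both paths end in \<beta>, which is not special because its sibling \<alpha>
        is.\<close>
      moreover have "e (arrow_path Q \<beta>, post_arrow \<beta> (j, bs')) \<in> H" if "\<beta> \<in> siblings Q \<alpha>" for \<beta>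
        using pq True \<alpha> Ghost that siblings_special[OF that]
        by (intro e) (auto simp: pq' bs admissible_iff path_defs pair_degree_def siblings_def)
      ultimately show ?thesis
        using True Ghost by (auto simp: pq' bs path_length_def hat_path_def intro!: H sum)
    next
      case False
      then show ?thesis
        using pq \<alpha> H(1) Ghost unfolding pq'
        by (auto intro!: e simp: pq' admissible_iff path_defs pair_degree_def path_target_in_verts)
    qed
  qed
qed

text \<open>If q is trivial and p ends in a special \<alpha>, the pair (p, \<alpha>) is
  inadmissible; its replacements have a trivial second path or end in a nonspecial sibling. In all
  other cases prepending \<alpha> to q preserves admissibility.\<close>

lemma pair_diff_closed:
  fixes H :: "'m::ab_group_add set"
  assumes pq: "admissible Q sp pq" and \<alpha>: "\<alpha> \<in> arcs Q" "head Q \<alpha> = path_source (snd pq)"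
    and H: "0 \<in> H" "\<And>x y. x \<in> H \<Longrightarrow> y \<in> H \<Longrightarrow> x - y \<in> H" "\<And>x y. x \<in> H \<Longrightarrow> y \<in> H \<Longrightarrow> x + y \<in> H"
    and e: "\<And>pq'. \<lbrakk>admissible Q sp pq'; pair_degree pq' = pair_degree pq + 1;
      path_source (snd pq') = tail Q \<alpha>\<rbrakk> \<Longrightarrow> e pq' \<in> H"
  shows "pair_diff Q sp e \<alpha> pq \<in> H"
proof -
  have sum: "sum f S \<in> H" if "\<And>x. x \<in> S \<Longrightarrow> f x \<in> H" for f :: "'a \<Rightarrow> 'm" and S
    using that by (induction S rule: infinite_finite_induct) (auto intro: H)
  obtain i as j bs where pq': "pq = ((i, as), (j, bs))"
    by (cases pq; cases "fst pq"; cases "snd pq") auto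
  show ?thesis
  proof (cases "bs = [] \<and> as \<noteq> [] \<and> last as = \<alpha> \<and> special Q sp \<alpha>")
    case True
    then obtain as' where as: "as = as' @ [\<alpha>]"
      by (metis append_butlast_last_id)
    have "e ((i, as'), trivial_path (tail Q \<alpha>)) \<in> H"
      using pq True \<alpha> by (intro e) (auto simp: pq' as admissible_iff path_defs pair_degree_def)
    moreover have "e (post_arrow \<beta> (i, as'), arrow_path Q \<beta>) \<in> H" if "\<beta> \<in> siblings Q \<alpha>" for \<beta>
      using pq True \<alpha> that siblings_special[OF that]
      by (intro e) (auto simp: pq' as admissible_iff path_defs pair_degree_def siblings_def)
    ultimately show ?thesis
      using True by (auto simp: pq' as path_length_def hat_path_def intro!: H sum)
  next
    case False
    then show ?thesis
      using pq \<alpha> unfolding pq'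
      by (auto intro!: e simp: pq' admissible_iff path_defs pair_degree_def)
  qed
qed

lemma pair_ract_cong:
  assumes "admissible Q sp pq" "g \<in> leavitt_gens Q"
    and "\<And>pq'. \<lbrakk>admissible Q sp pq'; pair_degree pq' = pair_degree pq + gen_degree g;
      path_source (snd pq') = path_source (snd pq)\<rbrakk> \<Longrightarrow> e pq' = e' pq'"
  shows "pair_ract Q sp e g pq = pair_ract Q sp e' g pq"
proof -
  have "pair_ract Q sp (\<lambda>pq'. e pq' - e' pq') g pq \<in> {0}"
    using assms by (intro pair_ract_closed) auto
  then show ?thesis
    by (simp add: pair_ract_minus)
qed

lemma pair_diff_cong:
  assumes "admissible Q sp pq" "\<alpha> \<in> arcs Q" "head Q \<alpha> = path_source (snd pq)"
    and "\<And>pq'. \<lbrakk>admissible Q sp pq'; path_source (snd pq') = tail Q \<alpha>\<rbrakk> \<Longrightarrow> e pq' = e' pq'"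
  shows "pair_diff Q sp e \<alpha> pq = pair_diff Q sp e' \<alpha> pq"
proof -
  have "pair_diff Q sp (\<lambda>pq'. e pq' - e' pq') \<alpha> pq \<in> {0}"
    using assms by (intro pair_diff_closed) auto
  then show ?thesis
    by (simp add: pair_diff_minus)
qed

text \<open>The interfering cases are these. Let \<alpha> be special. If p = \<alpha> and q is
  trivial, an arrow in S(\<alpha>) sends the leading term and its own correction term to the same
  pair, so they cancel, while \<alpha> keeps only the leading term. If p and q are both trivial, the
  ghost of \<alpha> produces on both sides the rewriting of the inadmissible pair (\<alpha>,
  \<alpha>).\<close>

lemma pair_ract_pair_diff:
  fixes e :: "('v, 'a) path \<times> ('v, 'a) path \<Rightarrow> 'm::ab_group_add"
  assumes pq: "admissible Q sp pq" and \<alpha>: "\<alpha> \<in> arcs Q" "head Q \<alpha> = path_source (snd pq)"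
    and g: "g \<in> leavitt_gens Q"
  shows "pair_ract Q sp (pair_diff Q sp e \<alpha>) g pq = pair_diff Q sp (pair_ract Q sp e g) \<alpha> pq"
proof -
  obtain i as j bs where pq': "pq = ((i, as), (j, bs))"
    by (cases pq; cases "fst pq"; cases "snd pq") auto
  show ?thesis
  proof (cases g)
    case (Vertex v)
    then show ?thesis
      by (simp add: pq' path_defs)
  next
    case (Arrow \<beta>)
    then have \<beta>: "\<beta> \<in> arcs Q"
      using g by (auto simp: leavitt_gens_def)
    show ?thesis
    proof (cases as)
      case Nil
      then show ?thesis
        using \<alpha> by (simp add: pq' Arrow path_defs)
    next
      case (Cons \<gamma> as')
      show ?thesis
      proof (cases "as' = [] \<and> bs = [] \<and> \<gamma> = \<alpha> \<and> special Q sp \<alpha>")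
        case True
        have "(\<Sum>\<delta>\<in>siblings Q \<alpha>. if \<beta> = \<delta> then e ((head Q \<delta>, []), tail Q \<delta>, [\<delta>]) else 0) =
            (if \<beta> \<in> siblings Q \<alpha> then e ((head Q \<beta>, []), tail Q \<beta>, [\<beta>]) else 0)"
          by simp
        then show ?thesis
          using pq \<alpha> \<beta> True by (auto simp: pq' Arrow Cons path_defs siblings_def admissible_iff)
      next
        case False
        then show ?thesis
          using pq \<alpha> \<beta> by (auto simp: pq' Arrow Cons path_defs admissible_iff)
      qed
    qed
  next
    case (Ghost \<beta>)
    then have \<beta>: "\<beta> \<in> arcs Q"
      using g by (auto simp: leavitt_gens_def)
    \<comment> \<open>Both orders of operations reach the pair (\<delta>, \<delta>), but record the
      starting vertex of each path once as that of \<alpha> and once as that of \<delta>; siblings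
      share it.\<close>
    have "(\<Sum>\<delta>\<in>siblings Q \<alpha>. e ((tail Q \<alpha>, [\<delta>]), tail Q \<delta>, [\<delta>])) =
        (\<Sum>\<delta>\<in>siblings Q \<alpha>. e ((tail Q \<delta>, [\<delta>]), tail Q \<alpha>, [\<delta>]))"
      by (rule sum.cong) (auto simp: siblings_def)
    then show ?thesis
      using pq \<alpha> \<beta>
      by (cases as; cases bs) (auto simp: pq' Ghost path_defs admissible_iff)
  qed
qed

end

lemma pair_ract_add:
  "pair_ract Q sp (\<lambda>pq'. e pq' + e' pq') g pq = pair_ract Q sp e g pq + pair_ract Q sp e' g pq"
  by (cases pq; cases g) (simp_all add: sum.distrib)

lemma pair_diff_zero [simp]: "pair_diff Q sp (\<lambda>_. 0) \<alpha> pq = 0"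
  by (cases pq) simp

context leavitt_quiver
begin

section \<open>The relations of the Leavitt path algebra on indices\<close>

lemma pair_ract_unit:
  assumes "admissible Q sp pq"
  shows "(\<Sum>i\<in>verts Q. pair_ract Q sp e (Vertex i) pq) = e pq"
proof -
  obtain i as j bs where pq: "pq = ((i, as), (j, bs))"
    by (cases pq; cases "fst pq"; cases "snd pq") auto
  then have "i \<in> verts Q"
    using assms path_source_in_verts[of "(i, as)"] by (simp add: admissible_iff path_defs)
  then show ?thesis
    by (simp add: pq path_defs)
qed

text \<open>In this and the following identities,
  \<open>pair_ract Q sp (pair_ract Q sp e u) v\<close> stands for the word \<open>u v\<close>: the
  outer generator \<open>v\<close> moves the index first, in accordance with the opposite
  multiplication.\<close>

lemma pair_ract_vertex_vertex:
  "pair_ract Q sp (pair_ract Q sp e (Vertex i)) (Vertex j) pq =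
    (if i = j then pair_ract Q sp e (Vertex i) pq else 0)"
  by (cases pq) auto

lemma pair_ract_head_arrow:
  "pair_ract Q sp (pair_ract Q sp e (Vertex (head Q \<alpha>))) (Arrow \<alpha>) pq = pair_ract Q sp e (Arrow \<alpha>) pq"
  by (cases pq) (auto simp: path_defs)

lemma pair_ract_arrow_tail:
  assumes "admissible Q sp pq"
  shows "pair_ract Q sp (pair_ract Q sp e (Arrow \<alpha>)) (Vertex (tail Q \<alpha>)) pq =
    pair_ract Q sp e (Arrow \<alpha>) pq"
proof -
  obtain i as j bs where pq: "pq = ((i, as), (j, bs))"
    by (cases pq; cases "fst pq"; cases "snd pq") auto
  then show ?thesis
    using assms by (cases as) (auto simp: path_defs admissible_iff)
qed

lemma pair_ract_tail_ghost:
  "pair_ract Q sp (pair_ract Q sp e (Vertex (tail Q \<alpha>))) (Ghost \<alpha>) pq = pair_ract Q sp e (Ghost \<alpha>) pq"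
  by (cases pq) (auto simp: path_defs siblings_def intro!: sum.cong)

lemma pair_ract_ghost_head:
  assumes "admissible Q sp pq"
  shows "pair_ract Q sp (pair_ract Q sp e (Ghost \<alpha>)) (Vertex (head Q \<alpha>)) pq =
    pair_ract Q sp e (Ghost \<alpha>) pq"
proof -
  obtain i as j bs where pq: "pq = ((i, as), (j, bs))"
    by (cases pq; cases "fst pq"; cases "snd pq") auto
  then show ?thesis
    using assms by (cases bs rule: rev_cases) (auto simp: path_defs admissible_iff)
qed

text \<open>In the special case \<beta>* produces the shortened pair minus one pair for each sibling
  of \<beta>. Then \<beta> restores the original pair from the first term, whereas for a sibling the
  first term cancels against its own correction.\<close>

lemma pair_ract_arrow_ghost:
  assumes "admissible Q sp pq" and \<alpha>: "\<alpha> \<in> arcs Q" and \<beta>: "\<beta> \<in> arcs Q"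
  shows "pair_ract Q sp (pair_ract Q sp e (Arrow \<alpha>)) (Ghost \<beta>) pq =
    (if \<alpha> = \<beta> then pair_ract Q sp e (Vertex (head Q \<alpha>)) pq else 0)"
proof -
  obtain i as j bs where pq: "pq = ((i, as), (j, bs))"
    by (cases pq; cases "fst pq"; cases "snd pq") auto
  show ?thesis
  proof (cases "as = [] \<and> bs \<noteq> [] \<and> last bs = \<beta> \<and> special Q sp \<beta>")
    case True
    then obtain bs' where bs: "bs = bs' @ [\<beta>]"
      by (metis append_butlast_last_id)
    have "(\<Sum>\<delta>\<in>siblings Q \<beta>. if \<alpha> = \<delta> then e ((head Q \<delta>, []), (j, bs' @ [\<delta>])) else 0) =
        (if \<alpha> \<in> siblings Q \<beta> then e ((head Q \<alpha>, []), (j, bs' @ [\<alpha>])) else 0)"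
      by simp
    then show ?thesis
      using assms True by (auto simp: pq bs path_defs siblings_def admissible_iff)
  next
    case False
    then show ?thesis
      using assms by (auto simp: pq path_defs admissible_iff)
  qed
qed

text \<open>For nontrivial p only its first arrow contributes, being removed and put back. For
  trivial p the special arrow contributes the original pair minus one pair per sibling, and the
  nonspecial arrows contribute exactly these pairs. That there is precisely one special arrow at
  \<open>i\<close> enters here.\<close>

lemma pair_ract_ghost_arrow:
  assumes pq: "admissible Q sp pq" and i: "i \<in> verts Q"
  shows "(\<Sum>\<alpha>\<in>out_arcs Q i. pair_ract Q sp (pair_ract Q sp e (Ghost \<alpha>)) (Arrow \<alpha>) pq) =
    pair_ract Q sp e (Vertex i) pq"
proof -
  obtain i' as j bs where pq': "pq = ((i', as), (j, bs))"
    by (cases pq; cases "fst pq"; cases "snd pq") auto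
  show ?thesis
  proof (cases as)
    case (Cons \<gamma> as')
    have "(\<Sum>\<alpha>\<in>out_arcs Q i. pair_ract Q sp (pair_ract Q sp e (Ghost \<alpha>)) (Arrow \<alpha>) pq) =
        (\<Sum>\<alpha>\<in>out_arcs Q i. if \<alpha> = \<gamma> then e pq else 0)"
      using pq by (intro sum.cong) (auto simp: pq' Cons path_defs admissible_iff)
    also have "\<dots> = (if \<gamma> \<in> out_arcs Q i then e pq else 0)"
      by (simp add: out_arcs_def)
    also have "\<dots> = pair_ract Q sp e (Vertex i) pq"
      using pq by (auto simp: pq' Cons path_defs admissible_iff)
    finally show ?thesis .
  next
    case Nil
    show ?thesis
    proof (cases "i = path_target Q (j, bs)")
      case True
      let ?e = "\<lambda>\<alpha>. e (arrow_path Q \<alpha>, post_arrow \<alpha> (j, bs))"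
      have special_iff: "special Q sp \<alpha> \<longleftrightarrow> \<alpha> = sp i" if "\<alpha> \<in> out_arcs Q i" for \<alpha>
        using that by (auto simp: special_def)
      have out: "out_arcs Q i = insert (sp i) (siblings Q (sp i))" "sp i \<notin> siblings Q (sp i)"
        using sp[OF i] by (auto simp: siblings_def)
      have "(\<Sum>\<alpha>\<in>out_arcs Q i. pair_ract Q sp (pair_ract Q sp e (Ghost \<alpha>)) (Arrow \<alpha>) pq) =
          (\<Sum>\<alpha>\<in>out_arcs Q i. if \<alpha> = sp i then e pq - sum ?e (siblings Q \<alpha>) else ?e \<alpha>)"
        using pq True special_iff
        by (intro sum.cong) (auto simp: pq' Nil path_defs admissible_iff)
      also have "\<dots> = e pq - sum ?e (siblings Q (sp i)) + sum ?e (siblings Q (sp i))"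
        using out by (simp add: out(1)) (auto intro!: sum.cong)
      finally show ?thesis
        using pq True by (simp add: pq' Nil path_defs admissible_iff)
    next
      case False
      then show ?thesis
        using pq by (auto simp: pq' Nil path_defs admissible_iff intro!: sum.neutral)
    qed
  qed
qed

section \<open>Cochains\<close>

text \<open>A set of degrees instead of one degree treats the parts (\<open>D = {l}\<close>) and the
  whole carrier (\<open>D = UNIV\<close>) together. Degree and vertex are read off from the pair,
  which removes the existential quantifiers over them.\<close>

definition cochains :: "int set \<Rightarrow> ('v, 'a, 'k::field) leavitt_cochain set" where
  "cochains D = {z. \<forall>pq. Poly_Mapping.lookup z pq = 0 \<or> admissible Q sp pq \<and> pair_degree pq \<in> D \<and>
     Poly_Mapping.lookup z pq \<in> inj_module Q (path_source (snd pq))}"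

lemma cochainsI:
  "(\<And>pq. Poly_Mapping.lookup z pq \<noteq> 0 \<Longrightarrow> admissible Q sp pq \<and> pair_degree pq \<in> D \<and>
     Poly_Mapping.lookup z pq \<in> inj_module Q (path_source (snd pq))) \<Longrightarrow> z \<in> cochains D"
  unfolding cochains_def by blast

lemma cochainsD:
  assumes "z \<in> cochains D" "Poly_Mapping.lookup z pq \<noteq> 0"
  shows "admissible Q sp pq" "pair_degree pq \<in> D"
    "Poly_Mapping.lookup z pq \<in> inj_module Q (path_source (snd pq))"
  using assms unfolding cochains_def by blast+

lemma cochains_lookup:
  "z \<in> cochains D \<Longrightarrow> Poly_Mapping.lookup z pq \<in> inj_module Q (path_source (snd pq))"
  by (metis cochainsD(3) inj_module_zero)

lemma leavitt_carrier_eq: "leavitt_carrier Q sp = (cochains UNIV :: ('v, 'a, 'k::field) leavitt_cochain set)"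
proof -
  have "(\<exists>l. \<exists>i\<in>verts Q. pq \<in> admissible_pairs Q sp l i \<and> \<phi> \<in> inj_module Q i) \<longleftrightarrow>
      admissible Q sp pq \<and> \<phi> \<in> inj_module Q (path_source (snd pq))"
    for pq and \<phi> :: "('v, 'a, 'k) functional"
    using path_source_in_verts[of "snd pq"]
    by (cases pq) (auto simp: admissible_pairs_def admissible_def)
  then show ?thesis
    unfolding leavitt_carrier_def cochains_def by (simp only: in_keys_iff Ball_def) blast
qed

lemma leavitt_part_eq: "leavitt_part Q sp l = (cochains {l} :: ('v, 'a, 'k::field) leavitt_cochain set)"
proof -
  have "(\<exists>i\<in>verts Q. pq \<in> admissible_pairs Q sp l i \<and> \<phi> \<in> inj_module Q i) \<longleftrightarrow>
      admissible Q sp pq \<and> pair_degree pq = l \<and> \<phi> \<in> inj_module Q (path_source (snd pq))"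
    for pq and \<phi> :: "('v, 'a, 'k) functional"
    using path_source_in_verts[of "snd pq"]
    by (cases pq) (auto simp: admissible_pairs_def admissible_def pair_degree_def)
  then show ?thesis
    unfolding leavitt_part_def cochains_def by (simp only: in_keys_iff Ball_def) blast
qed

lemma cochains_mono: "D \<subseteq> D' \<Longrightarrow> cochains D \<subseteq> cochains D'"
  unfolding cochains_def by blast

lemma cochains_zero [simp, intro]: "0 \<in> cochains D"
  by (rule cochainsI) simp

lemma cochains_add [intro]:
  assumes "z \<in> cochains D" "w \<in> cochains D"
  shows "z + w \<in> cochains D"
proof (rule cochainsI)
  fix pq assume "Poly_Mapping.lookup (z + w) pq \<noteq> 0"
  then have "Poly_Mapping.lookup z pq \<noteq> 0 \<or> Poly_Mapping.lookup w pq \<noteq> 0"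
    by (auto simp: lookup_add)
  then have "admissible Q sp pq \<and> pair_degree pq \<in> D"
    using cochainsD(1,2)[OF assms(1)] cochainsD(1,2)[OF assms(2)] by blast
  then show "admissible Q sp pq \<and> pair_degree pq \<in> D \<and>
      Poly_Mapping.lookup (z + w) pq \<in> inj_module Q (path_source (snd pq))"
    using assms by (simp add: lookup_add inj_module_add cochains_lookup)
qed

lemma cochains_scale [intro]:
  assumes "z \<in> cochains D"
  shows "cochain_scale c z \<in> cochains D"
proof (rule cochainsI)
  fix pq assume "Poly_Mapping.lookup (cochain_scale c z) pq \<noteq> 0"
  then have "Poly_Mapping.lookup z pq \<noteq> 0"
    by (auto simp: zero_fun_def)
  then show "admissible Q sp pq \<and> pair_degree pq \<in> D \<and>
      Poly_Mapping.lookup (cochain_scale c z) pq \<in> inj_module Q (path_source (snd pq))"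
    using cochainsD[OF assms] by (simp add: inj_module_smult)
qed

lemma cochain_scale_minus_one: "cochain_scale (- 1) z = - z"
  by (rule poly_mapping_eqI) (simp add: fun_eq_iff)

lemma cochains_uminus [intro]: "z \<in> cochains D \<Longrightarrow> - z \<in> cochains D"
  using cochains_scale[of z D "- 1"] by (simp only: cochain_scale_minus_one)

lemma cochains_diff [intro]: "\<lbrakk>z \<in> cochains D; w \<in> cochains D\<rbrakk> \<Longrightarrow> z - w \<in> cochains D"
  using cochains_add[of z D "- w"] by auto

lemma cochains_sum [intro]: "(\<And>i. i \<in> S \<Longrightarrow> f i \<in> cochains D) \<Longrightarrow> sum f S \<in> cochains D"
  by (induction S rule: infinite_finite_induct) auto

lemma cochains_zeta [intro]:
  "\<lbrakk>admissible Q sp pq; pair_degree pq \<in> D; x \<in> inj_module Q (path_source (snd pq))\<rbrakk> \<Longrightarrow>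
    zeta x pq \<in> cochains D"
  by (rule cochainsI) (simp add: zeta_def lookup_single when_def split: if_splits)

lemma cochains_induct [consumes 1, case_names zero zeta add]:
  assumes "z \<in> cochains D" "P 0"
    and "\<And>pq x. \<lbrakk>admissible Q sp pq; pair_degree pq \<in> D; x \<in> inj_module Q (path_source (snd pq))\<rbrakk> \<Longrightarrow>
      P (zeta x pq)"
    and "\<And>z w. P z \<Longrightarrow> P w \<Longrightarrow> P (z + w)"
  shows "P z"
proof (rule poly_mapping_induct_single)
  fix pq assume "pq \<in> Poly_Mapping.keys z"
  then show "P (Poly_Mapping.single pq (Poly_Mapping.lookup z pq))"
    using cochainsD[OF assms(1)] unfolding zeta_def[symmetric] in_keys_iff
    by (intro assms(3))
qed (use assms in auto)

lemma cochains_eqI: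
  assumes "z \<in> cochains D" "klinear S" "klinear T"
    and "\<And>pq x. \<lbrakk>admissible Q sp pq; pair_degree pq \<in> D; x \<in> inj_module Q (path_source (snd pq))\<rbrakk> \<Longrightarrow>
      S (zeta x pq) = T (zeta x pq)"
  shows "S z = T z"
  using assms(1)
  by (induction rule: cochains_induct) (simp_all add: assms klinear_zero klinear_add)

lemma cochains_shift:
  assumes "z \<in> cochains D" "klinear T"
    and "\<And>pq x. \<lbrakk>admissible Q sp pq; x \<in> inj_module Q (path_source (snd pq))\<rbrakk> \<Longrightarrow>
      T (zeta x pq) \<in> cochains {pair_degree pq + d}"
  shows "T z \<in> cochains ((\<lambda>n. n + d) ` D)"
  using assms(1)
proof (induction rule: cochains_induct)
  case (zeta pq x)
  then show ?case
    using assms(3)[of pq x] cochains_mono[of "{pair_degree pq + d}" "(\<lambda>n. n + d) ` D"] by auto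
qed (auto simp: klinear_zero[OF assms(2)] klinear_add[OF assms(2)])

section \<open>Linearity and compatibility of action and differential\<close>

lemma gen_ract_eq: "gen_ract Q sp z g = lext (\<lambda>pq x. pair_ract Q sp (zeta x) g pq) z"
  by (simp add: gen_ract_def lext_def zeta_ract_eq)

lemma klinear_gen_ract:
  "klinear (\<lambda>z. gen_ract Q sp z g :: ('v, 'a, 'k::field) leavitt_cochain)"
  unfolding gen_ract_eq
proof (rule klinear_lext)
  show "Modules.additive (\<lambda>x. pair_ract Q sp (zeta x) g pq)" for pq
    by (rule Modules.additive.intro)
      (simp add: Modules.additive.add[OF additive_zeta, abs_def] pair_ract_add)
  show "pair_ract Q sp (zeta (\<lambda>u. c * x u)) g pq = cochain_scale c (pair_ract Q sp (zeta x) g pq)"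
    for pq c and x :: "('v, 'a, 'k) functional"
    by (simp add: pair_ract_natural[OF additive_cochain_scale])
qed

lemma gen_ract_zeta:
  fixes x :: "('v, 'a, 'k::field) functional"
  shows "gen_ract Q sp (zeta x pq) g = pair_ract Q sp (zeta x) g pq"
proof -
  have "pair_ract Q sp (zeta 0) g pq = (0 :: ('v, 'a, 'k) leavitt_cochain)"
    by (cases pq; cases g) simp_all
  then show ?thesis
    unfolding gen_ract_eq by (simp add: zeta_def[of x])
qed

text \<open>The later generator \<open>h\<close> acts on the values and so moves inside by
  naturality. This turns composition of actions into nested \<open>pair_ract\<close> with the order
  reversed.\<close>

lemma gen_ract_pair_ract:
  "gen_ract Q sp (pair_ract Q sp (zeta x) g pq) h = pair_ract Q sp (pair_ract Q sp (zeta x) h) g pq"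
  by (simp add: pair_ract_natural[OF klinear_additive[OF klinear_gen_ract]] gen_ract_zeta)

lemma gen_ract_closed:
  fixes z :: "('v, 'a, 'k::field) leavitt_cochain"
  assumes "z \<in> cochains D" "g \<in> leavitt_gens Q"
  shows "gen_ract Q sp z g \<in> cochains ((\<lambda>n. n + gen_degree g) ` D)"
  using assms(1) klinear_gen_ract
proof (rule cochains_shift)
  fix pq and x :: "('v, 'a, 'k) functional"
  assume "admissible Q sp pq" "x \<in> inj_module Q (path_source (snd pq))"
  then show "gen_ract Q sp (zeta x pq) g \<in> cochains {pair_degree pq + gen_degree g}"
    unfolding gen_ract_zeta using assms(2) by (intro pair_ract_closed) auto
qed

lemma leavitt_diff_eq: "leavitt_diff Q sp z = lext (\<lambda>pq x. \<Sum>b\<in>eA_basis Q (path_source (snd pq)).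
    cochain_scale (x (classA Q b)) (leavitt_diff_basis Q sp b pq)) z"
  by (simp add: leavitt_diff_def lext_def case_prod_beta)

lemma klinear_leavitt_diff: "klinear (leavitt_diff Q sp)"
  unfolding leavitt_diff_eq
  by (rule klinear_lext)
    (auto intro!: Modules.additive.intro simp: cochain_scale_add_left sum.distrib cochain_scale_scale
      Modules.additive.sum[OF additive_cochain_scale])

lemma leavitt_diff_zeta:
  "leavitt_diff Q sp (zeta x pq) = (\<Sum>\<alpha>\<in>in_arcs Q (path_source (snd pq)).
    cochain_scale (x (classA Q (arrow_path Q \<alpha>))) (pair_diff Q sp (zeta (e_sharp Q (tail Q \<alpha>))) \<alpha> pq))"
proof -
  let ?i = "path_source (snd pq)"
  let ?F = "\<lambda>b. cochain_scale (x (classA Q b)) (leavitt_diff_basis Q sp b pq)"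
  have "leavitt_diff Q sp (zeta x pq) = sum ?F (eA_basis Q ?i)"
    unfolding leavitt_diff_eq zeta_def by (subst lext_single) simp_all
  also have "\<dots> = ?F (trivial_path ?i) + sum ?F (arrow_path Q ` in_arcs Q ?i)"
    unfolding eA_basis_def by (rule sum.insert) (auto simp: trivial_path_def arrow_path_def)
  also have "?F (trivial_path ?i) = 0"
    by (cases pq) (simp add: leavitt_diff_basis_def trivial_path_def)
  also have "sum ?F (arrow_path Q ` in_arcs Q ?i) = (\<Sum>\<alpha>\<in>in_arcs Q ?i. ?F (arrow_path Q \<alpha>))"
    by (subst sum.reindex) (auto simp: inj_on_def arrow_path_def)
  finally show ?thesis
    by (simp add: leavitt_diff_basis_arrow)
qed

lemma pair_diff_e_sharp_closed:
  assumes "admissible Q sp pq" "\<alpha> \<in> in_arcs Q (path_source (snd pq))"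
  shows "pair_diff Q sp (zeta (e_sharp Q (tail Q \<alpha>) :: ('v, 'a, 'k::field) functional)) \<alpha> pq
    \<in> cochains {pair_degree pq + 1}"
  using assms by (intro pair_diff_closed) (auto intro!: cochains_zeta e_sharp_eq(2))

lemma leavitt_diff_closed:
  fixes z :: "('v, 'a, 'k::field) leavitt_cochain"
  assumes "z \<in> cochains D"
  shows "leavitt_diff Q sp z \<in> cochains ((\<lambda>n. n + 1) ` D)"
  using assms klinear_leavitt_diff
proof (rule cochains_shift)
  fix pq and x :: "('v, 'a, 'k) functional"
  assume "admissible Q sp pq"
  then show "leavitt_diff Q sp (zeta x pq) \<in> cochains {pair_degree pq + 1}"
    unfolding leavitt_diff_zeta by (auto intro!: pair_diff_e_sharp_closed)
qed

text \<open>The differential is a combination of elements \<open>zeta (e_sharp Q i) pq\<close>. Its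
  next application reads off their coordinates at arrows, which are 0 at every index
  \<open>pq\<close>.\<close>

lemma leavitt_diff_diff:
  fixes z :: "('v, 'a, 'k::field) leavitt_cochain"
  assumes "z \<in> cochains D"
  shows "leavitt_diff Q sp (leavitt_diff Q sp z) = 0"
proof -
  have e_sharp: "leavitt_diff Q sp (zeta (e_sharp Q i) pq) = (0 :: ('v, 'a, 'k) leavitt_cochain)"
    if "i \<in> verts Q" for i pq
    using that by (simp add: leavitt_diff_zeta e_sharp_arrow)
  have "klinear (\<lambda>z. 0 :: ('v, 'a, 'k) leavitt_cochain)"
    by (simp add: klinear_def Modules.additive_def)
  with assms show ?thesis
  proof (rule cochains_eqI[OF _ klinear_compose[OF klinear_leavitt_diff klinear_leavitt_diff]])
    fix pq and x :: "('v, 'a, 'k) functional"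
    assume "admissible Q sp pq"
    show "leavitt_diff Q sp (leavitt_diff Q sp (zeta x pq)) = 0"
      unfolding leavitt_diff_zeta
      by (simp add: Modules.additive.sum[OF klinear_additive[OF klinear_leavitt_diff]]
          klinear_scale[OF klinear_leavitt_diff]
          pair_diff_natural[OF klinear_additive[OF klinear_leavitt_diff]] e_sharp)
  qed
qed

text \<open>A generator changes neither \<open>x\<close> nor the source of q, so the incoming arrows
  and the coefficients of the differential are the same before and after. The claim thus splits into
  one index identity \<open>pair_ract_pair_diff\<close> per incoming arrow.\<close>

lemma leavitt_diff_gen_ract:
  fixes z :: "('v, 'a, 'k::field) leavitt_cochain"
  assumes z: "z \<in> cochains D" and g: "g \<in> leavitt_gens Q"
  shows "leavitt_diff Q sp (gen_ract Q sp z g) = gen_ract Q sp (leavitt_diff Q sp z) g"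
  using z klinear_compose[OF klinear_leavitt_diff klinear_gen_ract]
    klinear_compose[OF klinear_gen_ract klinear_leavitt_diff]
proof (rule cochains_eqI)
  fix pq and x :: "('v, 'a, 'k) functional"
  assume pq: "admissible Q sp pq"
  let ?I = "in_arcs Q (path_source (snd pq))"
  let ?x = "\<lambda>\<alpha>. x (classA Q (arrow_path Q \<alpha>))"
  let ?e = "\<lambda>\<alpha>. zeta (e_sharp Q (tail Q \<alpha>)) :: _ \<Rightarrow> ('v, 'a, 'k) leavitt_cochain"
  have "leavitt_diff Q sp (gen_ract Q sp (zeta x pq) g) =
      pair_ract Q sp (\<lambda>pq'. leavitt_diff Q sp (zeta x pq')) g pq"
    unfolding gen_ract_zeta by (rule pair_ract_natural[OF klinear_additive[OF klinear_leavitt_diff]])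
  also have "\<dots> = pair_ract Q sp (\<lambda>pq'. \<Sum>\<alpha>\<in>?I. cochain_scale (?x \<alpha>) (pair_diff Q sp (?e \<alpha>) \<alpha> pq')) g pq"
    using pq g by (rule pair_ract_cong) (simp add: leavitt_diff_zeta)
  also have "\<dots> = (\<Sum>\<alpha>\<in>?I. cochain_scale (?x \<alpha>) (pair_ract Q sp (pair_diff Q sp (?e \<alpha>) \<alpha>) g pq))"
    by (simp add: pair_ract_sum pair_ract_natural[OF additive_cochain_scale])
  also have "\<dots> = (\<Sum>\<alpha>\<in>?I. cochain_scale (?x \<alpha>) (pair_diff Q sp (pair_ract Q sp (?e \<alpha>) g) \<alpha> pq))"
    using pq g by (intro sum.cong) (simp_all add: pair_ract_pair_diff)
  also have "\<dots> = gen_ract Q sp (leavitt_diff Q sp (zeta x pq)) g"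
    unfolding leavitt_diff_zeta
    by (simp add: Modules.additive.sum[OF klinear_additive[OF klinear_gen_ract]]
        klinear_scale[OF klinear_gen_ract]
        pair_diff_natural[OF klinear_additive[OF klinear_gen_ract]] gen_ract_zeta)
  finally show "leavitt_diff Q sp (gen_ract Q sp (zeta x pq) g) =
      gen_ract Q sp (leavitt_diff Q sp (zeta x pq)) g" .
qed

end

section \<open>Homogeneous components\<close>

definition component :: "('b \<Rightarrow> int) \<Rightarrow> int \<Rightarrow> ('b \<Rightarrow>\<^sub>0 'c::ab_group_add) \<Rightarrow> ('b \<Rightarrow>\<^sub>0 'c)" where
  "component d n = lext (\<lambda>k x. if d k = n then Poly_Mapping.single k x else 0)"

lemma additive_component: "Modules.additive (component d n)"
  unfolding component_def by (rule additive_lext) (auto intro!: Modules.additive.intro simp: single_add)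

lemmas component_add = Modules.additive.add[OF additive_component]
  and component_zero [simp] = Modules.additive.zero[OF additive_component]

lemma component_single [simp]:
  "component d n (Poly_Mapping.single k x) = (if d k = n then Poly_Mapping.single k x else 0)"
  by (simp add: component_def)

lemma lookup_component [simp]:
  "Poly_Mapping.lookup (component d n f) k = (if d k = n then Poly_Mapping.lookup f k else 0)"
  by (rule additive_eqI[where f = f])
    (auto intro!: Modules.additive.intro simp: component_add lookup_add lookup_single when_def)

lemma keys_component: "Poly_Mapping.keys (component d n f) = {k \<in> Poly_Mapping.keys f. d k = n}"
  by (auto simp: in_keys_iff split: if_splits)

lemma keys_component_subset: "Poly_Mapping.keys f \<subseteq> S \<Longrightarrow> Poly_Mapping.keys (component d n f) \<subseteq> S"
  by (auto simp: keys_component)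

lemma component_homogeneous:
  assumes "\<And>k. k \<in> Poly_Mapping.keys f \<Longrightarrow> d k = m"
  shows "component d n f = (if n = m then f else 0)"
  using assms by (intro poly_mapping_eqI) (auto simp: in_keys_iff)

lemma sum_component: "(\<Sum>n\<in>d ` Poly_Mapping.keys f. component d n f) = f"
proof (rule poly_mapping_eqI)
  fix k
  have "(\<Sum>n\<in>d ` Poly_Mapping.keys f. if d k = n then Poly_Mapping.lookup f k else 0) =
      (if d k \<in> d ` Poly_Mapping.keys f then Poly_Mapping.lookup f k else 0)"
    by simp
  then show "Poly_Mapping.lookup (\<Sum>n\<in>d ` Poly_Mapping.keys f. component d n f) k = Poly_Mapping.lookup f k"
    by (auto simp: lookup_sum in_keys_iff)
qed

lemma component_outside: "n \<notin> d ` Poly_Mapping.keys f \<Longrightarrow> component d n f = 0"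
  by (rule poly_mapping_eqI) (auto simp: in_keys_iff)

lemma keys_convolution:
  assumes "r \<in> Poly_Mapping.keys (convolution mul f g)"
  obtains p q where "p \<in> Poly_Mapping.keys f" "q \<in> Poly_Mapping.keys g" "mul p q = Some r"
proof -
  have "r \<in> (\<Union>p\<in>Poly_Mapping.keys f. \<Union>q\<in>Poly_Mapping.keys g. Poly_Mapping.keys (case mul p q of
     None \<Rightarrow> 0 | Some r \<Rightarrow> Poly_Mapping.single r (Poly_Mapping.lookup f p * Poly_Mapping.lookup g q)))"
    using assms unfolding convolution_def lext_def by (blast dest: keys_sum[THEN subsetD])
  then show ?thesis
    using that by (auto split: option.splits if_splits)
qed

lemma finsum_eq_sum:
  fixes G :: "('a::comm_monoid_add, 'm) ring_scheme"
  assumes "abelian_monoid G" "\<And>x y. x \<oplus>\<^bsub>G\<^esub> y = x + y" "\<zero>\<^bsub>G\<^esub> = 0" "f \<in> S \<rightarrow> carrier G"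
  shows "finsum G f S = sum f S"
proof -
  interpret abelian_monoid G by fact
  show ?thesis
    using assms(4) by (induction S rule: infinite_finite_induct) (simp_all add: assms(2,3) Pi_def)
qed

section \<open>The Leavitt path algebra\<close>

abbreviation word_degree :: "('v, 'a) leavitt_gen list \<Rightarrow> int" where
  "word_degree w \<equiv> sum_list (map gen_degree w)"

context quiver
begin

sublocale W: finite_category "lists (leavitt_gens Q)" "\<lambda>u v. Some (u @ v)" "{[]}"
  by standard auto

abbreviation free_alg :: "('k::field, ('v, 'a) leavitt_gen list \<Rightarrow>\<^sub>0 'k) module" where
  "free_alg \<equiv> leavitt_free Q"

abbreviation mult_free :: "(('v, 'a) leavitt_gen list \<Rightarrow>\<^sub>0 'k::field) \<Rightarrow>
    (('v, 'a) leavitt_gen list \<Rightarrow>\<^sub>0 'k) \<Rightarrow> (('v, 'a) leavitt_gen list \<Rightarrow>\<^sub>0 'k)" (infixl \<open>\<star>\<close> 70) where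
  "mult_free \<equiv> convolution (\<lambda>u v. Some (u @ v))"

lemmas free_simps = category_algebra_simps[of "lists (leavitt_gens Q)" "\<lambda>u v. Some (u @ v)" "{[]}",
    folded leavitt_free_def]

lemma free_algebra:
  "ring_algebra ring_of_type_algebra (free_alg :: ('k::field, ('v, 'a) leavitt_gen list \<Rightarrow>\<^sub>0 'k) module)"
  unfolding leavitt_free_def by (rule W.category_algebra_algebra)

interpretation F: ring_algebra ring_of_type_algebra
  "free_alg :: ('k::field, ('v, 'a) leavitt_gen list \<Rightarrow>\<^sub>0 'k) module"
  by (rule free_algebra)

lemma gens_closed:
  "i \<in> verts Q \<Longrightarrow> Vertex i \<in> leavitt_gens Q"
  "\<alpha> \<in> arcs Q \<Longrightarrow> Arrow \<alpha> \<in> leavitt_gens Q"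
  "\<alpha> \<in> arcs Q \<Longrightarrow> Ghost \<alpha> \<in> leavitt_gens Q"
  by (simp_all add: leavitt_gens_def)

text \<open>Each relation is a difference of two elements homogeneous of a common degree: 1 or -1
  where a vertex multiplies a single arrow or ghost, and 0 otherwise. A zero term has no keys and
  fits any degree.\<close>

lemma relations_homogeneous:
  assumes "r \<in> leavitt_relations Q"
  shows "Poly_Mapping.keys r \<subseteq> lists (leavitt_gens Q) \<and>
    (\<exists>n. \<forall>w\<in>Poly_Mapping.keys r. word_degree w = n)"
proof -
  have diff: "Poly_Mapping.keys (f - g) \<subseteq> lists (leavitt_gens Q) \<and>
      (\<exists>n. \<forall>w\<in>Poly_Mapping.keys (f - g). word_degree w = n)"
    if "\<And>w. w \<in> Poly_Mapping.keys f \<union> Poly_Mapping.keys g \<Longrightarrow> w \<in> lists (leavitt_gens Q) \<and> word_degree w = n"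
    for f g :: "('v, 'a) leavitt_gen list \<Rightarrow>\<^sub>0 'b" and n
    using that keys_diff[of f g] by blast
  from assms show ?thesis
    unfolding leavitt_relations_def
    by (elim UnE; (elim insertE emptyE CollectE exE conjE)?; hypsubst?; intro diff)
      (auto simp: gens_closed dest!: keys_sum[THEN subsetD] split: if_splits)
qed

lemma ideal_leavitt_ideal:
  "ideal (leavitt_ideal Q) (free_alg :: ('k::field, ('v, 'a) leavitt_gen list \<Rightarrow>\<^sub>0 'k) module)"
  unfolding leavitt_ideal_def using relations_homogeneous
  by (intro F.genideal_ideal) (auto simp: free_simps)

lemma leavitt_ideal_minimal:
  assumes "ideal I (free_alg :: ('k::field, ('v, 'a) leavitt_gen list \<Rightarrow>\<^sub>0 'k) module)"
    "leavitt_relations Q \<subseteq> I"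
  shows "leavitt_ideal Q \<subseteq> I"
  unfolding leavitt_ideal_def using assms by (rule F.genideal_minimal)

lemma relations_in_leavitt_ideal: "leavitt_relations Q \<subseteq> leavitt_ideal Q"
  unfolding leavitt_ideal_def using relations_homogeneous
  by (intro F.genideal_self) (auto simp: free_simps)

interpretation L: algebra_ideal ring_of_type_algebra
  "free_alg :: ('k::field, ('v, 'a) leavitt_gen list \<Rightarrow>\<^sub>0 'k) module" "leavitt_ideal Q"
  by (intro algebra_ideal.intro free_algebra ideal_leavitt_ideal)

lemma L_quotient: "L.quotient = leavitt_algebra Q"
  by (simp add: leavitt_algebra_def)

lemmas leavitt_add = L.quotient_add[unfolded L_quotient free_simps]
  and leavitt_mult = L.quotient_mult[unfolded L_quotient free_simps]
  and leavitt_smult = L.quotient_smult[unfolded L_quotient free_simps]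
  and leavitt_zero = L.coset_zero[unfolded L_quotient free_simps]
  and leavitt_one = L.coset_one[unfolded L_quotient free_simps]
  and leavitt_coset_closed = L.coset_closed[unfolded L_quotient free_simps]
  and leavitt_coset_ideal = L.coset_ideal[unfolded L_quotient free_simps]

lemma leavitt_cases:
  assumes "u \<in> carrier (leavitt_algebra Q)"
  obtains f where "Poly_Mapping.keys f \<subseteq> lists (leavitt_gens Q)" "u = L.coset f"
  using assms unfolding L_quotient[symmetric] by (elim L.coset_cases) (simp add: free_simps)

lemma leavitt_algebra_algebra:
  "ring_algebra ring_of_type_algebra
    (leavitt_algebra Q :: ('k::field, (('v, 'a) leavitt_gen list \<Rightarrow>\<^sub>0 'k) set) module)"
  using L.quotient_ring_algebra by (simp only: L_quotient)

section \<open>The grading of the Leavitt path algebra\<close>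

lemma component_word_mult:
  "component word_degree n (Poly_Mapping.single u c \<star> g) =
    Poly_Mapping.single u c \<star> component word_degree (n - word_degree u) g"
  by (rule additive_eqI[where f = g])
    (auto intro: additive_compose additive_component additive_convolution_right
      additive_compose[OF additive_convolution_right])

lemma component_mult_word:
  "component word_degree n (g \<star> Poly_Mapping.single u c) =
    component word_degree (n - word_degree u) g \<star> Poly_Mapping.single u c"
  by (rule additive_eqI[where f = g])
    (auto intro: additive_compose[OF additive_component additive_convolution_left] 
      additive_compose[OF additive_convolution_left additive_component])

text \<open>The elements with all components in the ideal form an ideal themselves, since
  multiplication by a word only shifts degrees, and it contains the homogeneous relations.
  Minimality of the generated ideal then applies.\<close>

lemma component_leavitt_ideal:
  fixes f :: "('v, 'a) leavitt_gen list \<Rightarrow>\<^sub>0 'k::field"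
  assumes "f \<in> leavitt_ideal Q"
  shows "component word_degree n f \<in> leavitt_ideal Q"
proof -
  let ?I = "{f \<in> carrier free_alg. \<forall>n. component word_degree n f \<in>
    (leavitt_ideal Q :: (('v, 'a) leavitt_gen list \<Rightarrow>\<^sub>0 'k) set)}"
  have zero: "0 \<in> (leavitt_ideal Q :: (('v, 'a) leavitt_gen list \<Rightarrow>\<^sub>0 'k) set)"
    using L.zero_closed by (simp add: free_simps)
  have add: "f + g \<in> leavitt_ideal Q"
    if "f \<in> leavitt_ideal Q" "g \<in> leavitt_ideal Q" for f g :: "('v, 'a) leavitt_gen list \<Rightarrow>\<^sub>0 'k"
    using L.a_closed[OF that] by (simp add: free_simps)
  have left: "component word_degree n (f \<star> g) \<in> leavitt_ideal Q"
    if "g \<in> ?I" "f \<in> carrier free_alg" for f g :: "('v, 'a) leavitt_gen list \<Rightarrow>\<^sub>0 'k" and n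
  proof (rule poly_mapping_induct_single[where f = f])
    fix u assume u: "u \<in> Poly_Mapping.keys f"
    show "component word_degree n (Poly_Mapping.single u (Poly_Mapping.lookup f u) \<star> g) \<in> leavitt_ideal Q"
      unfolding component_word_mult using that u
      by (intro L.I_l_closed[unfolded free_simps]) (auto simp: free_simps)
  qed (simp_all add: zero add convolution_add_left component_add)
  have right: "component word_degree n (g \<star> f) \<in> leavitt_ideal Q"
    if "g \<in> ?I" "f \<in> carrier free_alg" for f g :: "('v, 'a) leavitt_gen list \<Rightarrow>\<^sub>0 'k" and n
  proof (rule poly_mapping_induct_single[where f = f])
    fix u assume u: "u \<in> Poly_Mapping.keys f"
    show "component word_degree n (g \<star> Poly_Mapping.single u (Poly_Mapping.lookup f u)) \<in> leavitt_ideal Q"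
      unfolding component_mult_word using that u
      by (intro L.I_r_closed[unfolded free_simps]) (auto simp: free_simps)
  qed (simp_all add: zero add convolution_add_right component_add)
  have "ideal ?I free_alg"
    by (rule F.idealI_closed, blast)
      (clarsimp simp: free_simps zero add component_add left[unfolded free_simps]
        right[unfolded free_simps] W.convolution_closed order_trans[OF keys_add])+
  moreover have "leavitt_relations Q \<subseteq> ?I"
  proof
    fix r :: "('v, 'a) leavitt_gen list \<Rightarrow>\<^sub>0 'k"
    assume r: "r \<in> leavitt_relations Q"
    then obtain m where "\<And>w. w \<in> Poly_Mapping.keys r \<Longrightarrow> word_degree w = m"
      using relations_homogeneous by blast
    then have "component word_degree n r = (if n = m then r else 0)" for n
      by (rule component_homogeneous)
    then show "r \<in> ?I"
      using r relations_homogeneous[OF r] relations_in_leavitt_ideal zero by (auto simp: free_simps)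
  qed
  ultimately show ?thesis
    using leavitt_ideal_minimal assms by blast
qed

text \<open>The choice of representative is harmless because components of elements of the ideal lie
  in the ideal.\<close>

definition leavitt_component ::
    "int \<Rightarrow> (('v, 'a) leavitt_gen list \<Rightarrow>\<^sub>0 'k::field) set \<Rightarrow> (('v, 'a) leavitt_gen list \<Rightarrow>\<^sub>0 'k) set" where
  "leavitt_component n u = L.coset (component word_degree n (SOME f. f \<in> u))"

lemma leavitt_component_coset:
  assumes "Poly_Mapping.keys f \<subseteq> lists (leavitt_gens Q)"
  shows "leavitt_component n (L.coset f) = L.coset (component word_degree n f)"
proof -
  have "(SOME g. g \<in> L.coset f) \<in> L.coset f"
    using L.a_rcos_self[of f] assms by (intro someI) (simp add: free_simps)
  then obtain h where h: "h \<in> leavitt_ideal Q" "(SOME g. g \<in> L.coset f) = h + f"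
    by (auto simp: a_r_coset_def' free_simps)
  have "Poly_Mapping.keys (component word_degree n f) \<subseteq> lists (leavitt_gens Q)"
    using assms by (auto simp: keys_component)
  moreover have "component word_degree n h \<in> leavitt_ideal Q"
    by (rule component_leavitt_ideal) fact
  moreover from this have "Poly_Mapping.keys (component word_degree n h) \<subseteq> lists (leavitt_gens Q)"
    using L.Icarr by (auto simp: free_simps)
  ultimately have "L.coset (component word_degree n h + component word_degree n f) =
      L.coset (component word_degree n f)"
    by (simp add: leavitt_coset_ideal L.quotient_ring[unfolded L_quotient, THEN ring.ring_simprules(8)]
        leavitt_coset_closed flip: leavitt_add)
  then show ?thesis
    unfolding leavitt_component_def h(2) component_add .
qed

lemma leavitt_partI:
  "\<lbrakk>Poly_Mapping.keys f \<subseteq> lists (leavitt_gens Q); \<And>w. w \<in> Poly_Mapping.keys f \<Longrightarrow> word_degree w = n\<rbrakk> \<Longrightarrow>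
    L.coset f \<in> leavitt_alg_part Q n"
  by (auto simp: leavitt_alg_part_def free_simps)

lemma leavitt_part_cases:
  assumes "u \<in> leavitt_alg_part Q n"
  obtains f where "Poly_Mapping.keys f \<subseteq> lists (leavitt_gens Q)"
    "\<forall>w\<in>Poly_Mapping.keys f. word_degree w = n" "u = L.coset f"
  using assms by (auto simp: leavitt_alg_part_def free_simps)

interpretation LA: ring_algebra ring_of_type_algebra
  "leavitt_algebra Q :: ('k::field, (('v, 'a) leavitt_gen list \<Rightarrow>\<^sub>0 'k) set) module"
  by (rule leavitt_algebra_algebra)

lemma leavitt_decomposition:
  fixes u :: "(('v, 'a) leavitt_gen list \<Rightarrow>\<^sub>0 'k::field) set"
  assumes "u \<in> carrier (leavitt_algebra Q)"
  shows "\<exists>S. finite S \<and> (\<forall>n. n \<notin> S \<longrightarrow> leavitt_component n u = \<zero>\<^bsub>leavitt_algebra Q\<^esub>) \<and>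
    u = (\<Oplus>\<^bsub>leavitt_algebra Q\<^esub>n\<in>S. leavitt_component n u)"
proof -
  obtain f where f: "Poly_Mapping.keys f \<subseteq> lists (leavitt_gens Q)" "u = L.coset f"
    using assms by (rule leavitt_cases)
  let ?S = "word_degree ` Poly_Mapping.keys f"
  have closed: "(\<lambda>n. component word_degree n f) \<in> ?S \<rightarrow> carrier free_alg"
    using f(1) by (auto simp: free_simps keys_component)
  have "(\<Oplus>\<^bsub>leavitt_algebra Q\<^esub>n\<in>?S. leavitt_component n u) =
      (\<Oplus>\<^bsub>leavitt_algebra Q\<^esub>n\<in>?S. L.coset (component word_degree n f))"
    using f by (simp add: leavitt_component_coset)
  also have "\<dots> = L.coset (\<Oplus>\<^bsub>free_alg\<^esub>n\<in>?S. component word_degree n f)"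
    using L.coset_finsum[OF closed] by (simp add: L_quotient)
  also have "(\<Oplus>\<^bsub>free_alg\<^esub>n\<in>?S. component word_degree n f) = (\<Sum>n\<in>?S. component word_degree n f)"
    using closed by (intro finsum_eq_sum F.abelian_monoid_axioms) (simp_all add: free_simps)
  also have "\<dots> = f"
    by (rule sum_component)
  finally have "u = (\<Oplus>\<^bsub>leavitt_algebra Q\<^esub>n\<in>?S. leavitt_component n u)"
    using f(2) by simp
  moreover have "leavitt_component n u = \<zero>\<^bsub>leavitt_algebra Q\<^esub>" if "n \<notin> ?S" for n
    using f by (simp add: leavitt_component_coset component_outside[OF that] leavitt_zero)
  ultimately show ?thesis
    by (intro exI[of _ ?S]) simp
qed

lemma dgB_dg_algebra:
  "dg_algebra ring_of_type_algebra (dgB Q :: ('k::field, (('v, 'a) leavitt_gen list \<Rightarrow>\<^sub>0 'k) set) dg)"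
proof -
  let ?L = "leavitt_algebra Q :: ('k, (('v, 'a) leavitt_gen list \<Rightarrow>\<^sub>0 'k) set) module"
  let ?P = "leavitt_alg_part Q :: int \<Rightarrow> (('v, 'a) leavitt_gen list \<Rightarrow>\<^sub>0 'k) set set"
  have P: "?P n \<subseteq> carrier ?L" for n
    by (rule subsetI, elim leavitt_part_cases) (simp add: leavitt_coset_closed)
  have sub: "submodule (?P n) ring_of_type_algebra ?L" for n
  proof (rule LA.submoduleI)
    have smult: "c \<odot>\<^bsub>?L\<^esub> x \<in> ?P n" if "x \<in> ?P n" for c x
      using that
      by (elim leavitt_part_cases, simp add: leavitt_smult, intro leavitt_partI)
        (rule order_trans[OF keys_scale], simp, drule keys_scale[THEN subsetD], simp)
    then show "c \<odot>\<^bsub>?L\<^esub> x \<in> ?P n" if "x \<in> ?P n" for c x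
      using that .
    show "\<ominus>\<^bsub>?L\<^esub> x \<in> ?P n" if "x \<in> ?P n" for x
    proof -
      have x: "x \<in> carrier ?L"
        using that P by blast
      \<comment> \<open>Closure of a part under scalars is already known, so the negative is
        identified with the multiple by -1.\<close>
      have "(- 1) \<odot>\<^bsub>?L\<^esub> x \<oplus>\<^bsub>?L\<^esub> x = \<zero>\<^bsub>?L\<^esub>"
        using LA.smult_l_distr[of "- 1" 1 x] LA.smult_l_null[OF x] LA.smult_one[OF x] x by simp
      then have "\<ominus>\<^bsub>?L\<^esub> x = (- 1) \<odot>\<^bsub>?L\<^esub> x"
        using x by (intro LA.minus_equality LA.smult_closed) simp_all
      then show ?thesis
        using smult[OF that] by simp
    qed
    show "\<zero>\<^bsub>?L\<^esub> \<in> ?P n"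
      using leavitt_partI[of 0 n] by (simp add: leavitt_zero)
    show "x \<oplus>\<^bsub>?L\<^esub> y \<in> ?P n" if "x \<in> ?P n" "y \<in> ?P n" for x y
      using that
      by (elim leavitt_part_cases, simp add: leavitt_add, intro leavitt_partI)
        (rule order_trans[OF keys_add], simp, drule keys_add[THEN subsetD], auto)
  qed (rule P)
  have "dg_algebra ring_of_type_algebra (make_dg (opposite_algebra ?L) ?P (\<lambda>_. \<zero>\<^bsub>opposite_algebra ?L\<^esub>))"
  proof (rule dg_algebra_zero_diff)
    show "ring_algebra ring_of_type_algebra (opposite_algebra ?L)"
      by (rule opposite_ring_algebra) (rule leavitt_algebra_algebra)
    show "submodule (?P n) ring_of_type_algebra (opposite_algebra ?L)" for n
      by (rule submodule_cong[OF _ _ _ _ sub]) simp_all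
    show "\<exists>!c. (\<forall>n. c n \<in> ?P n) \<and> finite {n. c n \<noteq> \<zero>\<^bsub>opposite_algebra ?L\<^esub>} \<and>
        m = (\<Oplus>\<^bsub>opposite_algebra ?L\<^esub>n\<in>{n. c n \<noteq> \<zero>\<^bsub>opposite_algebra ?L\<^esub>}. c n)"
      if "m \<in> carrier (opposite_algebra ?L)" for m
      unfolding opposite_simps
    proof (rule LA.decomposition_by_projections[where \<pi> = leavitt_component])
      show "leavitt_component n x \<in> ?P n" if "x \<in> carrier ?L" for n x
        using that
        by (elim leavitt_cases, simp add: leavitt_component_coset, intro leavitt_partI)
          (simp_all add: keys_component le_infI1 Collect_conj_eq)
      show "leavitt_component n (x \<oplus>\<^bsub>?L\<^esub> y) = leavitt_component n x \<oplus>\<^bsub>?L\<^esub> leavitt_component n y"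
        if "x \<in> carrier ?L" "y \<in> carrier ?L" for n x y
        using that by (elim leavitt_cases) (simp add: leavitt_add leavitt_component_coset
            order_trans[OF keys_add] component_add keys_component_subset)
      show "leavitt_component n x = (if n = k then x else \<zero>\<^bsub>?L\<^esub>)" if "x \<in> ?P k" for n k x
        using that by (elim leavitt_part_cases)
          (simp add: leavitt_component_coset component_homogeneous leavitt_zero)
    qed (use that P leavitt_decomposition in auto)
    show "\<one>\<^bsub>opposite_algebra ?L\<^esub> \<in> ?P 0"
      using leavitt_partI[of "Poly_Mapping.single [] 1" 0] by (simp flip: leavitt_one)
    show "x \<otimes>\<^bsub>opposite_algebra ?L\<^esub> y \<in> ?P (m + n)" if "x \<in> ?P m" "y \<in> ?P n" for m n x y
    proof -
      obtain f where f: "Poly_Mapping.keys f \<subseteq> lists (leavitt_gens Q)"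
          "\<forall>w\<in>Poly_Mapping.keys f. word_degree w = m" "x = L.coset f"
        using \<open>x \<in> ?P m\<close> by (rule leavitt_part_cases)
      obtain g where g: "Poly_Mapping.keys g \<subseteq> lists (leavitt_gens Q)"
          "\<forall>w\<in>Poly_Mapping.keys g. word_degree w = n" "y = L.coset g"
        using \<open>y \<in> ?P n\<close> by (rule leavitt_part_cases)
      \<comment> \<open>The factors are swapped by the opposite multiplication; degrees add up the
        same way in either order.\<close>
      have "L.coset (g \<star> f) \<in> ?P (m + n)"
        using W.convolution_closed[OF g(1) f(1)] f(2) g(2)
        by (intro leavitt_partI) (auto elim!: keys_convolution)
      then show ?thesis
        using f g by (simp add: leavitt_mult)
    qed
  qed
  then show ?thesis
    by (simp add: dgB_def)
qed

end

context leavitt_quiver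
begin

section \<open>The action of the Leavitt path algebra\<close>

abbreviation word_ract ::
    "('v, 'a) leavitt_gen list \<Rightarrow> ('v, 'a, 'k::field) leavitt_cochain \<Rightarrow> ('v, 'a, 'k) leavitt_cochain" where
  "word_ract w z \<equiv> foldr (\<lambda>g m. gen_ract Q sp m g) w z"

lemma klinear_word_ract: "klinear (word_ract w)"
proof (induction w)
  case Nil
  show ?case
    by (simp add: klinear_def Modules.additive_def)
next
  case (Cons g w)
  then show ?case
    using klinear_compose[OF klinear_gen_ract] by simp
qed

lemma word_ract_closed:
  "\<lbrakk>z \<in> cochains D; w \<in> lists (leavitt_gens Q)\<rbrakk> \<Longrightarrow>
    word_ract w z \<in> cochains ((\<lambda>n. n + word_degree w) ` D)"
proof (induction w)
  case (Cons g w)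
  then have "gen_ract Q sp (word_ract w z) g \<in> cochains ((\<lambda>n. n + gen_degree g) ` (\<lambda>n. n + word_degree w) ` D)"
    by (intro gen_ract_closed) simp_all
  then show ?case
    by (simp add: image_image add_ac)
qed simp

lemma leavitt_diff_word_ract:
  "\<lbrakk>z \<in> cochains D; w \<in> lists (leavitt_gens Q)\<rbrakk> \<Longrightarrow>
    leavitt_diff Q sp (word_ract w z) = word_ract w (leavitt_diff Q sp z)"
  by (induction w) (simp_all add: leavitt_diff_gen_ract[OF word_ract_closed])

lemma free_ract_eq: "free_ract Q sp z f = lext (\<lambda>w c. cochain_scale c (word_ract w z)) f"
  by (simp add: free_ract_def lext_def)

lemma additive_free_ract: "Modules.additive (free_ract Q sp z)"
  unfolding free_ract_eq by (rule additive_lext) (rule additive_cochain_scale_left)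

lemma free_ract_single [simp]: "free_ract Q sp z (Poly_Mapping.single w c) = cochain_scale c (word_ract w z)"
  by (simp add: free_ract_eq)

lemma klinear_free_ract: "klinear (\<lambda>z. free_ract Q sp z f)"
  unfolding klinear_def free_ract_def
  by (auto intro!: Modules.additive.intro sum.cong
      simp: klinear_add[OF klinear_word_ract] klinear_scale[OF klinear_word_ract]
      cochain_scale_add_right sum.distrib cochain_scale_scale mult.commute
      Modules.additive.sum[OF additive_cochain_scale])

lemma free_ract_scale: "free_ract Q sp z (scale c f) = cochain_scale c (free_ract Q sp z f)"
  by (rule additive_eqI[where f = f])
    (auto intro: additive_compose additive_free_ract additive_scale additive_cochain_scale
      simp: cochain_scale_scale)

text \<open>For words this is \<open>foldr\<close> over \<open>u @ v\<close>, with \<open>v\<close>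
  acting first. The free algebra thus acts on the left, which is a right action of its
  opposite.\<close>

lemma free_ract_mult: "free_ract Q sp z (f \<star> g) = free_ract Q sp (free_ract Q sp z g) f"
proof (rule additive_eqI[where f = f])
  fix u
  let ?f = "Poly_Mapping.single u (Poly_Mapping.lookup f u)"
  show "free_ract Q sp z (?f \<star> g) = free_ract Q sp (free_ract Q sp z g) ?f"
    by (rule additive_eqI[where f = g])
      (auto intro: additive_compose additive_free_ract additive_convolution_right
        additive_compose[OF klinear_additive[OF klinear_free_ract] additive_free_ract]
        additive_compose[OF additive_cochain_scale
          additive_compose[OF klinear_additive[OF klinear_word_ract] additive_free_ract]]
        simp: cochain_scale_scale klinear_scale[OF klinear_word_ract])
qed (auto intro: additive_compose[OF additive_free_ract additive_convolution_left] additive_free_ract)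

lemma free_ract_closed:
  assumes "z \<in> cochains D" "Poly_Mapping.keys f \<subseteq> lists (leavitt_gens Q)"
    and "\<And>w n. w \<in> Poly_Mapping.keys f \<Longrightarrow> n \<in> D \<Longrightarrow> n + word_degree w \<in> D'"
  shows "free_ract Q sp z f \<in> cochains D'"
  unfolding free_ract_def
proof (intro cochains_sum cochains_scale)
  fix w assume w: "w \<in> Poly_Mapping.keys f"
  then have "word_ract w z \<in> cochains ((\<lambda>n. n + word_degree w) ` D)"
    using assms by (intro word_ract_closed) auto
  then show "word_ract w z \<in> cochains D'"
    using cochains_mono[of "(\<lambda>n. n + word_degree w) ` D" D'] assms(3)[OF w] by auto
qed

lemma leavitt_diff_free_ract:
  assumes "z \<in> cochains D" "Poly_Mapping.keys f \<subseteq> lists (leavitt_gens Q)"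
  shows "leavitt_diff Q sp (free_ract Q sp z f) = free_ract Q sp (leavitt_diff Q sp z) f"
  unfolding free_ract_def
  by (simp add: Modules.additive.sum[OF klinear_additive[OF klinear_leavitt_diff]]
      klinear_scale[OF klinear_leavitt_diff]
      leavitt_diff_word_ract[OF assms(1) subsetD[OF assms(2)]] cong: sum.cong)

text \<open>Tested on \<open>zeta x pq\<close>, every relation turns by
  \<open>gen_ract_pair_ract\<close> into one of the index identities with \<open>e\<close> equal to
  \<open>zeta x\<close>.\<close>

lemma free_ract_relation:
  fixes z :: "('v, 'a, 'k::field) leavitt_cochain"
  assumes r: "r \<in> leavitt_relations Q" and z: "z \<in> cochains D"
  shows "free_ract Q sp z r = 0"
proof -
  have "klinear (\<lambda>z. 0 :: ('v, 'a, 'k) leavitt_cochain)"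
    by (simp add: klinear_def Modules.additive_def)
  with z klinear_free_ract show ?thesis
  proof (rule cochains_eqI)
    fix pq and x :: "('v, 'a, 'k) functional"
    assume pq: "admissible Q sp pq"
    note free_ract_diff = Modules.additive.diff[OF additive_free_ract]
      and free_ract_sum = Modules.additive.sum[OF additive_free_ract]
      and free_ract_zero = Modules.additive.zero[OF additive_free_ract]
    from r show "free_ract Q sp (zeta x pq) r = 0"
      unfolding leavitt_relations_def
      by (elim UnE; (elim insertE emptyE CollectE exE conjE)?; hypsubst?)
        (simp_all add: free_ract_diff free_ract_sum free_ract_zero gen_ract_zeta gen_ract_pair_ract
          pair_ract_unit pair_ract_vertex_vertex pair_ract_head_arrow pair_ract_arrow_tail
          pair_ract_tail_ghost pair_ract_ghost_head pair_ract_arrow_ghost pair_ract_ghost_arrow pq)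
  qed
qed

lemma free_ract_leavitt_ideal:
  fixes z :: "('v, 'a, 'k::field) leavitt_cochain"
  assumes "f \<in> leavitt_ideal Q" and z: "z \<in> cochains UNIV"
  shows "free_ract Q sp z f = 0"
proof -
  interpret F: ring_algebra ring_of_type_algebra
    "leavitt_free Q :: ('k, ('v, 'a) leavitt_gen list \<Rightarrow>\<^sub>0 'k) module"
    by (rule free_algebra)
  \<comment> \<open>All cochains must be annihilated at once: \<open>f \<star> g\<close> applies
    \<open>f\<close> to \<open>free_ract Q sp z g\<close>, so the annihilator of a single
    \<open>z\<close> would only be a left ideal.\<close>
  let ?I = "{f \<in> carrier (leavitt_free Q). \<forall>z\<in>cochains UNIV.
    free_ract Q sp z f = (0 :: ('v, 'a, 'k) leavitt_cochain)}"
  have closed: "free_ract Q sp z f \<in> cochains UNIV"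
    if "z \<in> cochains UNIV" "Poly_Mapping.keys f \<subseteq> lists (leavitt_gens Q)"
    for z :: "('v, 'a, 'k) leavitt_cochain" and f
    using that by (rule free_ract_closed) simp
  have "ideal ?I (leavitt_free Q)"
    by (rule F.idealI_closed, blast)
      (clarsimp simp: free_simps free_ract_mult closed W.convolution_closed order_trans[OF keys_add]
        Modules.additive.zero[OF additive_free_ract] Modules.additive.add[OF additive_free_ract]
        klinear_zero[OF klinear_free_ract])+
  moreover have "leavitt_relations Q \<subseteq> ?I"
    using relations_homogeneous by (auto simp: free_simps free_ract_relation simp del: in_lists_conv_set)
  ultimately show ?thesis
    using leavitt_ideal_minimal assms by blast
qed

text \<open>Representatives differ by elements of the ideal, which act as 0, so they all give the
  same value; \<open>f\<close> itself lies in the coset, which makes the value in the definite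
  description unique.\<close>

lemma leavitt_ract_coset:
  fixes z :: "('v, 'a, 'k::field) leavitt_cochain"
  assumes z: "z \<in> cochains UNIV" and f: "Poly_Mapping.keys f \<subseteq> lists (leavitt_gens Q)"
  shows "leavitt_ract Q sp z (leavitt_ideal Q +>\<^bsub>leavitt_free Q\<^esub> f) = free_ract Q sp z f"
proof -
  interpret L: ideal "leavitt_ideal Q" "leavitt_free Q :: ('k, ('v, 'a) leavitt_gen list \<Rightarrow>\<^sub>0 'k) module"
    by (rule ideal_leavitt_ideal)
  have "free_ract Q sp z g = free_ract Q sp z f" if "g \<in> leavitt_ideal Q +>\<^bsub>leavitt_free Q\<^esub> f" for g
    using that free_ract_leavitt_ideal[OF _ z]
    by (auto simp: a_r_coset_def' free_simps Modules.additive.add[OF additive_free_ract])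
  moreover have "f \<in> leavitt_ideal Q +>\<^bsub>leavitt_free Q\<^esub> f"
    using f by (intro L.a_rcos_self) (simp add: free_simps)
  ultimately show ?thesis
    unfolding leavitt_ract_def by (intro the_equality ballI) metis+
qed

lemma leavitt_ract_elt:
  assumes "z \<in> cochains UNIV" "g \<in> leavitt_gens Q"
  shows "leavitt_ract Q sp z (leavitt_elt Q g) = gen_ract Q sp z g"
  using assms by (simp add: leavitt_elt_def leavitt_ract_coset)

section \<open>The injective Leavitt complex\<close>

lemma leavitt_complex_simps [simp]:
  "carrier (leavitt_complex Q sp) = cochains UNIV"
  "\<zero>\<^bsub>leavitt_complex Q sp\<^esub> = 0"
  "z \<oplus>\<^bsub>leavitt_complex Q sp\<^esub> w = z + w"
  "c \<odot>\<^bsub>leavitt_complex Q sp\<^esub> z = cochain_scale c z"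
  "part (leavitt_complex Q sp) n = cochains {n}"
  "diff (leavitt_complex Q sp) z = leavitt_diff Q sp z"
  by (simp_all add: leavitt_complex_def leavitt_carrier_eq leavitt_part_eq)

lemma leavitt_complex_module:
  "module ring_of_type_algebra (leavitt_complex Q sp :: ('k::field, ('v, 'a, 'k) leavitt_cochain) dg)"
proof (rule moduleI)
  show "cring (ring_of_type_algebra :: 'k ring)"
    by (rule cring_from_type_algebra)
  show "abelian_group (leavitt_complex Q sp :: ('k, ('v, 'a, 'k) leavitt_cochain) dg)"
    by (rule abelian_groupI) (auto simp: algebra_simps intro: bexI[of _ "- x" for x])
qed (auto simp: cochain_scale_add_left cochain_scale_add_right cochain_scale_scale)

lemma leavitt_complex_minus_zero: "\<ominus>\<^bsub>leavitt_complex Q sp\<^esub> 0 = (0 :: ('v, 'a, 'k::field) leavitt_cochain)"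
proof -
  interpret M: module ring_of_type_algebra "leavitt_complex Q sp :: ('k, ('v, 'a, 'k) leavitt_cochain) dg"
    by (rule leavitt_complex_module)
  show ?thesis
    by (rule M.minus_equality) simp_all
qed

lemma component_cochains:
  assumes "z \<in> cochains D"
  shows "component pair_degree n z \<in> cochains {n}"
  by (rule cochainsI) (use cochainsD[OF assms] in \<open>auto split: if_splits\<close>)

lemma leavitt_complex_kmodule:
  "dg_kmodule ring_of_type_algebra (leavitt_complex Q sp :: ('k::field, ('v, 'a, 'k) leavitt_cochain) dg)"
proof -
  let ?C = "leavitt_complex Q sp :: ('k, ('v, 'a, 'k) leavitt_cochain) dg"
  interpret M: module ring_of_type_algebra ?C
    by (rule leavitt_complex_module)
  have part: "cochains {n} \<subseteq> (cochains UNIV :: ('v, 'a, 'k) leavitt_cochain set)" for n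
    by (rule cochains_mono) simp
  show ?thesis
  proof (intro dg_kmodule.intro dg_kmodule_axioms.intro M.module_axioms)
    show "submodule (part ?C n) ring_of_type_algebra ?C" for n
    proof (rule M.submoduleI)
      show "\<ominus>\<^bsub>?C\<^esub> z \<in> part ?C n" if "z \<in> part ?C n" for z
      proof -
        have "\<ominus>\<^bsub>?C\<^esub> z = - z"
          using that part by (intro M.minus_equality) auto
        then show ?thesis
          using that by auto
      qed
    qed (use part in auto)
    show "\<exists>!c. (\<forall>n. c n \<in> part ?C n) \<and> finite {n. c n \<noteq> \<zero>\<^bsub>?C\<^esub>} \<and>
        z = (\<Oplus>\<^bsub>?C\<^esub>n\<in>{n. c n \<noteq> \<zero>\<^bsub>?C\<^esub>}. c n)" if "z \<in> carrier ?C" for z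
    proof (rule M.decomposition_by_projections[where \<pi> = "component pair_degree"])
      show "\<exists>S. finite S \<and> (\<forall>n. n \<notin> S \<longrightarrow> component pair_degree n z = \<zero>\<^bsub>?C\<^esub>) \<and>
          z = (\<Oplus>\<^bsub>?C\<^esub>n\<in>S. component pair_degree n z)" if z: "z \<in> carrier ?C" for z
      proof (intro exI conjI allI impI)
        have "(\<lambda>n. component pair_degree n z) \<in> pair_degree ` Poly_Mapping.keys z \<rightarrow> carrier ?C"
          using z part component_cochains by fastforce
        then have "(\<Oplus>\<^bsub>?C\<^esub>n\<in>pair_degree ` Poly_Mapping.keys z. component pair_degree n z) =
            (\<Sum>n\<in>pair_degree ` Poly_Mapping.keys z. component pair_degree n z)"
          by (intro finsum_eq_sum M.abelian_monoid_axioms) simp_all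
        then show "z = (\<Oplus>\<^bsub>?C\<^esub>n\<in>pair_degree ` Poly_Mapping.keys z. component pair_degree n z)"
          by (simp add: sum_component)
      qed (simp_all add: component_outside)
      show "component pair_degree n z = (if n = k then z else \<zero>\<^bsub>?C\<^esub>)" if "z \<in> part ?C k" for n k z
        unfolding leavitt_complex_simps
        by (rule component_homogeneous) (use that cochainsD(2)[of z "{k}"] in \<open>simp add: in_keys_iff\<close>)
    qed (use that part component_cochains in \<open>auto simp: component_add\<close>)
    show "diff ?C z \<in> part ?C (n + 1)" if "z \<in> part ?C n" for z n
      using leavitt_diff_closed[of z "{n}"] that by simp
  qed (auto simp: klinear_add[OF klinear_leavitt_diff] klinear_scale[OF klinear_leavitt_diff]
      leavitt_diff_diff)
qed

lemma leavitt_complex_right_dg_module: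
  "right_dg_module ring_of_type_algebra (dgB Q)
    (leavitt_complex Q sp :: ('k::field, ('v, 'a, 'k) leavitt_cochain) dg) (leavitt_ract Q sp)"
proof -
  let ?C = "leavitt_complex Q sp :: ('k, ('v, 'a, 'k) leavitt_cochain) dg"
  let ?B = "dgB Q :: ('k, (('v, 'a) leavitt_gen list \<Rightarrow>\<^sub>0 'k) set) dg"
  interpret C: dg_kmodule ring_of_type_algebra ?C
    by (rule leavitt_complex_kmodule)
  have B: "carrier ?B = carrier (leavitt_algebra Q)" "\<one>\<^bsub>?B\<^esub> = \<one>\<^bsub>leavitt_algebra Q\<^esub>"
    "ring.add ?B = ring.add (leavitt_algebra Q)" "module.smult ?B = module.smult (leavitt_algebra Q)"
    "b \<otimes>\<^bsub>?B\<^esub> b' = b' \<otimes>\<^bsub>leavitt_algebra Q\<^esub> b" "part ?B = leavitt_alg_part Q"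
    "diff ?B b = \<zero>\<^bsub>leavitt_algebra Q\<^esub>" for b b'
    by (simp_all add: dgB_def)
  have part: "cochains {n} \<subseteq> (cochains UNIV :: ('v, 'a, 'k) leavitt_cochain set)" for n
    by (rule cochains_mono) simp
  have closed: "free_ract Q sp z f \<in> cochains UNIV"
    if "z \<in> cochains UNIV" "Poly_Mapping.keys f \<subseteq> lists (leavitt_gens Q)"
    for z :: "('v, 'a, 'k) leavitt_cochain" and f
    using that by (rule free_ract_closed) simp
  \<comment> \<open>The second term of the Leibniz rule is the action of the differential of
    \<open>b\<close>, which is 0 in B.\<close>
  have zero: "leavitt_ract Q sp z \<zero>\<^bsub>leavitt_algebra Q\<^esub> = 0" if "z \<in> cochains UNIV"
    for z :: "('v, 'a, 'k) leavitt_cochain"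
    using that leavitt_ract_coset[of z 0]
    by (simp add: leavitt_zero Modules.additive.zero[OF additive_free_ract])
  have diff_closed: "leavitt_diff Q sp z \<in> cochains UNIV" if "z \<in> cochains UNIV"
    for z :: "('v, 'a, 'k) leavitt_cochain"
    using leavitt_diff_closed[OF that] cochains_mono[OF subset_UNIV] by blast
  show ?thesis
  proof (intro right_dg_module.intro right_dg_module_axioms.intro dgB_dg_algebra C.dg_kmodule_axioms;
      unfold B leavitt_complex_simps)
    fix z z' :: "('v, 'a, 'k) leavitt_cochain" and c :: 'k
      and b b' :: "(('v, 'a) leavitt_gen list \<Rightarrow>\<^sub>0 'k) set"
    assume z: "z \<in> cochains UNIV"
    show "leavitt_ract Q sp z \<one>\<^bsub>leavitt_algebra Q\<^esub> = z"
      using leavitt_ract_coset[OF z, of "Poly_Mapping.single [] 1"] by (simp flip: leavitt_one)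
    assume b: "b \<in> carrier (leavitt_algebra Q)"
    show "leavitt_ract Q sp z b \<in> cochains UNIV"
      using z b by (elim leavitt_cases) (simp add: leavitt_ract_coset closed)
    show "leavitt_ract Q sp z (c \<odot>\<^bsub>leavitt_algebra Q\<^esub> b) = cochain_scale c (leavitt_ract Q sp z b)"
      using z b by (elim leavitt_cases)
        (simp add: leavitt_ract_coset leavitt_smult free_ract_scale order_trans[OF keys_scale])
    show "leavitt_ract Q sp (cochain_scale c z) b = cochain_scale c (leavitt_ract Q sp z b)"
      using z b by (elim leavitt_cases)
        (simp add: leavitt_ract_coset klinear_scale[OF klinear_free_ract] cochains_scale)
    show "leavitt_ract Q sp (z + z') b = leavitt_ract Q sp z b + leavitt_ract Q sp z' b"
      if "z' \<in> cochains UNIV"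
      using z that b by (elim leavitt_cases)
        (simp add: leavitt_ract_coset klinear_add[OF klinear_free_ract] cochains_add)
    assume b': "b' \<in> carrier (leavitt_algebra Q)"
    show "leavitt_ract Q sp z (b \<oplus>\<^bsub>leavitt_algebra Q\<^esub> b') = leavitt_ract Q sp z b + leavitt_ract Q sp z b'"
      using z b b' by (elim leavitt_cases)
        (simp add: leavitt_ract_coset leavitt_add Modules.additive.add[OF additive_free_ract]
          order_trans[OF keys_add])
    show "leavitt_ract Q sp z (b' \<otimes>\<^bsub>leavitt_algebra Q\<^esub> b) = leavitt_ract Q sp (leavitt_ract Q sp z b) b'"
      using z b b' by (elim leavitt_cases)
        (simp add: leavitt_ract_coset leavitt_mult free_ract_mult closed W.convolution_closed)
  next
    fix z :: "('v, 'a, 'k) leavitt_cochain" and n i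
      and b :: "(('v, 'a) leavitt_gen list \<Rightarrow>\<^sub>0 'k) set"
    assume z: "z \<in> cochains {n}" and b: "b \<in> leavitt_alg_part Q i"
    then have z': "z \<in> cochains UNIV"
      using part by blast
    obtain f where f: "Poly_Mapping.keys f \<subseteq> lists (leavitt_gens Q)"
        "\<forall>w\<in>Poly_Mapping.keys f. word_degree w = i" "b = leavitt_ideal Q +>\<^bsub>leavitt_free Q\<^esub> f"
      using b by (rule leavitt_part_cases)
    then show "leavitt_ract Q sp z b \<in> cochains {n + i}"
      using free_ract_closed[OF z f(1)] by (simp add: leavitt_ract_coset z')
    show "leavitt_diff Q sp (leavitt_ract Q sp z b) = leavitt_ract Q sp (leavitt_diff Q sp z) b +
        sign_twist ?C n (leavitt_ract Q sp z \<zero>\<^bsub>leavitt_algebra Q\<^esub>)"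
      using z' f
      by (simp add: leavitt_complex_minus_zero leavitt_ract_coset diff_closed leavitt_diff_free_ract
          zero sign_twist_def)
  qed
qed

section \<open>The bimodule structure\<close>

lemma leavitt_lact_eq: "leavitt_lact Q a z =
    lext (\<lambda>pq x. zeta (inj_lact Q (path_source (snd pq)) a x) pq) z"
  by (simp add: leavitt_lact_def lext_def case_prod_beta)

lemma klinear_leavitt_lact: "klinear (leavitt_lact Q a)"
  unfolding leavitt_lact_eq
  by (rule klinear_lext)
    (auto intro!: Modules.additive.intro
      simp: inj_lact_additive inj_lact_scale Modules.additive.add[OF additive_zeta])

lemma leavitt_lact_zeta: "leavitt_lact Q a (zeta x pq) = zeta (inj_lact Q (path_source (snd pq)) a x) pq"
proof -
  have "inj_lact Q i a 0 = 0" for i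
    by (auto simp: inj_lact_def)
  then show ?thesis
    unfolding leavitt_lact_eq zeta_def[of x] by (subst lext_single) simp_all
qed

lemma admissible_source: "admissible Q sp pq \<Longrightarrow> path_source (snd pq) \<in> verts Q"
  using path_source_in_verts[of "snd pq"] by (cases pq) (simp add: admissible_def)

lemma leavitt_lact_closed:
  assumes "z \<in> cochains D" "a \<in> carrier (algA Q)"
  shows "leavitt_lact Q a z \<in> cochains D"
  using assms(1)
proof (induction rule: cochains_induct)
  case (zeta pq x)
  then show ?case
    using assms(2) by (auto simp: leavitt_lact_zeta intro!: cochains_zeta inj_lact_closed admissible_source)
qed (auto simp: klinear_zero[OF klinear_leavitt_lact] klinear_add[OF klinear_leavitt_lact])

text \<open>\<open>inj_lact\<close> depends on the vertex at which q starts. Generators keep this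
  vertex fixed, and \<open>pair_ract_cong\<close> restricts the comparison to pairs with this
  source.\<close>

lemma leavitt_lact_gen_ract:
  assumes "z \<in> cochains D" "g \<in> leavitt_gens Q"
  shows "leavitt_lact Q a (gen_ract Q sp z g) = gen_ract Q sp (leavitt_lact Q a z) g"
  using assms(1) klinear_compose[OF klinear_leavitt_lact klinear_gen_ract]
    klinear_compose[OF klinear_gen_ract klinear_leavitt_lact]
proof (rule cochains_eqI)
  fix pq x
  assume "admissible Q sp pq"
  then show "leavitt_lact Q a (gen_ract Q sp (zeta x pq) g) = gen_ract Q sp (leavitt_lact Q a (zeta x pq)) g"
    unfolding gen_ract_zeta leavitt_lact_zeta
      pair_ract_natural[OF klinear_additive[OF klinear_leavitt_lact]]
    using assms(2) by (rule pair_ract_cong) simp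
qed

lemma leavitt_lact_free_ract:
  assumes "z \<in> cochains D" "Poly_Mapping.keys f \<subseteq> lists (leavitt_gens Q)"
  shows "leavitt_lact Q a (free_ract Q sp z f) = free_ract Q sp (leavitt_lact Q a z) f"
proof -
  have "leavitt_lact Q a (word_ract w z) = word_ract w (leavitt_lact Q a z)"
    if "w \<in> lists (leavitt_gens Q)" for w
    using that by (induction w) (simp_all add: leavitt_lact_gen_ract[OF word_ract_closed[OF assms(1)]])
  then show ?thesis
    unfolding free_ract_def
    by (simp add: Modules.additive.sum[OF klinear_additive[OF klinear_leavitt_lact]]
        klinear_scale[OF klinear_leavitt_lact] subsetD[OF assms(2)] cong: sum.cong)
qed

text \<open>For each incoming arrow \<alpha> both sides acquire the scalar
  \<open>vertex_coeff (tail Q \<alpha>) a\<close>: one through the coordinate of \<open>x\<close> at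
  \<alpha>, the other through the action on \<open>e_sharp Q (tail Q \<alpha>)\<close>.\<close>

lemma leavitt_diff_lact:
  fixes z :: "('v, 'a, 'k::field) leavitt_cochain"
  assumes z: "z \<in> cochains D" and a: "a \<in> carrier (algA Q)"
  shows "leavitt_diff Q sp (leavitt_lact Q a z) = leavitt_lact Q a (leavitt_diff Q sp z)"
  using z klinear_compose[OF klinear_leavitt_diff klinear_leavitt_lact]
    klinear_compose[OF klinear_leavitt_lact klinear_leavitt_diff]
proof (rule cochains_eqI)
  fix pq and x :: "('v, 'a, 'k) functional"
  assume pq: "admissible Q sp pq" and x: "x \<in> inj_module Q (path_source (snd pq))"
  let ?i = "path_source (snd pq)"
  let ?e = "\<lambda>\<alpha>. zeta (e_sharp Q (tail Q \<alpha>)) :: _ \<Rightarrow> ('v, 'a, 'k) leavitt_cochain"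
  have "cochain_scale (inj_lact Q ?i a x (classA Q (arrow_path Q \<alpha>))) (pair_diff Q sp (?e \<alpha>) \<alpha> pq) =
      cochain_scale (x (classA Q (arrow_path Q \<alpha>))) (leavitt_lact Q a (pair_diff Q sp (?e \<alpha>) \<alpha> pq))"
    if \<alpha>: "\<alpha> \<in> in_arcs Q ?i" for \<alpha>
  proof -
    have "leavitt_lact Q a (pair_diff Q sp (?e \<alpha>) \<alpha> pq) =
        pair_diff Q sp (\<lambda>pq'. leavitt_lact Q a (?e \<alpha> pq')) \<alpha> pq"
      by (rule pair_diff_natural[OF klinear_additive[OF klinear_leavitt_lact]])
    also have "\<dots> = pair_diff Q sp (\<lambda>pq'. cochain_scale (vertex_coeff (tail Q \<alpha>) a) (?e \<alpha> pq')) \<alpha> pq"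
      using pq \<alpha> a by (intro pair_diff_cong) (auto simp: leavitt_lact_zeta inj_lact_e_sharp)
    also have "\<dots> = cochain_scale (vertex_coeff (tail Q \<alpha>) a) (pair_diff Q sp (?e \<alpha>) \<alpha> pq)"
      by (rule pair_diff_natural[OF additive_cochain_scale, symmetric])
    finally show ?thesis
      using inj_lact_arrow[of \<alpha> x a] \<alpha> x a by (simp add: cochain_scale_scale mult.commute)
  qed
  then show "leavitt_diff Q sp (leavitt_lact Q a (zeta x pq)) =
      leavitt_lact Q a (leavitt_diff Q sp (zeta x pq))"
    unfolding leavitt_lact_zeta leavitt_diff_zeta
    by (simp add: Modules.additive.sum[OF klinear_additive[OF klinear_leavitt_lact]]
        klinear_scale[OF klinear_leavitt_lact])
qed

lemma leavitt_complex_left_dg_module: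
  "left_dg_module ring_of_type_algebra (dgA Q)
    (leavitt_complex Q sp :: ('k::field, ('v, 'a, 'k) leavitt_cochain) dg) (leavitt_lact Q)"
proof -
  let ?C = "leavitt_complex Q sp :: ('k, ('v, 'a, 'k) leavitt_cochain) dg"
  let ?D = "dgA Q :: ('k, (('v, 'a) path \<Rightarrow>\<^sub>0 'k) set) dg"
  let ?A = "algA Q :: ('k, (('v, 'a) path \<Rightarrow>\<^sub>0 'k) set) module"
  interpret C: dg_kmodule ring_of_type_algebra ?C
    by (rule leavitt_complex_kmodule)
  interpret A: ring_algebra ring_of_type_algebra ?A
    by (rule algA_algebra)
  have D: "carrier ?D = carrier ?A" "\<one>\<^bsub>?D\<^esub> = \<one>\<^bsub>?A\<^esub>" "monoid.mult ?D = monoid.mult ?A"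
    "ring.add ?D = ring.add ?A" "module.smult ?D = module.smult ?A"
    "part ?D i = (if i = 0 then carrier ?A else {\<zero>\<^bsub>?A\<^esub>})" "diff ?D a = \<zero>\<^bsub>?A\<^esub>" for i a
    by (simp_all add: dgA_def)
  have part: "cochains {n} \<subseteq> (cochains UNIV :: ('v, 'a, 'k) leavitt_cochain set)" for n
    by (rule cochains_mono) simp
  have klinear_id: "klinear (\<lambda>z. z :: ('v, 'a, 'k) leavitt_cochain)"
    by (simp add: klinear_def Modules.additive_def)
  have klinear_plus: "klinear (\<lambda>z. S z + T z)" if "klinear S" "klinear T"
    for S T :: "('v, 'a, 'k) leavitt_cochain \<Rightarrow> ('v, 'a, 'k) leavitt_cochain"
    using that by (simp add: klinear_def Modules.additive_def cochain_scale_add_right)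
  have klinear_smult: "klinear (cochain_scale c)" for c :: 'k
    by (simp add: klinear_def additive_cochain_scale cochain_scale_scale mult.commute)
  have add: "leavitt_lact Q (a \<oplus>\<^bsub>?A\<^esub> a') z = leavitt_lact Q a z + leavitt_lact Q a' z"
    if "a \<in> carrier ?A" "a' \<in> carrier ?A" "z \<in> cochains UNIV" for a a' z
    using that(3) klinear_leavitt_lact klinear_plus[OF klinear_leavitt_lact klinear_leavitt_lact]
    by (rule cochains_eqI)
      (simp add: leavitt_lact_zeta inj_lact_add admissible_source that
        Modules.additive.add[OF additive_zeta])
  have zero: "leavitt_lact Q \<zero>\<^bsub>?A\<^esub> z = 0" if "z \<in> cochains UNIV" for z
    using add[of "\<zero>\<^bsub>?A\<^esub>" "\<zero>\<^bsub>?A\<^esub>" z] that by simp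
  show ?thesis
  proof (intro left_dg_module.intro left_dg_module_axioms.intro dgA_dg_algebra C.dg_kmodule_axioms;
      unfold D leavitt_complex_simps)
    fix z z' :: "('v, 'a, 'k) leavitt_cochain" and c :: 'k and a a'
    assume z: "z \<in> cochains UNIV"
    show "leavitt_lact Q \<one>\<^bsub>?A\<^esub> z = z"
      using z klinear_leavitt_lact klinear_id
      by (rule cochains_eqI) (simp add: leavitt_lact_zeta inj_lact_one admissible_source)
    assume a: "a \<in> carrier ?A"
    show "leavitt_lact Q a z \<in> cochains UNIV"
      using z a by (rule leavitt_lact_closed)
    show "leavitt_lact Q a (z + z') = leavitt_lact Q a z + leavitt_lact Q a z'"
      by (rule klinear_add[OF klinear_leavitt_lact])
    show "leavitt_lact Q (c \<odot>\<^bsub>?A\<^esub> a) z = cochain_scale c (leavitt_lact Q a z)"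
      using z klinear_leavitt_lact klinear_compose[OF klinear_smult klinear_leavitt_lact]
      by (rule cochains_eqI) (simp add: leavitt_lact_zeta inj_lact_smult admissible_source a)
    show "leavitt_lact Q a (cochain_scale c z) = cochain_scale c (leavitt_lact Q a z)"
      by (rule klinear_scale[OF klinear_leavitt_lact])
    assume a': "a' \<in> carrier ?A"
    show "leavitt_lact Q (a \<oplus>\<^bsub>?A\<^esub> a') z = leavitt_lact Q a z + leavitt_lact Q a' z"
      using a a' z by (rule add)
    show "leavitt_lact Q (a \<otimes>\<^bsub>?A\<^esub> a') z = leavitt_lact Q a (leavitt_lact Q a' z)"
      using z klinear_leavitt_lact klinear_compose[OF klinear_leavitt_lact klinear_leavitt_lact]
      by (rule cochains_eqI) (simp add: leavitt_lact_zeta inj_lact_mult admissible_source a a')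
  next
    fix z :: "('v, 'a, 'k) leavitt_cochain" and n i :: int and a
    assume a: "a \<in> (if i = 0 then carrier ?A else {\<zero>\<^bsub>?A\<^esub>})" and z: "z \<in> cochains {n}"
    then have z': "z \<in> cochains UNIV" "leavitt_diff Q sp z \<in> cochains UNIV"
      using part leavitt_diff_closed[OF z] by auto
    show "leavitt_lact Q a z \<in> cochains {i + n}"
      using a z z' by (auto simp: zero leavitt_lact_closed split: if_splits)
    show "leavitt_diff Q sp (leavitt_lact Q a z) = leavitt_lact Q \<zero>\<^bsub>?A\<^esub> z +
        sign_twist ?C i (leavitt_lact Q a (leavitt_diff Q sp z))"
      using a z'
      by (auto simp: leavitt_complex_minus_zero zero sign_twist_def leavitt_diff_lact
          klinear_zero[OF klinear_leavitt_diff]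
          split: if_splits)
  qed
qed

lemma leavitt_complex_dg_bimodule:
  "dg_bimodule ring_of_type_algebra (dgA Q) (dgB Q)
    (leavitt_complex Q sp :: ('k::field, ('v, 'a, 'k) leavitt_cochain) dg) (leavitt_lact Q)
    (leavitt_ract Q sp)"
proof (intro dg_bimodule.intro dg_bimodule_axioms.intro leavitt_complex_left_dg_module
    leavitt_complex_right_dg_module)
  fix z :: "('v, 'a, 'k) leavitt_cochain" and a b
  assume "a \<in> carrier (dgA Q :: ('k, (('v, 'a) path \<Rightarrow>\<^sub>0 'k) set) dg)"
    "b \<in> carrier (dgB Q :: ('k, (('v, 'a) leavitt_gen list \<Rightarrow>\<^sub>0 'k) set) dg)"
    "z \<in> carrier (leavitt_complex Q sp)"
  then have a: "a \<in> carrier (algA Q)" and b: "b \<in> carrier (leavitt_algebra Q)"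
    and z: "z \<in> cochains UNIV"
    by (simp_all add: dgA_def dgB_def)
  from b show "leavitt_ract Q sp (leavitt_lact Q a z) b = leavitt_lact Q a (leavitt_ract Q sp z b)"
    by (elim leavitt_cases)
      (simp add: leavitt_ract_coset z leavitt_lact_closed[OF z a] leavitt_lact_free_ract[OF z])
qed

end

theorem proposition3p6:
  fixes Q :: "('v, 'a) pre_digraph" and sp :: "'v \<Rightarrow> 'a"
  assumes "fin_digraph Q"
    and "\<forall>i\<in>verts Q. out_arcs Q i \<noteq> {}"
    and "\<forall>i\<in>verts Q. sp i \<in> out_arcs Q i"
  shows
    "(\<forall>i\<in>verts Q. \<forall>l. \<forall>(p, q)\<in>admissible_pairs Q sp l i.
        \<forall>x\<in>(inj_module Q i :: ('v, 'a, 'k::field) functional set).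
        \<forall>j\<in>verts Q. \<forall>\<beta>\<in>arcs Q.
          leavitt_diff Q sp (leavitt_ract Q sp (zeta x (p, q)) (leavitt_elt Q (Vertex j)))
            = leavitt_ract Q sp (leavitt_diff Q sp (zeta x (p, q))) (leavitt_elt Q (Vertex j)) \<and>
          leavitt_diff Q sp (leavitt_ract Q sp (zeta x (p, q)) (leavitt_elt Q (Arrow \<beta>)))
            = leavitt_ract Q sp (leavitt_diff Q sp (zeta x (p, q))) (leavitt_elt Q (Arrow \<beta>)) \<and>
          leavitt_diff Q sp (leavitt_ract Q sp (zeta x (p, q)) (leavitt_elt Q (Ghost \<beta>)))
            = leavitt_ract Q sp (leavitt_diff Q sp (zeta x (p, q))) (leavitt_elt Q (Ghost \<beta>)))
     \<and> right_dg_module (ring_of_type_algebra :: 'k ring) (dgB Q) (leavitt_complex Q sp)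
         (leavitt_ract Q sp)
     \<and> dg_bimodule (ring_of_type_algebra :: 'k ring) (dgA Q) (dgB Q) (leavitt_complex Q sp)
         (leavitt_lact Q) (leavitt_ract Q sp)"
proof -
  interpret leavitt_quiver Q sp
    using assms by (intro leavitt_quiver.intro quiver.intro leavitt_quiver_axioms.intro) auto
  have "leavitt_diff Q sp (leavitt_ract Q sp (zeta x (p, q)) (leavitt_elt Q g)) =
      leavitt_ract Q sp (leavitt_diff Q sp (zeta x (p, q))) (leavitt_elt Q g)"
    if "(p, q) \<in> admissible_pairs Q sp l i" "x \<in> inj_module Q i" "g \<in> leavitt_gens Q"
    for p q l i g and x :: "('v, 'a, 'k) functional"
  proof -
    have z: "zeta x (p, q) \<in> cochains UNIV"
      using that by (auto simp: admissible_pairs_def)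
    \<comment> \<open>The description of \<open>leavitt_ract\<close> by representatives holds on the
      carrier, and the right-hand side applies it to this differential.\<close>
    then have "leavitt_diff Q sp (zeta x (p, q)) \<in> cochains UNIV"
      using leavitt_diff_closed[OF z] cochains_mono[OF subset_UNIV] by blast
    then show ?thesis
      using z that(3) by (simp add: leavitt_ract_elt leavitt_diff_gen_ract[OF z])
  qed
  then show ?thesis
    using leavitt_complex_right_dg_module leavitt_complex_dg_bimodule by (auto simp: gens_closed)
qed

end
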